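(* A finite group $G$ is an ecut group if and only if the centre of every simple component of $\mathbb{Q}G$ is either $\mathbb{Q}$ or $\mathbb{Q}(\sqrt{-d})$ for some $d>0$, except possibly for one simple component, for which the centre may be either a real quadratic extension of $\mathbb{Q}$ or a degree $4$ extension of $\mathbb{Q}$ with no real embeddings.
   Context: For a finite group $G$, the group $\mathcal{Z}(\mathrm{U}(\mathbb{Z}G))$ of central units of the integral group ring $\mathbb{Z}G$ equals $\pm\mathcal{Z}(G)\times A_G$ with $A_G$ free abelian of finite rank; this rank is denoted $\rho(G)$. $G$ is called an ecut (extended cut) group if $\rho(G)\le 1$. The simple components of $\mathbb{Q}G$ are the simple factors $M_{n_i}(D_i)$ ($D_i$ division rings) in the Wedderburn decomposition $\mathbb{Q}G\cong\bigoplus_i M_{n_i}(D_i)$. *)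

theory Defs
  imports Complex_Main "HOL-Algebra.Algebra" "HOL-Algebra.Free_Abelian_Groups"
    "HOL-Algebra.Algebraic_Closure_Type" "HOL-Library.Extended_Nat"
begin

section \<open>Group rings and the rank of central units\<close>

text \<open>All functions on \<open>G\<close> are allowed, so this is the group ring \<open>RG\<close> only when \<open>G\<close> is finite.\<close>

definition group_ring :: "('r, 'm) ring_scheme \<Rightarrow> ('a, 'b) monoid_scheme \<Rightarrow> ('a \<Rightarrow> 'r) ring" where
  "group_ring R G =
    \<lparr>carrier = carrier G \<rightarrow>\<^sub>E carrier R,
     monoid.mult = (\<lambda>f h. \<lambda>x\<in>carrier G.
               \<Oplus>\<^bsub>R\<^esub>y\<in>carrier G. f y \<otimes>\<^bsub>R\<^esub> h (inv\<^bsub>G\<^esub> y \<otimes>\<^bsub>G\<^esub> x)),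
     one = (\<lambda>x\<in>carrier G. if x = \<one>\<^bsub>G\<^esub> then \<one>\<^bsub>R\<^esub> else \<zero>\<^bsub>R\<^esub>),
     ring.zero = (\<lambda>x\<in>carrier G. \<zero>\<^bsub>R\<^esub>),
     add = (\<lambda>f h. \<lambda>x\<in>carrier G. f x \<oplus>\<^bsub>R\<^esub> h x)\<rparr>"

definition group_ring_elt :: "('r, 'm) ring_scheme \<Rightarrow> ('a, 'b) monoid_scheme \<Rightarrow> 'a \<Rightarrow> 'a \<Rightarrow> 'r" where
  "group_ring_elt R G g = (\<lambda>x\<in>carrier G. if x = g then \<one>\<^bsub>R\<^esub> else \<zero>\<^bsub>R\<^esub>)"

text \<open>Used both for groups and, since ring records extend monoid records, for rings.\<close>

definition centre :: "('a, 'b) monoid_scheme \<Rightarrow> ('a, 'b) monoid_scheme" where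
  "centre M = M\<lparr>carrier := {z \<in> carrier M. \<forall>x\<in>carrier M. z \<otimes>\<^bsub>M\<^esub> x = x \<otimes>\<^bsub>M\<^esub> z}\<rparr>"

definition central_units :: "('a, 'b) monoid_scheme \<Rightarrow> ('a \<Rightarrow> int) monoid" where
  "central_units G = centre (units_of (group_ring \<Z> G))"

text \<open>\<open>\<plusminus>Z(G)\<close> inside \<open>\<int>G\<close>.\<close>

definition trivial_central_units :: "('a, 'b) monoid_scheme \<Rightarrow> ('a \<Rightarrow> int) set" where
  "trivial_central_units G =
    group_ring_elt \<Z> G ` carrier (centre G) \<union>
    (\<lambda>g. \<ominus>\<^bsub>group_ring \<Z> G\<^esub> group_ring_elt \<Z> G g) ` carrier (centre G)"

text \<open>\<open>A\<close> is a complement \<open>A\<^sub>G\<close> of rank \<open>r\<close>: the central units are the internal direct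
  product of \<open>\<plusminus>Z(G)\<close> and \<open>A\<close>, and \<open>A\<close> is free abelian of rank \<open>r\<close>.\<close>

definition free_complement :: "('a, 'b) monoid_scheme \<Rightarrow> ('a \<Rightarrow> int) set \<Rightarrow> nat \<Rightarrow> bool" where
  "free_complement G A r \<longleftrightarrow>
    subgroup A (central_units G) \<and>
    trivial_central_units G \<inter> A = {\<one>\<^bsub>central_units G\<^esub>} \<and>
    trivial_central_units G <#>\<^bsub>central_units G\<^esub> A = carrier (central_units G) \<and>
    (central_units G)\<lparr>carrier := A\<rparr> \<cong> free_Abelian_group {..<r}"

text \<open>For finite \<open>G\<close> the set below is a singleton: complements exist, and all of them are
  isomorphic to the central units modulo torsion. The infimum in \<^typ>\<open>enat\<close> picks out its
  element (and avoids an unspecified value in the absence of a complement).\<close>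

definition rho :: "('a, 'b) monoid_scheme \<Rightarrow> enat" where
  "rho G = Inf {enat r | r. \<exists>A. free_complement G A r}"

definition ecut :: "('a, 'b) monoid_scheme \<Rightarrow> bool" where
  "ecut G \<longleftrightarrow> rho G \<le> 1"


section \<open>Wedderburn decomposition and simple components\<close>

definition matrix_ring :: "nat \<Rightarrow> ('r, 'm) ring_scheme \<Rightarrow> (nat \<times> nat \<Rightarrow> 'r) ring" where
  "matrix_ring n R =
    \<lparr>carrier = {..<n} \<times> {..<n} \<rightarrow>\<^sub>E carrier R,
     monoid.mult = (\<lambda>A B. \<lambda>(i, j)\<in>{..<n} \<times> {..<n}. \<Oplus>\<^bsub>R\<^esub>k\<in>{..<n}. A (i, k) \<otimes>\<^bsub>R\<^esub> B (k, j)),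
     one = (\<lambda>(i, j)\<in>{..<n} \<times> {..<n}. if i = j then \<one>\<^bsub>R\<^esub> else \<zero>\<^bsub>R\<^esub>),
     ring.zero = (\<lambda>_\<in>{..<n} \<times> {..<n}. \<zero>\<^bsub>R\<^esub>),
     add = (\<lambda>A B. \<lambda>ij\<in>{..<n} \<times> {..<n}. A ij \<oplus>\<^bsub>R\<^esub> B ij)\<rparr>"

definition is_division_ring :: "('r, 'm) ring_scheme \<Rightarrow> bool" where
  "is_division_ring D \<longleftrightarrow>
    ring D \<and> \<one>\<^bsub>D\<^esub> \<noteq> \<zero>\<^bsub>D\<^esub> \<and> Units D = carrier D - {\<zero>\<^bsub>D\<^esub>}"

text \<open>A two-sided ideal \<open>B\<close> as a ring with its own identity element, which is
  not that of \<open>R\<close> unless \<open>B = R\<close>.\<close>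

definition component_ring :: "('r, 'm) ring_scheme \<Rightarrow> 'r set \<Rightarrow> ('r, 'm) ring_scheme" where
  "component_ring R B =
    R\<lparr>carrier := B, one := (THE e. e \<in> B \<and> (\<forall>x\<in>B. e \<otimes>\<^bsub>R\<^esub> x = x \<and> x \<otimes>\<^bsub>R\<^esub> e = x))\<rparr>"

text \<open>\<open>R\<close> is the internal direct sum of the ideals in \<open>\<B>\<close>, each of which is a matrix ring over a
  division ring. Taking \<open>D\<close> over the element type of \<open>R\<close> is no restriction, as \<open>D\<close> embeds
  (non-unitally) into \<open>M\<^sub>n(D)\<close>.\<close>

definition wedderburn_decomposition :: "('r, 'm) ring_scheme \<Rightarrow> 'r set set \<Rightarrow> bool" where
  "wedderburn_decomposition R \<B> \<longleftrightarrow>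
    finite \<B> \<and>
    (\<forall>B\<in>\<B>. ideal B R \<and>
       (\<exists>n\<ge>1. \<exists>D :: 'r ring. is_division_ring D \<and> component_ring R B \<simeq> matrix_ring n D)) \<and>
    (\<forall>x\<in>carrier R. \<exists>!c. c \<in> (\<Pi>\<^sub>E B\<in>\<B>. B) \<and> x = (\<Oplus>\<^bsub>R\<^esub>B\<in>\<B>. c B))"

text \<open>The set \<open>\<B>\<close> of ideals is uniquely determined by \<open>R\<close>. As components are ideals, isomorphic
  factors are counted separately.\<close>

definition simple_components :: "('r, 'm) ring_scheme \<Rightarrow> 'r set set" where
  "simple_components R = {B. \<exists>\<B>. wedderburn_decomposition R \<B> \<and> B \<in> \<B>}"


section \<open>The fields occurring as centres\<close>

abbreviation rat_ring :: "rat ring" where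
  "rat_ring \<equiv> ring_of_type_algebra"

abbreviation real_ring :: "real ring" where
  "real_ring \<equiv> ring_of_type_algebra"

abbreviation complex_ring :: "complex ring" where
  "complex_ring \<equiv> ring_of_type_algebra"

abbreviation rational_group_ring :: "('a, 'b) monoid_scheme \<Rightarrow> ('a \<Rightarrow> rat) ring" where
  "rational_group_ring G \<equiv> group_ring rat_ring G"

text \<open>\<open>\<rat>(\<surd>-d)\<close>\<close>

definition imaginary_quadratic_field :: "nat \<Rightarrow> complex ring" where
  "imaginary_quadratic_field d =
    complex_ring\<lparr>carrier := generate_field complex_ring (insert (csqrt (- of_nat d)) \<rat>)\<rparr>"

text \<open>For a field \<open>K\<close> of characteristic 0, its subfield \<open>\<rat>\<close> is the one generated by the empty set.\<close>

definition degree_over_Q :: "('r, 'm) ring_scheme \<Rightarrow> nat \<Rightarrow> bool" where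
  "degree_over_Q K n \<longleftrightarrow> ring.dimension K n (generate_field K {}) (carrier K)"

definition has_real_embedding :: "('r, 'm) ring_scheme \<Rightarrow> bool" where
  "has_real_embedding K \<longleftrightarrow> ring_hom K real_ring \<noteq> {}"

definition rational_or_imaginary_quadratic :: "('r, 'm) ring_scheme \<Rightarrow> bool" where
  "rational_or_imaginary_quadratic K \<longleftrightarrow>
    K \<simeq> rat_ring \<or> (\<exists>d>0. K \<simeq> imaginary_quadratic_field d)"

definition real_quadratic :: "('r, 'm) ring_scheme \<Rightarrow> bool" where
  "real_quadratic K \<longleftrightarrow> field K \<and> degree_over_Q K 2 \<and> has_real_embedding K"

definition totally_complex_quartic :: "('r, 'm) ring_scheme \<Rightarrow> bool" where
  "totally_complex_quartic K \<longleftrightarrow> field K \<and> degree_over_Q K 4 \<and> \<not> has_real_embedding K"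

end

theory Submission
  imports Defs "HOL-Library.Function_Algebras" "Jordan_Normal_Form.Determinant" "HOL-Computational_Algebra.Fundamental_Theorem_Algebra"
begin

text \<open>
  The centre of \<open>\<complex>G\<close> is spanned by its primitive central idempotents \<open>e\<close>, which correspond to the
  characters \<open>lam e\<close>. Such an \<open>e\<close> lies over exactly one primitive central idempotent \<open>\<epsilon>\<close> of \<open>\<rat>G\<close>, and
  the \<open>e\<close> over \<open>\<epsilon>\<close> are the embeddings into \<open>\<complex>\<close> of the field \<open>K \<epsilon>\<close>, the centre of the simple component
  \<open>\<rat>G \<epsilon>\<close>. As \<open>g \<mapsto> g\<^sup>-\<^sup>1\<close> induces complex conjugation under every embedding, \<open>K \<epsilon>\<close> is totally real or
  totally complex, so \<open>\<rat>\<close> and the imaginary quadratic fields are the fields \<open>K \<epsilon>\<close> with one place, and the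
  real quadratic and totally complex quartic ones are those with two places.

  The logarithmic embedding of the central units has kernel \<open>\<plusminus>Z(G)\<close>, because \<open>u u\<^sup>* = 1\<close> forces \<open>u = \<plusminus>g\<close>,
  and discrete image. If at most one \<open>K \<epsilon>\<close> has two places and the others have one, the image lies in a
  line, so the rank is at most one. Conversely, Dirichlet's argument yields for every place \<open>v\<close> of a
  \<open>K \<epsilon>\<close> with further places a central unit that is trivial in the other components and has absolute
  value less than one at all places of \<open>K \<epsilon>\<close> except \<open>v\<close>; if the rank is at most one, the logarithms of all
  units are proportional, and comparing signs excludes any other distribution of places.
\<close>

section \<open>Convolution algebras\<close>

text \<open>Semisimplicity and units are both handled by elementary means. The form
  \<open>ip\<close>, the coefficient at the identity of \<open>f \<star> star h\<close>, is definite
  over \<open>rat\<close> (trivial \<open>cj\<close>) as well as over \<open>complex\<close>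
  (conjugation); orthogonal projections with respect to it yield idempotent generators of ideals and
  quasi-inverses. Rings of algebraic integers do not occur: integrality means integer coefficients
  on the class sums. The obstacle is that the integral centre is in general not the product of its
  projections to the fields \<open>K \<epsilon>\<close>, so a norm or a unit of one component does
  not make sense integrally by itself. The remedy is a common denominator \<open>q\<close> making
  every \<open>q \<epsilon>\<close> integral: an integral \<open>y\<close> in
  \<open>K \<epsilon>\<close> is completed to \<open>y + q (1 - \<epsilon>)\<close>. For
  \<open>y\<close> nonzero its total norm is a nonzero integer, and a quotient of two such elements
  is 1 on all other components. The full unit theorem is not proved either: the signs of the
  logarithms of a few units exclude too many places, and conversely one logarithm with locally
  finite values already gives a cyclic complement.\<close>

definition fscale :: "'k::times \<Rightarrow> ('a \<Rightarrow> 'k) \<Rightarrow> 'a \<Rightarrow> 'k" where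
  "fscale c f = (\<lambda>x. c * f x)"

lemma fscale_apply: "fscale c f x = c * f x"
  by (simp add: fscale_def)

interpretation fvs: vector_space "fscale :: 'k::field \<Rightarrow> ('a \<Rightarrow> 'k) \<Rightarrow> 'a \<Rightarrow> 'k"
  by unfold_locales (auto simp: fun_eq_iff fscale_apply algebra_simps)

lemma sum_fun_apply: "(\<Sum>i\<in>I. f i) x = (\<Sum>i\<in>I. f i x)"
  by (induction I rule: infinite_finite_induct) auto

lemma minus_fun_apply' [simp]: "(f - g) x = f x - (g x :: 'b::ab_group_add)"
  by (simp add: fun_diff_def)

lemma uminus_fun_apply' [simp]: "(- f) x = - (f x :: 'b::ab_group_add)"
  by (simp add: fun_Compl_def)

locale fin_group = group +
  assumes finite_carrier [simp]: "finite (carrier G)"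
begin

text \<open>Elements of the group algebra are total functions vanishing off the carrier
  (\<open>galg\<close>), so that they can be added pointwise and compared as functions. The value 0
  off the carrier puts every product into \<open>galg\<close>, whatever the factors.\<close>

definition conv :: "('a \<Rightarrow> 'k::comm_ring_1) \<Rightarrow> ('a \<Rightarrow> 'k) \<Rightarrow> 'a \<Rightarrow> 'k" (infixl \<open>\<star>\<close> 70) where
  "f \<star> h = (\<lambda>x. if x \<in> carrier G then \<Sum>y\<in>carrier G. f y * h (inv y \<otimes> x) else 0)"

definition delta :: "'a \<Rightarrow> 'a \<Rightarrow> 'k::comm_ring_1" where
  "delta g = (\<lambda>x. if x = g then 1 else 0)"

definition galg :: "('a \<Rightarrow> 'k::comm_ring_1) set" where
  "galg = {f. \<forall>x. x \<notin> carrier G \<longrightarrow> f x = 0}"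

abbreviation e1 :: "'a \<Rightarrow> 'k::comm_ring_1" where "e1 \<equiv> delta \<one>"

lemma galgD: "f \<in> galg \<Longrightarrow> x \<notin> carrier G \<Longrightarrow> f x = 0"
  by (auto simp: galg_def)

lemma galg_eqI: "f \<in> galg \<Longrightarrow> h \<in> galg \<Longrightarrow> (\<And>x. x \<in> carrier G \<Longrightarrow> f x = h x) \<Longrightarrow> f = h"
  by (rule ext) (metis galgD)

lemma galg_closed [simp, intro]:
  "0 \<in> galg" "f \<in> galg \<Longrightarrow> h \<in> galg \<Longrightarrow> f + h \<in> galg" "f \<in> galg \<Longrightarrow> h \<in> galg \<Longrightarrow> f - h \<in> galg"
  "f \<in> galg \<Longrightarrow> - f \<in> galg" "f \<in> galg \<Longrightarrow> fscale c f \<in> galg" "a \<star> b \<in> galg"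
  by (auto simp: galg_def conv_def fscale_apply)

lemma galg_sum [intro]: "(\<And>i. i \<in> I \<Longrightarrow> f i \<in> galg) \<Longrightarrow> (\<Sum>i\<in>I. f i) \<in> galg"
  by (induction I rule: infinite_finite_induct) auto

lemma delta_galg [simp, intro]: "g \<in> carrier G \<Longrightarrow> delta g \<in> galg"
  by (auto simp: galg_def delta_def)

lemma conv_add_left: "(f + g) \<star> h = f \<star> h + g \<star> h"
  by (simp add: conv_def fun_eq_iff distrib_right sum.distrib)

lemma conv_add_right: "h \<star> (f + g) = h \<star> f + h \<star> g"
  by (simp add: conv_def fun_eq_iff distrib_left sum.distrib)

lemma conv_minus_left: "(- f) \<star> h = - (f \<star> h)"
  by (simp add: conv_def fun_eq_iff sum_negf)

lemma conv_minus_right: "h \<star> (- f) = - (h \<star> f)"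
  by (simp add: conv_def fun_eq_iff sum_negf)

lemma conv_diff_left: "(f - g) \<star> h = f \<star> h - g \<star> h"
  by (simp add: conv_def fun_eq_iff left_diff_distrib sum_subtractf)

lemma conv_diff_right: "h \<star> (f - g) = h \<star> f - h \<star> g"
  by (simp add: conv_def fun_eq_iff right_diff_distrib sum_subtractf)

lemma conv_zero_left [simp]: "0 \<star> h = 0"
  by (simp add: conv_def fun_eq_iff)

lemma conv_zero_right [simp]: "h \<star> 0 = 0"
  by (simp add: conv_def fun_eq_iff)

lemma conv_scale_left: "fscale c f \<star> h = fscale c (f \<star> h)"
  by (simp add: conv_def fun_eq_iff fscale_apply sum_distrib_left mult.assoc)

lemma conv_scale_right: "h \<star> fscale c f = fscale c (h \<star> f)"
  by (simp add: conv_def fun_eq_iff fscale_apply sum_distrib_left mult.left_commute)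

lemmas conv_distribs = conv_add_left conv_add_right conv_diff_left conv_diff_right
  conv_minus_left conv_minus_right

lemma conv_sum_left: "(\<Sum>i\<in>I. f i) \<star> h = (\<Sum>i\<in>I. f i \<star> h)"
  by (simp add: conv_def fun_eq_iff sum_fun_apply sum_distrib_right sum.swap[of _ I])

lemma conv_sum_right: "h \<star> (\<Sum>i\<in>I. f i) = (\<Sum>i\<in>I. h \<star> f i)"
  by (simp add: conv_def fun_eq_iff sum_fun_apply sum_distrib_left sum.swap[of _ I])

lemma sum_left_translate:
  assumes "g \<in> carrier G"
  shows "(\<Sum>y\<in>carrier G. f (g \<otimes> y)) = (\<Sum>y\<in>carrier G. f y)"
  by (rule sum.reindex_bij_witness[where i = "\<lambda>y. inv g \<otimes> y" and j = "\<lambda>y. g \<otimes> y"])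
     (use assms in \<open>auto simp: m_assoc[symmetric]\<close>)

lemma sum_inv: "(\<Sum>y\<in>carrier G. f (inv y)) = (\<Sum>y\<in>carrier G. f y)"
  by (rule sum.reindex_bij_witness[where i = "\<lambda>y. inv y" and j = "\<lambda>y. inv y"]) auto

lemma conv_assoc: "(f \<star> g) \<star> h = f \<star> (g \<star> h)"
proof
  fix x
  show "((f \<star> g) \<star> h) x = (f \<star> (g \<star> h)) x"
  proof (cases "x \<in> carrier G")
    case True
    have "((f \<star> g) \<star> h) x = (\<Sum>y\<in>carrier G. (\<Sum>z\<in>carrier G. f z * g (inv z \<otimes> y) * h (inv y \<otimes> x)))"
      using True by (simp add: conv_def sum_distrib_right)
    also have "\<dots> = (\<Sum>z\<in>carrier G. (\<Sum>y\<in>carrier G. f z * g (inv z \<otimes> y) * h (inv y \<otimes> x)))"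
      by (rule sum.swap)
    also have "\<dots> = (\<Sum>z\<in>carrier G. (\<Sum>w\<in>carrier G. f z * g (inv z \<otimes> (z \<otimes> w)) * h (inv (z \<otimes> w) \<otimes> x)))"
      by (rule sum.cong[OF refl], rule sum_left_translate[symmetric]) auto
    also have "\<dots> = (\<Sum>z\<in>carrier G. (\<Sum>w\<in>carrier G. f z * (g w * h (inv w \<otimes> (inv z \<otimes> x)))))"
      using True by (intro sum.cong refl) (simp add: m_assoc[symmetric] inv_mult_group mult.assoc)
    also have "\<dots> = (f \<star> (g \<star> h)) x"
      using True by (simp add: conv_def sum_distrib_left)
    finally show ?thesis .
  qed (simp add: conv_def)
qed

lemma delta_conv: "g \<in> carrier G \<Longrightarrow> x \<in> carrier G \<Longrightarrow> (delta g \<star> f) x = f (inv g \<otimes> x)"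
  by (simp add: conv_def delta_def if_distrib[of "\<lambda>u. u * _"] sum.delta cong: if_cong)

lemma conv_delta:
  assumes "g \<in> carrier G" "x \<in> carrier G"
  shows "(f \<star> delta g) x = f (x \<otimes> inv g)"
proof -
  have "inv y \<otimes> x = g \<longleftrightarrow> y = x \<otimes> inv g" if "y \<in> carrier G" for y
    using assms that inv_solve_left[of g y x] inv_solve_right[of y x g] by auto
  then have "(f \<star> delta g) x = (\<Sum>y\<in>carrier G. f y * (if y = x \<otimes> inv g then 1 else 0))"
    using assms by (simp add: conv_def delta_def cong: sum.cong)
  also have "\<dots> = f (x \<otimes> inv g)"
    using assms by (simp add: if_distrib[of "\<lambda>u. _ * u"] sum.delta cong: if_cong)
  finally show ?thesis .
qed

lemma conv_one_left [simp]: "f \<in> galg \<Longrightarrow> e1 \<star> f = f"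
  by (rule galg_eqI) (auto simp: delta_conv)

lemma conv_one_right [simp]: "f \<in> galg \<Longrightarrow> f \<star> e1 = f"
  by (rule galg_eqI) (auto simp: conv_delta)

lemma e1_idem [simp]: "e1 \<star> e1 = e1"
  by simp

lemma delta_conv_delta: "g \<in> carrier G \<Longrightarrow> h \<in> carrier G \<Longrightarrow> delta g \<star> delta h = delta (g \<otimes> h)"
  by (rule galg_eqI) (simp_all add: delta_conv, simp add: delta_def inv_solve_left' inv_solve_left)

lemma conv_at_one: "(f \<star> h) \<one> = (\<Sum>y\<in>carrier G. f y * h (inv y))"
  by (simp add: conv_def)

lemma conv_trace: "(f \<star> h) \<one> = (h \<star> f) \<one>"
  unfolding conv_at_one by (subst sum_inv[symmetric]) (auto intro!: sum.cong simp: mult.commute)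

lemma galg_expand: "f \<in> galg \<Longrightarrow> f = (\<Sum>g\<in>carrier G. fscale (f g) (delta g))"
  by (rule galg_eqI) (auto simp: delta_def[abs_def] if_distrib[of "\<lambda>u. _ * u"] sum.delta galg_def fscale_apply sum_fun_apply cong: if_cong)

text \<open>Class functions. By \<open>zalg_commute\<close> and \<open>zalgI\<close> they form
  exactly the centre of the algebra.\<close>

definition zalg :: "('a \<Rightarrow> 'k::comm_ring_1) set" where
  "zalg = {f \<in> galg. \<forall>x\<in>carrier G. \<forall>y\<in>carrier G. f (x \<otimes> y) = f (y \<otimes> x)}"

lemma zalg_galg: "z \<in> zalg \<Longrightarrow> z \<in> galg"
  by (simp add: zalg_def)

lemma zalg_swap: "z \<in> zalg \<Longrightarrow> x \<in> carrier G \<Longrightarrow> y \<in> carrier G \<Longrightarrow> z (x \<otimes> y) = z (y \<otimes> x)"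
  by (simp add: zalg_def)

text \<open>Replacing the summation variable \<open>y\<close> by \<open>x \<otimes> inv y\<close>
  exchanges the factors up to the value \<open>z (x \<otimes> inv y)\<close>, which for a class
  function is \<open>z (inv y \<otimes> x)\<close>.\<close>

lemma zalg_commute:
  assumes "z \<in> zalg"
  shows "z \<star> f = f \<star> z"
proof
  fix x
  show "(z \<star> f) x = (f \<star> z) x"
  proof (cases "x \<in> carrier G")
    case True
    have "(z \<star> f) x = (\<Sum>y\<in>carrier G. z y * f (inv y \<otimes> x))"
      using True by (simp add: conv_def)
    also have "\<dots> = (\<Sum>y\<in>carrier G. z (x \<otimes> y) * f (inv (x \<otimes> y) \<otimes> x))"
      using True by (simp add: sum_left_translate[where f = "\<lambda>y. z y * f (inv y \<otimes> x)"])
    also have "\<dots> = (\<Sum>y\<in>carrier G. z (x \<otimes> inv y) * f (inv (x \<otimes> inv y) \<otimes> x))"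
      by (rule sum_inv[symmetric])
    also have "\<dots> = (\<Sum>y\<in>carrier G. f y * z (inv y \<otimes> x))"
      using True assms by (intro sum.cong refl) (auto simp: inv_mult_group m_assoc zalg_def mult.commute)
    also have "\<dots> = (f \<star> z) x" using True by (simp add: conv_def)
    finally show ?thesis .
  qed (simp add: conv_def)
qed

lemma zalgI_delta:
  assumes f: "f \<in> galg" and c: "\<And>g. g \<in> carrier G \<Longrightarrow> f \<star> delta g = delta g \<star> f"
  shows "f \<in> zalg"
  unfolding zalg_def
proof (intro CollectI conjI ballI)
  fix x y assume xy: "x \<in> carrier G" "y \<in> carrier G"
  have "f (x \<otimes> y) = (f \<star> delta (inv y)) x" using xy by (simp add: conv_delta)
  also have "\<dots> = (delta (inv y) \<star> f) x" using xy c by simp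
  also have "\<dots> = f (y \<otimes> x)" using xy by (simp add: delta_conv)
  finally show "f (x \<otimes> y) = f (y \<otimes> x)" .
qed (rule f)

lemma zalgI: "f \<in> galg \<Longrightarrow> (\<And>h. h \<in> galg \<Longrightarrow> f \<star> h = h \<star> f) \<Longrightarrow> f \<in> zalg"
  by (rule zalgI_delta) auto

lemma zalg_closed [simp, intro]:
  "0 \<in> zalg" "f \<in> zalg \<Longrightarrow> h \<in> zalg \<Longrightarrow> f + h \<in> zalg" "f \<in> zalg \<Longrightarrow> h \<in> zalg \<Longrightarrow> f - h \<in> zalg"
  "f \<in> zalg \<Longrightarrow> - f \<in> zalg" "f \<in> zalg \<Longrightarrow> fscale c f \<in> zalg"
  by (auto simp: zalg_def galg_closed fscale_apply)

lemma e1_zalg [simp, intro]: "e1 \<in> zalg"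
  by (rule zalgI) auto

lemma conv_zalg [simp, intro]: "f \<in> zalg \<Longrightarrow> h \<in> zalg \<Longrightarrow> f \<star> h \<in> zalg"
  by (rule zalgI) (simp_all, metis conv_assoc zalg_commute)

lemma zalg_sum [intro]: "(\<And>i. i \<in> I \<Longrightarrow> f i \<in> zalg) \<Longrightarrow> (\<Sum>i\<in>I. f i) \<in> zalg"
  by (induction I rule: infinite_finite_induct) auto

lemma zalg_left_commute: "z \<in> zalg \<Longrightarrow> f \<star> (z \<star> h) = z \<star> (f \<star> h)"
  by (metis conv_assoc zalg_commute)

lemma map_conv:
  fixes \<phi> :: "'k::comm_ring_1 \<Rightarrow> 'l::comm_ring_1"
  assumes "\<phi> 0 = 0" "\<And>a b. \<phi> (a + b) = \<phi> a + \<phi> b" "\<And>a b. \<phi> (a * b) = \<phi> a * \<phi> b"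
  shows "\<phi> \<circ> (f \<star> h) = (\<phi> \<circ> f) \<star> (\<phi> \<circ> h)"
proof -
  have "\<phi> (sum k A) = (\<Sum>a\<in>A. \<phi> (k a))" for k :: "'a \<Rightarrow> 'k" and A
    by (induction A rule: infinite_finite_induct) (auto simp: assms)
  then show ?thesis by (auto simp: fun_eq_iff conv_def assms)
qed

section \<open>Dimension arguments and primitive central idempotents\<close>

lemma galg_span: "galg = fvs.span (delta ` carrier G :: ('a \<Rightarrow> 'k::field) set)"
proof
  show "fvs.span (delta ` carrier G) \<subseteq> (galg :: ('a \<Rightarrow> 'k) set)"
    by (rule fvs.span_minimal) (auto intro!: fvs.subspaceI)
  show "(galg :: ('a \<Rightarrow> 'k) set) \<subseteq> fvs.span (delta ` carrier G)"
  proof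
    fix f :: "'a \<Rightarrow> 'k" assume "f \<in> galg"
    then have "f = (\<Sum>g\<in>carrier G. fscale (f g) (delta g))" by (rule galg_expand)
    also have "\<dots> \<in> fvs.span (delta ` carrier G)"
      by (intro fvs.span_sum fvs.span_scale fvs.span_base) auto
    finally show "f \<in> fvs.span (delta ` carrier G)" .
  qed
qed

lemma independent_galg:
  assumes "fvs.independent B" "B \<subseteq> (galg :: ('a \<Rightarrow> 'k::field) set)"
  shows "finite B" "card B \<le> card (carrier G)"
proof -
  have "finite B \<and> card B \<le> card (delta ` carrier G :: ('a \<Rightarrow> 'k) set)"
    using assms galg_span by (intro fvs.independent_span_bound) auto
  then show "finite B" "card B \<le> card (carrier G)"
    using card_image_le[OF finite_carrier, of "delta :: _ \<Rightarrow> 'a \<Rightarrow> 'k"] by auto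
qed

lemma subspace_image_galg:
  fixes T :: "('a \<Rightarrow> 'k::field) \<Rightarrow> 'a \<Rightarrow> 'k"
  assumes "\<And>x y. T (x + y) = T x + T y" "\<And>c x. T (fscale c x) = fscale c (T x)"
  shows "fvs.subspace (T ` galg)"
proof (rule fvs.subspaceI)
  have "T 0 = fscale 0 (T 0)" using assms(2)[of 0 0] by (simp add: fvs.scale_zero_left)
  then show "0 \<in> T ` galg" by (metis fvs.scale_zero_left galg_closed(1) imageI)
next
  fix x y assume "x \<in> T ` galg" "y \<in> T ` galg"
  then obtain u v where "u \<in> galg" "v \<in> galg" "x = T u" "y = T v" by blast
  then show "x + y \<in> T ` galg" using assms(1)[of u v] by (metis galg_closed(2) imageI)
next
  fix c x assume "x \<in> T ` galg"
  then obtain u where "u \<in> galg" "x = T u" by blast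
  then show "fscale c x \<in> T ` galg" using assms(2)[of c u] by (metis galg_closed(5) imageI)
qed

lemma subspace_corner: "fvs.subspace ((\<star>) f ` (galg :: ('a \<Rightarrow> 'k::field) set))"
  by (rule subspace_image_galg) (simp_all add: conv_add_right conv_scale_right)

text \<open>If \<open>g\<close> lies strictly below \<open>f\<close>, the right ideal generated by
  \<open>g\<close> is strictly smaller than that of \<open>f\<close>, since only the latter contains
  \<open>f - g\<close>. Hence an idempotent in \<open>S\<close> whose right ideal has least
  dimension is minimal. The set \<open>S\<close> may consist of central or of arbitrary idempotents;
  both cases occur.\<close>

lemma minimal_idempotent:
  assumes S: "S \<noteq> {}" "S \<subseteq> {f. (f :: 'a \<Rightarrow> 'k::field) \<star> f = f}"
  obtains f where "f \<in> S" "\<And>g. g \<in> S \<Longrightarrow> f \<star> g = g \<Longrightarrow> g \<star> f = g \<Longrightarrow> g = f"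
proof -
  define rk :: "('a \<Rightarrow> 'k) \<Rightarrow> nat" where "rk f = fvs.dim ((\<star>) f ` galg)" for f
  have rk_less: "rk g < rk f" if "g \<star> g = g" "f \<star> f = f" "f \<star> g = g" "g \<star> f = g" "g \<noteq> f" for f g
  proof -
    obtain B where B: "B \<subseteq> (\<star>) g ` galg" "fvs.independent B" "(\<star>) g ` galg \<subseteq> fvs.span B" "card B = rk g"
      using fvs.basis_exists unfolding rk_def by metis
    obtain B' where B': "B' \<subseteq> (\<star>) f ` galg" "fvs.independent B'" "(\<star>) f ` galg \<subseteq> fvs.span B'" "card B' = rk f"
      using fvs.basis_exists unfolding rk_def by metis
    have fin: "finite B" "finite B'"
      using B(1) B'(1) by (auto intro!: independent_galg B(2) B'(2))
    have nin: "f - g \<notin> fvs.span B"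
    proof
      assume "f - g \<in> fvs.span B"
      moreover have "fvs.span B \<subseteq> (\<star>) g ` galg" by (rule fvs.span_minimal[OF B(1) subspace_corner])
      ultimately obtain x where "f - g = g \<star> x" by auto
      then have "f - g = g \<star> (f - g)" using that by (metis conv_assoc)
      then show False using that by (simp add: conv_diff_right)
    qed
    have "insert (f - g) B \<subseteq> (\<star>) f ` galg"
    proof -
      have "f - g = f \<star> (f - g)" using that by (simp add: conv_diff_right)
      moreover have "f - g \<in> galg" using that(1,2) galg_closed(6)[of f f] galg_closed(6)[of g g] by (intro galg_closed(3)) simp_all
      moreover have "g \<star> x = f \<star> (g \<star> x)" for x using that by (metis conv_assoc)
      ultimately have "f - g \<in> (\<star>) f ` galg" "(\<star>) g ` galg \<subseteq> (\<star>) f ` galg"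
        by (blast intro: image_eqI, blast intro: image_eqI)
      then show ?thesis using B(1) by blast
    qed
    moreover have "fvs.independent (insert (f - g) B)"
      by (rule fvs.independent_insertI[OF nin B(2)])
    ultimately have "card (insert (f - g) B) \<le> card B'"
      using fvs.independent_span_bound[OF fin(2), of "insert (f - g) B"] B'(3) by (meson order_trans)
    moreover have "f - g \<notin> B" using nin fvs.span_base by blast
    ultimately show ?thesis using fin B(4) B'(4) by simp
  qed
  obtain f where f: "f \<in> S" "\<And>g. g \<in> S \<Longrightarrow> rk f \<le> rk g"
    using S(1) ex_has_least_nat[of "\<lambda>f. f \<in> S" _ rk] by blast
  show ?thesis
  proof (rule that[OF f(1)], rule ccontr)
    fix g assume "g \<in> S" "f \<star> g = g" "g \<star> f = g" "g \<noteq> f"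
    then show False using rk_less[of g f] f S(2) by (force simp: not_le[symmetric])
  qed
qed

lemma orthogonal_idempotents_independent:
  assumes "finite F" "\<And>f. f \<in> F \<Longrightarrow> f \<star> f = f \<and> f \<noteq> (0 :: 'a \<Rightarrow> 'k::field)"
    "\<And>f g. f \<in> F \<Longrightarrow> g \<in> F \<Longrightarrow> f \<noteq> g \<Longrightarrow> f \<star> g = 0"
  shows "fvs.independent F"
proof (rule fvs.independent_if_scalars_zero[OF assms(1)])
  fix c f assume 0: "(\<Sum>x\<in>F. fscale (c x) x) = 0" and f: "f \<in> F"
  have "0 = f \<star> (\<Sum>x\<in>F. fscale (c x) x)" using 0 by simp
  also have "\<dots> = (\<Sum>x\<in>F. if x = f then fscale (c f) f else 0)"
    unfolding conv_sum_right using f assms(2,3) by (intro sum.cong) (auto simp: conv_scale_right)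
  also have "\<dots> = fscale (c f) f" using f assms(1) by simp
  finally show "c f = 0" using assms(2)[OF f] by (metis fvs.scale_eq_0_iff)
qed

text \<open>This bound yields the finiteness of \<open>PCI\<close> and the existence of maximal
  orthogonal families in \<open>prim_decomposition\<close>.\<close>

lemma orthogonal_idempotents_card:
  assumes "finite F" "\<And>f. f \<in> F \<Longrightarrow> f \<star> f = f \<and> f \<noteq> (0 :: 'a \<Rightarrow> 'k::field)"
    "\<And>f g. f \<in> F \<Longrightarrow> g \<in> F \<Longrightarrow> f \<noteq> g \<Longrightarrow> f \<star> g = 0"
  shows "card F \<le> card (carrier G)"
proof (rule independent_galg(2)[OF orthogonal_idempotents_independent[OF assms]])
  show "F \<subseteq> galg" using assms(2) galg_closed(6) by (metis subsetI)
qed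

text \<open>\<open>PCI\<close> stands for the primitive central idempotents.\<close>

definition PCI :: "('a \<Rightarrow> 'k::field) set" where
  "PCI = {e \<in> zalg. e \<star> e = e \<and> e \<noteq> 0 \<and> (\<forall>f\<in>zalg. f \<star> f = f \<longrightarrow> f \<star> e = f \<longrightarrow> f = 0 \<or> f = e)}"

lemma PCI_D:
  assumes "e \<in> PCI"
  shows "e \<in> zalg" "e \<star> e = e" "e \<noteq> 0" "e \<in> galg"
  using assms zalg_galg by (auto simp: PCI_def)

lemma PCI_primitive:
  "e \<in> PCI \<Longrightarrow> f \<in> zalg \<Longrightarrow> f \<star> f = f \<Longrightarrow> f \<star> e = f \<Longrightarrow> f \<noteq> 0 \<Longrightarrow> f = e"
  by (auto simp: PCI_def)

lemma PCI_below:
  assumes h: "h \<in> zalg" "h \<star> h = h" "h \<noteq> (0 :: 'a \<Rightarrow> 'k::field)"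
  obtains e where "e \<in> PCI" "e \<star> h = e"
proof -
  define S where "S = {g \<in> zalg. g \<star> g = g \<and> g \<noteq> 0 \<and> g \<star> h = g}"
  have "S \<noteq> {}" "S \<subseteq> {f. f \<star> f = f}" using h by (auto simp: S_def)
  then obtain e where e: "e \<in> S" "\<And>g. g \<in> S \<Longrightarrow> e \<star> g = g \<Longrightarrow> g \<star> e = g \<Longrightarrow> g = e"
    by (rule minimal_idempotent) blast
  show ?thesis
  proof (rule that)
    have "f = e" if "f \<in> zalg" "f \<star> f = f" "f \<star> e = f" "f \<noteq> 0" for f
    proof (rule e(2))
      show "f \<in> S" using that e(1) conv_assoc[of f e h] by (simp add: S_def)
      show "e \<star> f = f" using that zalg_commute[of f e] by simp
    qed fact
    then show "e \<in> PCI" using e(1) by (auto simp: PCI_def S_def)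
    show "e \<star> h = e" using e(1) by (simp add: S_def)
  qed
qed

lemma zalg_idem_mult:
  assumes "e \<in> zalg" "f \<in> zalg" "e \<star> e = e" "f \<star> f = f"
  shows "(e \<star> f) \<star> (e \<star> f) = e \<star> f" "(e \<star> f) \<star> e = e \<star> f" "(e \<star> f) \<star> f = e \<star> f"
  using assms by (metis conv_assoc zalg_commute)+

text \<open>The product is a central idempotent below both \<open>e\<close> and \<open>f\<close>; if
  it were nonzero, primitivity would make it equal to both.\<close>

lemma PCI_orth: "e \<in> PCI \<Longrightarrow> f \<in> PCI \<Longrightarrow> e \<noteq> f \<Longrightarrow> e \<star> f = 0"
  using zalg_idem_mult[of e f] PCI_D[of e] PCI_D[of f] PCI_primitive[of e "e \<star> f"] PCI_primitive[of f "e \<star> f"]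
  by (metis conv_zalg)

lemma PCI_mult: "e \<in> PCI \<Longrightarrow> f \<in> PCI \<Longrightarrow> e \<star> f = (if e = f then e else 0)"
  using PCI_orth PCI_D by auto

lemma finite_PCI [simp]: "finite (PCI :: ('a \<Rightarrow> 'k::field) set)"
proof (rule ccontr)
  assume "infinite (PCI :: ('a \<Rightarrow> 'k) set)"
  then obtain F where F: "F \<subseteq> (PCI :: ('a \<Rightarrow> 'k) set)" "card F = Suc (card (carrier G))" "finite F"
    using infinite_arbitrarily_large by blast
  have "card F \<le> card (carrier G)"
    by (rule orthogonal_idempotents_card) (use F PCI_orth PCI_D(2,3) in blast)+
  then show False using F by simp
qed

lemma PCI_independent: "fvs.independent (PCI :: ('a \<Rightarrow> 'k::field) set)"
  by (rule orthogonal_idempotents_independent) (auto simp: PCI_mult PCI_D)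

lemma PCI_sum_mult: "e \<in> PCI \<Longrightarrow> F \<subseteq> PCI \<Longrightarrow> e \<star> (\<Sum>f\<in>F. f) = (if e \<in> F then e else 0)"
proof -
  assume e: "e \<in> PCI" and F: "F \<subseteq> PCI"
  have "e \<star> (\<Sum>f\<in>F. f) = (\<Sum>f\<in>F. if f = e then e else 0)"
    unfolding conv_sum_right using e F by (intro sum.cong) (auto simp: PCI_mult subset_iff)
  then show ?thesis using finite_subset[OF F] by simp
qed

text \<open>Otherwise \<open>e1 - s\<close>, with \<open>s\<close> the sum, is a nonzero central
  idempotent and lies above some \<open>e\<close> in \<open>PCI\<close>; but
  \<open>e \<star> s = e\<close>, so that \<open>e \<star> (e1 - s) = 0\<close>.\<close>

lemma PCI_sum: "(\<Sum>e\<in>PCI. e) = (e1 :: 'a \<Rightarrow> 'k::field)"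
proof (rule ccontr)
  define s where "s = (\<Sum>e\<in>PCI. e :: 'a \<Rightarrow> 'k)"
  assume "(\<Sum>e\<in>PCI. e) \<noteq> (e1 :: 'a \<Rightarrow> 'k)"
  then have ne: "e1 - s \<noteq> 0" by (simp add: s_def)
  have sz: "s \<in> zalg" unfolding s_def by (auto simp: PCI_D)
  have ss: "s \<star> s = s"
  proof -
    have "s \<star> s = (\<Sum>e\<in>PCI. e \<star> s)" by (subst (1) s_def) (simp add: conv_sum_left)
    also have "\<dots> = (\<Sum>e\<in>PCI. e)" unfolding s_def by (intro sum.cong) (auto simp: PCI_sum_mult)
    finally show ?thesis by (simp add: s_def)
  qed
  obtain e where e: "e \<in> PCI" "e \<star> (e1 - s) = e"
  proof (rule PCI_below[OF _ _ ne])
    show "e1 - s \<in> zalg" using sz by simp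
    show "(e1 - s) \<star> (e1 - s) = e1 - s"
      using sz ss by (simp add: conv_diff_left conv_diff_right zalg_galg)
  qed
  have "e \<star> (e1 - s) = e - e" using e(1) by (simp add: conv_diff_right s_def PCI_sum_mult PCI_D)
  then show False using e PCI_D(3)[of e] by simp
qed

lemma PCI_decomp: "x \<in> galg \<Longrightarrow> x = (\<Sum>e\<in>PCI. x \<star> (e :: 'a \<Rightarrow> 'k::field))"
  by (simp add: conv_sum_right[symmetric] PCI_sum)

end

section \<open>The positive involution, orthogonal projections and semisimplicity\<close>

locale star_group_algebra = fin_group G for G :: "('a, 'b) monoid_scheme" (structure) +
  fixes cj :: "'k::field_char_0 \<Rightarrow> 'k"
  assumes cj_add: "cj (a + b) = cj a + cj b"
    and cj_mult: "cj (a * b) = cj a * cj b"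
    and cj_cj: "cj (cj a) = a"
    and cj_pos: "finite (A :: 'a set) \<Longrightarrow> (\<Sum>x\<in>A. f x * cj (f x)) = 0 \<Longrightarrow> x \<in> A \<Longrightarrow> f x = 0"
begin

lemma cj_0: "cj 0 = 0"
  using cj_add[of 0 0] by simp

lemma cj_sum: "cj (sum f A) = (\<Sum>a\<in>A. cj (f a))"
  by (induction A rule: infinite_finite_induct) (auto simp: cj_add cj_0)

definition star :: "('a \<Rightarrow> 'k) \<Rightarrow> 'a \<Rightarrow> 'k" where
  "star f = (\<lambda>x. if x \<in> carrier G then cj (f (inv x)) else 0)"

text \<open>By \<open>ip_explicit\<close> this is the standard form on functions. Written as a
  coefficient of a product, it shows at once that multiplication by \<open>star a\<close> is adjoint
  to multiplication by \<open>a\<close>, on either side; \<open>cj_pos\<close> makes it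
  definite.\<close>

definition ip :: "('a \<Rightarrow> 'k) \<Rightarrow> ('a \<Rightarrow> 'k) \<Rightarrow> 'k" where
  "ip f h = (f \<star> star h) \<one>"

lemma star_galg [simp, intro]: "star f \<in> galg"
  by (auto simp: star_def galg_def)

lemma star_star: "f \<in> galg \<Longrightarrow> star (star f) = f"
  by (auto simp: star_def fun_eq_iff galg_def cj_cj)

lemma star_conv: "star (f \<star> h) = star h \<star> star f"
proof
  fix x
  show "star (f \<star> h) x = (star h \<star> star f) x"
  proof (cases "x \<in> carrier G")
    case True
    have "(star h \<star> star f) x = (\<Sum>z\<in>carrier G. cj (h (inv z)) * cj (f (inv (inv z \<otimes> x))))"
      using True by (simp add: conv_def star_def)
    also have "\<dots> = (\<Sum>y\<in>carrier G. cj (h (inv (x \<otimes> y))) * cj (f (inv (inv (x \<otimes> y) \<otimes> x))))"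
      by (rule sum_left_translate[OF True, symmetric])
    also have "\<dots> = (\<Sum>y\<in>carrier G. cj (f y) * cj (h (inv y \<otimes> inv x)))"
      using True by (intro sum.cong refl) (auto simp: inv_mult_group m_assoc mult.commute)
    also have "\<dots> = star (f \<star> h) x"
      using True by (simp add: star_def conv_def cj_sum cj_mult)
    finally show ?thesis by simp
  qed (simp add: conv_def star_def)
qed

lemma ip_diff_left: "ip (f - g) h = ip f h - ip g h"
  by (simp add: ip_def conv_diff_left)

lemma ip_scale_left: "ip (fscale c f) h = c * ip f h"
  by (simp add: ip_def conv_scale_left fscale_apply)

lemma ip_zero_left [simp]: "ip 0 h = 0"
  by (simp add: ip_def)

lemma ip_sum_left: "ip (\<Sum>i\<in>I. f i) h = (\<Sum>i\<in>I. ip (f i) h)"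
  by (simp add: ip_def conv_sum_left sum_fun_apply)

lemma ip_explicit: "ip f h = (\<Sum>x\<in>carrier G. f x * cj (h x))"
  by (simp add: ip_def conv_at_one star_def)

lemma ip_sym: "ip h f = cj (ip f h)"
  by (simp add: ip_explicit cj_sum cj_mult cj_cj mult.commute)

lemma ip_self: "f \<in> galg \<Longrightarrow> ip f f = 0 \<Longrightarrow> f = 0"
proof (rule galg_eqI)
  fix x assume "ip f f = 0" "x \<in> carrier G"
  then show "f x = 0 x" using cj_pos[of "carrier G" f x] by (simp add: ip_explicit)
qed simp_all

lemma ip_adjoint_left: "ip (a \<star> x) y = ip x (star a \<star> y)" if "a \<in> galg"
  using that conv_trace[of a "x \<star> star y"] by (simp add: ip_def star_conv star_star conv_assoc)

lemma ip_adjoint_right: "ip (x \<star> a) y = ip x (y \<star> star a)" if "a \<in> galg"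
  using that by (simp add: ip_def star_conv star_star conv_assoc)

text \<open>The vectors are not normalised, because square roots are missing in \<open>rat\<close>;
  hence the division by \<open>ip b b\<close> in \<open>proj\<close>.\<close>

definition orth_set :: "('a \<Rightarrow> 'k) set \<Rightarrow> bool" where
  "orth_set B \<longleftrightarrow> finite B \<and> B \<subseteq> galg \<and> 0 \<notin> B \<and> (\<forall>b\<in>B. \<forall>b'\<in>B. b \<noteq> b' \<longrightarrow> ip b b' = 0)"

definition proj :: "('a \<Rightarrow> 'k) set \<Rightarrow> ('a \<Rightarrow> 'k) \<Rightarrow> 'a \<Rightarrow> 'k" where
  "proj B v = (\<Sum>b\<in>B. fscale (ip v b / ip b b) b)"

lemma ip_combination:
  assumes "orth_set B" "b \<in> B"
  shows "ip (\<Sum>x\<in>B. fscale (c x) x) b = c b * ip b b"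
proof -
  have "ip (\<Sum>x\<in>B. fscale (c x) x) b = (\<Sum>x\<in>B. if x = b then c b * ip b b else 0)"
    unfolding ip_sum_left ip_scale_left using assms by (intro sum.cong) (auto simp: orth_set_def)
  then show ?thesis using assms by (simp add: orth_set_def)
qed

lemma orth_ip_nonzero: "orth_set B \<Longrightarrow> b \<in> B \<Longrightarrow> ip b b \<noteq> 0"
  using ip_self by (auto simp: orth_set_def)

lemma orth_set_independent: "orth_set B \<Longrightarrow> fvs.independent B"
proof (rule fvs.independent_if_scalars_zero)
  fix c b assume "orth_set B" "(\<Sum>x\<in>B. fscale (c x) x) = 0" "b \<in> B"
  then show "c b = 0" using ip_combination[of B b c] orth_ip_nonzero by simp
qed (simp add: orth_set_def)

lemma proj_residual: "orth_set B \<Longrightarrow> b \<in> B \<Longrightarrow> ip (v - proj B v) b = 0"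
  unfolding ip_diff_left proj_def by (simp add: ip_combination orth_ip_nonzero)

text \<open>An orthogonal subset of \<open>S\<close> of maximal size is a basis: a nonzero residual
  \<open>v - proj B v\<close> could be added to it.\<close>

lemma orth_basis_exists:
  assumes S: "fvs.subspace S" "S \<subseteq> galg"
  obtains B where "orth_set B" "B \<subseteq> S" "\<And>v. v \<in> S \<Longrightarrow> v = proj B v"
proof -
  define P where "P = (\<lambda>B. orth_set B \<and> B \<subseteq> S)"
  have bd: "card B \<le> card (carrier G)" if "P B" for B
    using that independent_galg(2)[OF orth_set_independent[of B]] by (auto simp: P_def orth_set_def)
  have "P {}" by (simp add: P_def orth_set_def)
  then obtain B where B: "P B" "\<And>B'. P B' \<Longrightarrow> card B' \<le> card B"
    using ex_has_greatest_nat[of P "{}" card "Suc (card (carrier G))"] bd less_Suc_eq_le by (metis le_SucI)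
  then have oB: "orth_set B" "B \<subseteq> S" by (auto simp: P_def)
  have "v = proj B v" if "v \<in> S" for v
  proof (rule ccontr)
    define w where "w = v - proj B v"
    assume "v \<noteq> proj B v"
    then have "w \<noteq> 0" by (simp add: w_def)
    have "proj B v \<in> S"
      unfolding proj_def using S(1) oB(2) by (intro fvs.subspace_sum fvs.subspace_scale) auto
    then have wS: "w \<in> S" unfolding w_def using S(1) that by (intro fvs.subspace_diff)
    have wo: "ip w b = 0 \<and> ip b w = 0" if "b \<in> B" for b
      using proj_residual[OF oB(1) that, of v] ip_sym[of b w] by (simp add: w_def cj_0)
    have "w \<notin> B" using wo[of w] ip_self[of w] \<open>w \<noteq> 0\<close> wS S(2) by auto
    moreover have "P (insert w B)"
      using oB wS wo S(2) \<open>w \<noteq> 0\<close> by (auto simp: P_def orth_set_def)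
    ultimately show False using B(2)[of "insert w B"] oB(1) by (simp add: orth_set_def)
  qed
  with oB show ?thesis by (rule that)
qed

lemma projection_exists:
  assumes S: "fvs.subspace S" "S \<subseteq> galg"
  obtains p where "p \<in> S" "\<And>s. s \<in> S \<Longrightarrow> ip (v - p) s = 0"
proof -
  obtain B where B: "orth_set B" "B \<subseteq> S" "\<And>v. v \<in> S \<Longrightarrow> v = proj B v"
    using orth_basis_exists[OF S] by blast
  show ?thesis
  proof (rule that)
    show "proj B v \<in> S"
      unfolding proj_def using S(1) B(2) by (intro fvs.subspace_sum fvs.subspace_scale) auto
    fix s assume "s \<in> S"
    have *: "ip b (v - proj B v) = 0" if "b \<in> B" for b
      using proj_residual[OF B(1) that, of v] ip_sym[of b "v - proj B v"] by (simp add: cj_0)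
    have "ip s (v - proj B v) = ip (proj B s) (v - proj B v)" using B(3)[OF \<open>s \<in> S\<close>] by simp
    also have "\<dots> = 0" by (subst proj_def) (simp add: ip_sum_left ip_scale_left *)
    finally show "ip (v - proj B v) s = 0" using ip_sym[of "v - proj B v" s] by (simp add: cj_0)
  qed
qed

text \<open>Von Neumann regularity. Let \<open>p = a \<star> x\<close> be the orthogonal projection
  of 1 to the left ideal generated by \<open>x\<close>. Then \<open>w = x \<star> (e1 - p)\<close>
  lies in this ideal and is orthogonal to itself, because \<open>x\<close> can be moved to the other
  side of \<open>ip\<close> as \<open>star x\<close>. So \<open>w = 0\<close>.\<close>

lemma regular:
  fixes x :: "'a \<Rightarrow> 'k"
  assumes x: "x \<in> galg"
  obtains a where "a \<in> galg" "x \<star> a \<star> x = x"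
proof -
  define S where "S = (\<lambda>a. a \<star> x) ` galg"
  have "fvs.subspace S"
    unfolding S_def by (rule subspace_image_galg) (simp_all add: conv_add_left conv_scale_left)
  moreover have Sg: "S \<subseteq> galg" by (auto simp: S_def)
  ultimately obtain p where p: "p \<in> S" "\<And>s. s \<in> S \<Longrightarrow> ip (e1 - p) s = 0"
    by (rule projection_exists[where v = e1]) blast
  then obtain a where a: "a \<in> galg" "p = a \<star> x" by (auto simp: S_def)
  have ideal: "b \<star> s \<in> S" if "s \<in> S" for b s
    using that by (force simp: S_def conv_assoc[symmetric])
  define w where "w = x \<star> (e1 - p)"
  have "w = (e1 - x \<star> a) \<star> x" using x by (simp add: w_def a conv_distribs conv_assoc)
  then have wS: "w \<in> S" by (simp add: S_def)
  have "ip w w = ip (e1 - p) (star x \<star> w)" unfolding w_def by (rule ip_adjoint_left[OF x])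
  also have "\<dots> = 0" by (intro p(2) ideal wS)
  finally have "w = 0" using ip_self wS Sg by blast
  then have "x \<star> a \<star> x = x" using x by (simp add: w_def conv_distribs a conv_assoc)
  with a(1) show ?thesis by (rule that)
qed

text \<open>Let \<open>p\<close> be the orthogonal projection of 1 to \<open>I\<close>. For
  \<open>x\<close> in \<open>I\<close>, both \<open>x \<star> (e1 - p)\<close> and
  \<open>(e1 - p) \<star> x\<close> lie in \<open>I\<close> and are orthogonal to themselves, by the
  two adjunction rules. Thus \<open>p\<close> is a two-sided identity of \<open>I\<close>, and the
  identity of a two-sided ideal is central.\<close>

lemma ideal_idempotent:
  fixes I :: "('a \<Rightarrow> 'k) set"
  assumes I: "fvs.subspace I" "I \<subseteq> galg" "\<And>a x. a \<in> galg \<Longrightarrow> x \<in> I \<Longrightarrow> a \<star> x \<in> I"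
    "\<And>a x. a \<in> galg \<Longrightarrow> x \<in> I \<Longrightarrow> x \<star> a \<in> I"
  obtains p where "p \<in> I" "p \<in> zalg" "p \<star> p = p" "\<And>x. x \<in> I \<Longrightarrow> x \<star> p = x"
proof -
  obtain p where p: "p \<in> I" "\<And>s. s \<in> I \<Longrightarrow> ip (e1 - p) s = 0"
    using projection_exists[OF I(1,2), where v = e1] by blast
  have pg: "p \<in> galg" using p(1) I(2) by auto
  have right: "x \<star> p = x" if x: "x \<in> I" for x
  proof -
    have xg: "x \<in> galg" using x I(2) by auto
    have wI: "x \<star> (e1 - p) \<in> I" using x pg by (intro I(4)) auto
    have "ip (x \<star> (e1 - p)) (x \<star> (e1 - p)) = ip (e1 - p) (star x \<star> (x \<star> (e1 - p)))"
      by (rule ip_adjoint_left[OF xg])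
    also have "\<dots> = 0" by (intro p(2) I(3) wI) auto
    finally have "x \<star> (e1 - p) = 0" using ip_self wI I(2) by blast
    then show ?thesis using xg by (simp add: conv_distribs)
  qed
  have left: "p \<star> x = x" if x: "x \<in> I" for x
  proof -
    have xg: "x \<in> galg" using x I(2) by auto
    have wI: "(e1 - p) \<star> x \<in> I" using x pg by (intro I(3)) auto
    have "ip ((e1 - p) \<star> x) ((e1 - p) \<star> x) = ip (e1 - p) ((e1 - p) \<star> x \<star> star x)"
      by (rule ip_adjoint_right[OF xg])
    also have "\<dots> = 0" by (intro p(2) I(4) wI) auto
    finally have "(e1 - p) \<star> x = 0" using ip_self wI I(2) by blast
    then show ?thesis using xg by (simp add: conv_distribs)
  qed
  have "p \<in> zalg"
  proof (rule zalgI[OF pg])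
    fix h :: "'a \<Rightarrow> 'k" assume h: "h \<in> galg"
    have "p \<star> h = p \<star> h \<star> p" using right[OF I(4)[OF h p(1)]] by simp
    also have "\<dots> = h \<star> p" using left[OF I(3)[OF h p(1)]] by (simp add: conv_assoc)
    finally show "p \<star> h = h \<star> p" .
  qed
  with p(1) right show ?thesis by (intro that) auto
qed

text \<open>The centre of a component is a field: the ideal generated by the central element
  \<open>y\<close> has a central idempotent \<open>p\<close> as identity, which is nonzero and below
  \<open>e\<close>, hence equal to \<open>e\<close>.\<close>

lemma PCI_inverse:
  assumes e: "e \<in> PCI" and y: "y \<in> zalg" "y \<star> e = y" "y \<noteq> (0 :: 'a \<Rightarrow> 'k)"
  obtains a where "a \<in> zalg" "a \<star> e = a" "a \<star> y = e"
proof -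
  define I where "I = (\<lambda>a. a \<star> y) ` galg"
  have "fvs.subspace I"
    unfolding I_def by (rule subspace_image_galg) (simp_all add: conv_add_left conv_scale_left)
  moreover have "I \<subseteq> galg" by (auto simp: I_def)
  moreover have "a \<star> x \<in> I" if "a \<in> galg" "x \<in> I" for a x
    using that by (force simp: I_def conv_assoc[symmetric])
  moreover have "x \<star> a \<in> I" if ax: "a \<in> galg" "x \<in> I" for a x
  proof -
    obtain b where "x = b \<star> y" using ax(2) by (auto simp: I_def)
    then have "x \<star> a = (b \<star> a) \<star> y" using y(1) by (metis conv_assoc zalg_commute)
    then show ?thesis by (auto simp: I_def)
  qed
  ultimately obtain p where p: "p \<in> I" "p \<in> zalg" "p \<star> p = p" "\<And>x. x \<in> I \<Longrightarrow> x \<star> p = x"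
    by (rule ideal_idempotent) auto
  obtain b where b: "b \<in> galg" "p = b \<star> y" using p(1) by (auto simp: I_def)
  have "y \<in> I" unfolding I_def using y(1) by (intro image_eqI[where x = e1]) (auto simp: zalg_galg)
  then have "p \<noteq> 0" using p(4) y(3) by force
  moreover have "p \<star> e = p" unfolding b using y(2) by (simp add: conv_assoc)
  ultimately have pe: "p = e" using PCI_primitive[OF e p(2,3)] by blast
  \<comment> \<open>The cofactor \<open>b\<close> may reach outside the component and is not known
    to be central. Cut down by \<open>e\<close>, it becomes the inverse of \<open>y\<close> in the
    component, and the inverse of a central element is central.\<close>
  define a where "a = b \<star> e"
  have ay: "a \<star> y = e"
    using b pe y(2) zalg_commute[OF PCI_D(1)[OF e]] by (simp add: a_def conv_assoc)
  have ae: "a \<star> e = a" using PCI_D(2)[OF e] by (simp add: a_def conv_assoc)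
  have ya: "y \<star> a = e" using ay zalg_commute[OF y(1)] by simp
  have ez: "e \<star> h = h \<star> e" for h using zalg_commute[OF PCI_D(1)[OF e]] .
  have "a \<in> zalg"
  proof (rule zalgI)
    fix h :: "'a \<Rightarrow> 'k" assume h: "h \<in> galg"
    have "a \<star> h = a \<star> e \<star> h" using ae by simp
    also have "\<dots> = a \<star> h \<star> (y \<star> a)" by (simp add: conv_assoc ez ya)
    also have "\<dots> = a \<star> (h \<star> y) \<star> a" by (simp add: conv_assoc)
    also have "\<dots> = a \<star> (y \<star> h) \<star> a" using zalg_commute[OF y(1), of h] by simp
    also have "\<dots> = e \<star> h \<star> a" using ay by (simp add: conv_assoc[symmetric])
    also have "\<dots> = h \<star> (a \<star> e)" by (simp add: conv_assoc ez)
    finally show "a \<star> h = h \<star> a" using ae by simp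
  qed (simp add: a_def)
  with ae ay show ?thesis by (intro that)
qed

end

section \<open>Characters of the complex centre\<close>

context fin_group
begin

sublocale C: star_group_algebra G cnj
proof
  fix A :: "'a set" and f :: "'a \<Rightarrow> complex" and x
  assume A: "finite A" and s: "(\<Sum>x\<in>A. f x * cnj (f x)) = 0" and x: "x \<in> A"
  have "(\<Sum>x\<in>A. f x * cnj (f x)) = of_real (\<Sum>x\<in>A. (cmod (f x))\<^sup>2)"
    by (simp only: of_real_sum complex_norm_square)
  then have "(\<Sum>x\<in>A. (cmod (f x))\<^sup>2) = 0" using s by (metis of_real_eq_0_iff)
  then show "f x = 0" using A x by (simp add: sum_nonneg_eq_0_iff)
qed auto

sublocale Q: star_group_algebra G "\<lambda>x::rat. x"
proof
  fix A :: "'a set" and f :: "'a \<Rightarrow> rat" and x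
  assume A: "finite A" and s: "(\<Sum>x\<in>A. f x * f x) = 0" and x: "x \<in> A"
  then show "f x = 0" by (simp add: sum_nonneg_eq_0_iff)
qed auto

text \<open>The field cut out by \<open>e\<close> is finite over the algebraically closed field of
  complex numbers. Concretely, \<open>y = x \<star> e\<close> is annihilated by a nonzero
  polynomial; linear factors \<open>y - z e\<close> are split off, each being zero or invertible,
  and one of them must vanish because constants do not annihilate \<open>e\<close>.\<close>

lemma PCI_eigenvalue:
  fixes x :: "'a \<Rightarrow> complex"
  assumes e: "e \<in> PCI" and x: "x \<in> zalg"
  shows "\<exists>c. x \<star> e = fscale c e"
proof -
  define y where "y = x \<star> e"
  \<comment> \<open>Powers of \<open>y\<close> inside the component, so that the power 0 is
    \<open>e\<close>; accordingly \<open>ev p\<close> is the value of the polynomial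
    \<open>p\<close> at \<open>y\<close>.\<close>
  define pw where "pw n = ((\<lambda>f. y \<star> f) ^^ n) e" for n
  define ev where "ev p = (\<Sum>i\<le>degree p. fscale (coeff p i) (pw i))" for p
  have yz: "y \<in> zalg" using x PCI_D(1)[OF e] by (simp add: y_def)
  have ye: "y \<star> e = y" using PCI_D(2)[OF e] by (simp add: y_def conv_assoc)
  have pw0: "pw 0 = e" and pwS: "pw (Suc n) = y \<star> pw n" for n by (simp_all add: pw_def)
  have pwz: "pw n \<in> zalg" for n by (induction n) (use yz PCI_D(1)[OF e] in \<open>simp_all add: pw0 pwS\<close>)
  have pwe: "e \<star> pw n = pw n" for n
  proof (induction n)
    case (Suc n)
    show ?case using zalg_left_commute[OF yz, of e "pw n"] Suc by (simp add: pwS)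
  qed (simp add: pw0 PCI_D(2)[OF e])
  have ev_bound: "ev p = (\<Sum>i\<le>N. fscale (coeff p i) (pw i))" if "degree p \<le> N" for p N
    unfolding ev_def using that by (intro sum.mono_neutral_left) (auto simp: coeff_eq_0)
  have eve: "e \<star> ev p = ev p" for p
    by (simp add: ev_def conv_sum_right conv_scale_right pwe)
  have ev_lin: "ev ([:- z, 1:] * q) = (y - fscale z e) \<star> ev q" for z q
  proof -
    define N where "N = Suc (degree q)"
    have d: "degree ([:- z, 1:] * q) \<le> N"
      using degree_mult_le[of "[:- z, 1:]" q] by (simp add: N_def)
    have "(\<Sum>i\<le>N. fscale (coeff (pCons 0 q) i) (pw i)) = (\<Sum>i\<le>degree q. fscale (coeff q i) (pw (Suc i)))"
      unfolding N_def by (subst sum.atMost_Suc_shift) simp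
    also have "\<dots> = y \<star> ev q"
      by (simp add: ev_def pwS conv_sum_right conv_scale_right)
    finally have 1: "(\<Sum>i\<le>N. fscale (coeff (pCons 0 q) i) (pw i)) = y \<star> ev q" .
    have "ev ([:- z, 1:] * q) = (\<Sum>i\<le>N. fscale (coeff (pCons 0 q) i) (pw i) - fscale z (fscale (coeff q i) (pw i)))"
      unfolding ev_bound[OF d] by (intro sum.cong refl) (simp add: fun_eq_iff fscale_apply algebra_simps)
    also have "\<dots> = y \<star> ev q - fscale z (ev q)"
    proof -
      have "(\<Sum>i\<le>N. fscale z (fscale (coeff q i) (pw i))) = fscale z (ev q)"
        by (subst ev_bound[of q N]) (simp_all only: fvs.scale_sum_right N_def le_SucI order_refl)
      then show ?thesis by (simp only: sum_subtractf 1)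
    qed
    also have "\<dots> = (y - fscale z e) \<star> ev q"
      by (simp add: conv_diff_left conv_scale_left eve)
    finally show ?thesis .
  qed
  have root: "\<exists>c. y = fscale c e" if "p \<noteq> 0" "ev p = 0" for p
    using that
  proof (induction "degree p" arbitrary: p)
    case 0
    then obtain c where "p = [:c:]" by (metis degree_eq_zeroE)
    moreover have "ev [:c:] = fscale c e" by (simp add: ev_def pw0)
    ultimately show ?case using PCI_D(3)[OF e] 0 by (metis fvs.scale_eq_0_iff pCons_0_0)
  next
    case (Suc n)
    then have "\<not> constant (poly p)" by (simp add: constant_degree)
    then obtain z where "poly p z = 0" using fundamental_theorem_of_algebra by blast
    then obtain q where q: "p = [:- z, 1:] * q" unfolding poly_eq_0_iff_dvd by (auto elim: dvdE)
    have q0: "q \<noteq> 0" using q Suc.prems(1) by auto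
    have dq: "degree q = n" using Suc.hyps(2) q0 unfolding q by (subst (asm) degree_mult_eq) auto
    show ?case
    proof (cases "y - fscale z e = 0")
      case False
      have "y - fscale z e \<in> zalg" "(y - fscale z e) \<star> e = y - fscale z e"
        using yz ye PCI_D[OF e] by (simp_all add: conv_diff_left conv_scale_left)
      then obtain a where "a \<star> (y - fscale z e) = e" using False C.PCI_inverse[OF e] by blast
      then have "ev q = a \<star> ev p" unfolding q ev_lin by (simp add: conv_assoc[symmetric] eve)
      then have "ev q = 0" using Suc.prems(2) by simp
      then show ?thesis using Suc.hyps(1)[of q] dq q0 by simp
    qed auto
  qed
  \<comment> \<open>The dimension bound speaks of sets of vectors. It applies if the powers up to
    the group order are distinct; if two powers coincide, the difference of two monomials
    annihilates \<open>y\<close>.\<close>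
  have "\<exists>p. p \<noteq> 0 \<and> ev p = 0"
  proof (cases "inj_on pw {..card (carrier G)}")
    case True
    define S where "S = pw ` {..card (carrier G)}"
    have "card S = Suc (card (carrier G))" unfolding S_def using True by (simp add: card_image)
    moreover have "S \<subseteq> galg" using pwz zalg_galg by (auto simp: S_def)
    ultimately have "fvs.dependent S" using independent_galg(2)[of S] by auto
    then obtain u where u: "\<exists>v\<in>S. u v \<noteq> 0" "(\<Sum>v\<in>S. fscale (u v) v) = 0"
      using fvs.dependent_finite[of S] by (auto simp: S_def)
    define p where "p = (\<Sum>i\<le>card (carrier G). monom (u (pw i)) i)"
    have cp: "coeff p i = (if i \<le> card (carrier G) then u (pw i) else 0)" for i
      by (simp add: p_def coeff_sum)
    have "p \<noteq> 0" using u(1) cp by (auto simp: S_def dest!: arg_cong[where f = "\<lambda>p. coeff p _"]) (metis coeff_0)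
    moreover have "degree p \<le> card (carrier G)" using cp by (intro degree_le) auto
    then have "ev p = (\<Sum>v\<in>S. fscale (u v) v)"
      by (subst ev_bound) (auto simp: S_def sum.reindex[OF True] cp intro!: sum.cong)
    ultimately show ?thesis using u(2) by auto
  next
    case False
    then obtain i j where ij: "pw i = pw j" "i \<noteq> j" by (auto simp: inj_on_def)
    define p where "p = monom 1 i - monom (1::complex) j"
    have "p \<noteq> 0" using ij(2) by (auto simp: p_def dest!: arg_cong[where f = "\<lambda>p. coeff p i"])
    moreover have "degree p \<le> max i j" unfolding p_def by (metis degree_diff_le_max degree_monom_eq zero_neq_one)
    then have "ev p = (\<Sum>k\<le>max i j. (if k = i then pw i else 0) - (if k = j then pw j else 0))"
      unfolding ev_bound[OF \<open>degree p \<le> max i j\<close>] by (intro sum.cong) (auto simp: p_def fun_eq_iff fscale_apply)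
    then have "ev p = 0" using ij(1) by (simp add: sum_subtractf)
    ultimately show ?thesis by blast
  qed
  then show ?thesis using root by (auto simp: y_def)
qed

text \<open>\<open>lam e\<close> is the central character belonging to \<open>e\<close>.\<close>

definition lam :: "('a \<Rightarrow> complex) \<Rightarrow> ('a \<Rightarrow> complex) \<Rightarrow> complex" where
  "lam e x = (THE c. x \<star> e = fscale c e)"

lemma PCI_scale_inj: "e \<in> PCI \<Longrightarrow> fscale c e = fscale d (e :: 'a \<Rightarrow> complex) \<longleftrightarrow> c = d"
  using PCI_D(3)[of e] by (metis fvs.scale_cancel_right)

lemma lam_eqI: "e \<in> PCI \<Longrightarrow> x \<star> e = fscale c e \<Longrightarrow> lam e x = c"
  unfolding lam_def using PCI_scale_inj by (intro the_equality) auto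

lemma lam: "e \<in> PCI \<Longrightarrow> x \<in> zalg \<Longrightarrow> x \<star> e = fscale (lam e x) e"
  using PCI_eigenvalue lam_eqI by metis

lemma lam_add: "e \<in> PCI \<Longrightarrow> x \<in> zalg \<Longrightarrow> y \<in> zalg \<Longrightarrow> lam e (x + y) = lam e x + lam e y"
  by (rule lam_eqI) (simp_all add: conv_add_left lam fvs.scale_left_distrib)

lemma lam_diff: "e \<in> PCI \<Longrightarrow> x \<in> zalg \<Longrightarrow> y \<in> zalg \<Longrightarrow> lam e (x - y) = lam e x - lam e y"
  by (rule lam_eqI) (simp_all add: conv_diff_left lam fvs.scale_left_diff_distrib)

lemma lam_scale: "e \<in> PCI \<Longrightarrow> x \<in> zalg \<Longrightarrow> lam e (fscale c x) = c * lam e x"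
  by (rule lam_eqI) (simp_all add: conv_scale_left lam)

lemma lam_mult: "e \<in> PCI \<Longrightarrow> x \<in> zalg \<Longrightarrow> y \<in> zalg \<Longrightarrow> lam e (x \<star> y) = lam e x * lam e y"
  by (rule lam_eqI) (simp_all add: conv_assoc lam conv_scale_right mult.commute)

lemma lam_zero [simp]: "e \<in> PCI \<Longrightarrow> lam e 0 = 0"
  by (rule lam_eqI) simp_all

lemma lam_one [simp]: "e \<in> PCI \<Longrightarrow> lam e e1 = 1"
  by (rule lam_eqI) (simp_all add: PCI_D)

lemma lam_PCI: "e \<in> PCI \<Longrightarrow> f \<in> PCI \<Longrightarrow> lam e f = (if e = f then 1 else 0)"
  by (rule lam_eqI) (simp_all add: PCI_mult)

lemma lam_sum: "e \<in> PCI \<Longrightarrow> (\<And>i. i \<in> I \<Longrightarrow> f i \<in> zalg) \<Longrightarrow> lam e (\<Sum>i\<in>I. f i) = (\<Sum>i\<in>I. lam e (f i))"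
  by (rule lam_eqI) (simp_all add: conv_sum_left lam fvs.scale_sum_left)

lemma zalg_expand: "x \<in> zalg \<Longrightarrow> x = (\<Sum>e\<in>PCI. fscale (lam e x) e)"
  by (subst PCI_decomp) (auto simp: zalg_galg lam)

lemma lam_ext:
  assumes "x \<in> zalg" "y \<in> zalg" "\<And>e. e \<in> PCI \<Longrightarrow> lam e x = lam e y"
  shows "x = y"
  using zalg_expand[OF assms(1)] zalg_expand[OF assms(2)] assms(3) by simp

text \<open>Put \<open>s = star e\<close>, a central idempotent. Then
  \<open>s \<star> e = c e\<close> with \<open>c\<close> equal to 0 or 1, and \<open>c = 0\<close>
  would give \<open>ip e e = 0\<close>. Hence \<open>s \<star> e = e\<close>, and applying
  \<open>star\<close> turns this into \<open>s \<star> e = s\<close>.\<close>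

lemma star_PCI: "e \<in> PCI \<Longrightarrow> C.star e = e"
proof -
  assume e: "e \<in> PCI"
  define s where "s = C.star e"
  have ez: "e \<star> h = h \<star> e" for h using zalg_commute[OF PCI_D(1)[OF e]] .
  have sg: "C.star s = e" using PCI_D[OF e] by (simp add: s_def C.star_star)
  have sz: "s \<in> zalg"
  proof (rule zalgI)
    fix h :: "'a \<Rightarrow> complex" assume h: "h \<in> galg"
    have "s \<star> h = C.star (C.star h \<star> e)" using h by (simp add: C.star_conv s_def C.star_star)
    also have "\<dots> = h \<star> s" using h by (simp add: ez[symmetric] C.star_conv s_def C.star_star)
    finally show "s \<star> h = h \<star> s" .
  qed (simp add: s_def)
  define c where "c = lam e s"
  have se: "s \<star> e = fscale c e" using lam[OF e sz] by (simp add: c_def)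
  have ss: "s \<star> s = s" using C.star_conv[of e e] PCI_D(2)[OF e] by (simp add: s_def)
  have "s \<star> s \<star> e = fscale (c * c) e" by (simp add: conv_assoc se conv_scale_right)
  then have "c * c = c" using se ss PCI_scale_inj[OF e] by simp
  moreover have "c \<noteq> 0"
  proof
    assume "c = 0"
    then have "C.ip e e = 0" using se ez[of s] by (simp add: C.ip_def s_def fvs.scale_zero_left)
    then show False using C.ip_self PCI_D(3,4)[OF e] by blast
  qed
  ultimately have "s \<star> e = e" using se by (simp add: fvs.scale_one)
  moreover have "s \<star> e = s" using arg_cong[OF \<open>s \<star> e = e\<close>, of C.star] sg by (simp add: C.star_conv s_def[symmetric] ez)
  ultimately show ?thesis by (simp add: s_def)
qed

lemma star_zalg: "x \<in> zalg \<Longrightarrow> C.star x \<in> zalg"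
proof (rule zalgI)
  fix h :: "'a \<Rightarrow> complex" assume x: "x \<in> zalg" and h: "h \<in> galg"
  have "C.star x \<star> h = C.star (C.star h \<star> x)" using h by (simp add: C.star_conv C.star_star)
  also have "\<dots> = h \<star> C.star x" using h by (simp add: zalg_commute[OF x, symmetric] C.star_conv C.star_star)
  finally show "C.star x \<star> h = h \<star> C.star x" .
qed simp

lemma star_fscale: "C.star (fscale c x) = fscale (cnj c) (C.star x)"
  by (auto simp: C.star_def fun_eq_iff fscale_apply)

lemma lam_star: "e \<in> PCI \<Longrightarrow> x \<in> zalg \<Longrightarrow> lam e (C.star x) = cnj (lam e x)"
proof (rule lam_eqI)
  assume e: "e \<in> PCI" and x: "x \<in> zalg"
  have "C.star x \<star> e = C.star (e \<star> x)" by (simp add: C.star_conv star_PCI[OF e])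
  also have "e \<star> x = fscale (lam e x) e" using lam[OF e x] zalg_commute[OF x, of e] by simp
  finally show "C.star x \<star> e = fscale (cnj (lam e x)) e" by (simp add: star_fscale star_PCI[OF e])
qed

text \<open>Coefficientwise conjugation. Unlike \<open>star\<close>, which fixes every primitive
  central idempotent, it permutes them and pairs complex conjugate embeddings.\<close>

definition bar :: "('a \<Rightarrow> complex) \<Rightarrow> 'a \<Rightarrow> complex" where "bar f = cnj \<circ> f"

lemma bar_bar [simp]: "bar (bar f) = f"
  by (simp add: bar_def fun_eq_iff)

lemma bar_eq_iff [simp]: "bar f = bar h \<longleftrightarrow> f = h"
  by (metis bar_bar)

lemma bar_zero [simp]: "bar 0 = 0"
  by (simp add: bar_def fun_eq_iff)

lemma bar_conv: "bar (f \<star> h) = bar f \<star> bar h"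
  unfolding bar_def by (rule map_conv) auto

lemma bar_zalg: "f \<in> zalg \<Longrightarrow> bar f \<in> zalg"
  by (auto simp: zalg_def galg_def bar_def)

lemma bar_PCI: "e \<in> PCI \<Longrightarrow> bar e \<in> PCI"
  unfolding PCI_def
proof (intro CollectI conjI ballI impI)
  assume e: "e \<in> {e \<in> zalg. e \<star> e = e \<and> e \<noteq> 0 \<and> (\<forall>f\<in>zalg. f \<star> f = f \<longrightarrow> f \<star> e = f \<longrightarrow> f = 0 \<or> f = e)}"
  show "bar e \<in> zalg" using e bar_zalg by blast
  show "bar e \<star> bar e = bar e" using e by (simp add: bar_conv[symmetric])
  show "bar e \<noteq> 0" using e bar_eq_iff[of e 0] by (simp only: mem_Collect_eq bar_zero simp_thms)
  fix f assume f: "f \<in> zalg" "f \<star> f = f" "f \<star> bar e = f"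
  have "bar f \<in> zalg" "bar f \<star> bar f = bar f" "bar f \<star> e = bar f"
    using f bar_zalg bar_conv[of f f] bar_conv[of f "bar e"] by simp_all
  then have "bar f = 0 \<or> bar f = e" using e by blast
  then show "f = 0 \<or> f = bar e" by (metis bar_bar bar_zero)
qed

lemma lam_bar: "e \<in> PCI \<Longrightarrow> x \<in> zalg \<Longrightarrow> lam (bar e) (bar x) = cnj (lam e x)"
proof (rule lam_eqI)
  assume e: "e \<in> PCI" and x: "x \<in> zalg"
  have "bar x \<star> bar e = bar (fscale (lam e x) e)" by (simp add: bar_conv[symmetric] lam[OF e x])
  then show "bar x \<star> bar e = fscale (cnj (lam e x)) (bar e)" by (simp add: bar_def fun_eq_iff fscale_apply)
qed (rule bar_PCI)

section \<open>Rational structure of the centre\<close>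

definition ccl :: "'a \<Rightarrow> 'a set" where
  "ccl g = (\<lambda>x. x \<otimes> g \<otimes> inv x) ` carrier G"

definition CC :: "'a set set" where "CC = ccl ` carrier G"

definition crep :: "'a set \<Rightarrow> 'a" where "crep C = (SOME g. g \<in> C)"

definition ind :: "'a set \<Rightarrow> 'a \<Rightarrow> 'k::comm_ring_1" where
  "ind C = (\<lambda>x. if x \<in> C then 1 else 0)"

lemma finite_CC [simp]: "finite CC"
  by (simp add: CC_def)

lemma ccl_self: "g \<in> carrier G \<Longrightarrow> g \<in> ccl g"
  unfolding ccl_def by (rule image_eqI[where x = \<one>]) auto

lemma ccl_eq:
  assumes "g \<in> carrier G" "h \<in> ccl g"
  shows "ccl h = ccl g"
proof -
  obtain x where x: "x \<in> carrier G" "h = x \<otimes> g \<otimes> inv x" using assms by (auto simp: ccl_def)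
  have "y \<otimes> h \<otimes> inv y = (y \<otimes> x) \<otimes> g \<otimes> inv (y \<otimes> x)" if "y \<in> carrier G" for y
    using that x assms by (simp add: inv_mult_group m_assoc)
  moreover have "y \<otimes> g \<otimes> inv y = (y \<otimes> inv x) \<otimes> h \<otimes> inv (y \<otimes> inv x)" if "y \<in> carrier G" for y
  proof -
    have "inv x \<otimes> (x \<otimes> z) = z" if "z \<in> carrier G" for z
      using that x(1) by (simp add: m_assoc[symmetric])
    then show ?thesis using that x assms by (simp add: inv_mult_group m_assoc)
  qed
  ultimately have "y \<otimes> h \<otimes> inv y \<in> ccl g" "y \<otimes> g \<otimes> inv y \<in> ccl h" if "y \<in> carrier G" for y
    using that x(1) unfolding ccl_def
    by (metis (no_types, lifting) imageI m_closed, metis (no_types, lifting) imageI inv_closed m_closed)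
  then show ?thesis by (auto simp: ccl_def[of h] ccl_def[of g])
qed

lemma CC_D: "C \<in> CC \<Longrightarrow> g \<in> C \<Longrightarrow> g \<in> carrier G \<and> ccl g = C"
  using ccl_eq by (auto simp: CC_def) (auto simp: ccl_def)

lemma crep: "C \<in> CC \<Longrightarrow> crep C \<in> C"
  unfolding crep_def by (rule someI_ex) (use ccl_self in \<open>auto simp: CC_def\<close>)

lemma CC_unique: "g \<in> carrier G \<Longrightarrow> C \<in> CC \<Longrightarrow> g \<in> C \<longleftrightarrow> C = ccl g"
  using CC_D ccl_self by blast

lemma zalg_conj: "z \<in> zalg \<Longrightarrow> g \<in> carrier G \<Longrightarrow> h \<in> ccl g \<Longrightarrow> z h = z g"
  unfolding ccl_def by (auto simp: zalg_swap[of z] m_assoc[symmetric])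

lemma zalg_crep: "z \<in> zalg \<Longrightarrow> C \<in> CC \<Longrightarrow> g \<in> C \<Longrightarrow> z (crep C) = z g"
  using zalg_conj crep CC_D by metis

lemma ind_zalg [simp, intro]: "C \<in> CC \<Longrightarrow> ind C \<in> zalg"
  unfolding zalg_def galg_def
proof (intro CollectI conjI ballI allI impI)
  fix x y assume C: "C \<in> CC" and xy: "x \<in> carrier G" "y \<in> carrier G"
  have "y \<otimes> x = y \<otimes> (x \<otimes> y) \<otimes> inv y" using xy by (simp add: m_assoc)
  then have "y \<otimes> x \<in> ccl (x \<otimes> y)" unfolding ccl_def using xy by blast
  then have "ccl (y \<otimes> x) = ccl (x \<otimes> y)" using xy by (intro ccl_eq) auto
  then show "ind C (x \<otimes> y) = ind C (y \<otimes> x)" using C xy by (simp add: ind_def CC_unique)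
qed (use CC_D in \<open>auto simp: ind_def\<close>)

lemma ind_crep: "C \<in> CC \<Longrightarrow> D \<in> CC \<Longrightarrow> ind C (crep D) = (if C = D then 1 else 0)"
  using CC_D[of C "crep D"] CC_D[of D "crep D"] crep[of D] by (auto simp: ind_def)

lemma zalg_ind_expand:
  assumes z: "z \<in> zalg"
  shows "z = (\<Sum>C\<in>CC. fscale (z (crep C)) (ind C))"
proof (rule galg_eqI)
  show "(\<Sum>C\<in>CC. fscale (z (crep C)) (ind C)) \<in> galg" by (auto simp: zalg_galg)
  fix g assume g: "g \<in> carrier G"
  have "(\<Sum>C\<in>CC. fscale (z (crep C)) (ind C)) g = (\<Sum>C\<in>CC. if C = ccl g then z (crep C) else 0)"
    unfolding sum_fun_apply using g by (intro sum.cong) (auto simp: fscale_apply ind_def CC_unique)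
  also have "\<dots> = z (crep (ccl g))" using g by (simp add: CC_def)
  also have "\<dots> = z g" using g ccl_self by (intro zalg_crep[OF z]) (auto simp: CC_def)
  finally show "z g = (\<Sum>C\<in>CC. fscale (z (crep C)) (ind C)) g" by simp
qed (rule zalg_galg[OF z])

lemma Rats_cnj: "z \<in> \<rat> \<Longrightarrow> cnj z = z"
  by (elim Rats_cases') auto

text \<open>\<open>Z(\<rat>G)\<close> is identified with the set \<open>rz\<close> of rational-valued elements of \<open>Z(\<complex>G)\<close>; \<open>EQ\<close> consists of the
  primitive central idempotents \<open>\<epsilon>\<close> of \<open>\<rat>G\<close>, \<open>K \<epsilon>\<close> is the centre of the component \<open>\<rat>G \<epsilon>\<close>, and \<open>J \<epsilon>\<close>
  indexes its embeddings into \<open>\<complex>\<close>.\<close>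

definition rz :: "('a \<Rightarrow> complex) set" where "rz = {x \<in> zalg. \<forall>g. x g \<in> \<rat>}"

definition rc :: "('a \<Rightarrow> rat) \<Rightarrow> 'a \<Rightarrow> complex" where "rc f = of_rat \<circ> f"

lemma rz_zalg: "x \<in> rz \<Longrightarrow> x \<in> zalg"
  by (simp add: rz_def)

lemma rc_conv: "rc (f \<star> h) = rc f \<star> rc h"
  unfolding rc_def by (rule map_conv) (auto simp: of_rat_add of_rat_mult)

lemma rc_inj [simp]: "rc f = rc h \<longleftrightarrow> f = h"
  by (auto simp: rc_def fun_eq_iff)

lemma rc_zero [simp]: "rc 0 = 0" by (simp add: rc_def fun_eq_iff)

lemma rc_eq_zero [simp]: "rc f = 0 \<longleftrightarrow> f = 0"
  using rc_inj[of f 0] by (simp del: rc_inj)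

lemma rc_add: "rc (f + h) = rc f + rc h"
  and rc_diff: "rc (f - h) = rc f - rc h"
  and rc_scale: "rc (fscale q f) = fscale (of_rat q) (rc f)"
  by (auto simp: rc_def fun_eq_iff of_rat_add of_rat_diff of_rat_mult fscale_apply)

lemma rc_sum: "rc (\<Sum>i\<in>I. f i) = (\<Sum>i\<in>I. rc (f i))"
  by (simp add: rc_def fun_eq_iff sum_fun_apply of_rat_sum)

lemma rc_e1 [simp]: "rc e1 = e1"
  by (simp add: rc_def fun_eq_iff delta_def)

lemma rc_ind [simp]: "rc (ind C) = ind C"
  by (simp add: rc_def fun_eq_iff ind_def)

lemma rc_galg [simp]: "rc f \<in> galg \<longleftrightarrow> f \<in> galg"
  by (auto simp: galg_def rc_def)

lemma rc_zalg [simp]: "rc f \<in> zalg \<longleftrightarrow> f \<in> zalg"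
  by (auto simp: zalg_def) (auto simp: rc_def galg_def)

lemma rz_iff: "x \<in> rz \<longleftrightarrow> (\<exists>f\<in>zalg. x = rc f)"
proof
  assume x: "x \<in> rz"
  then have "\<forall>g. \<exists>q. x g = of_rat q" by (auto simp: rz_def Rats_def)
  then obtain q where q: "\<And>g. x g = of_rat (q g)" by metis
  then have xq: "x = rc q" by (auto simp: rc_def)
  then have "q \<in> zalg" using rz_zalg[OF x] by simp
  then show "\<exists>f\<in>zalg. x = rc f" using xq by blast
qed (auto simp: rz_def rc_def simp flip: rc_zalg)

lemma rz_closed [simp, intro]:
  "x \<in> rz \<Longrightarrow> y \<in> rz \<Longrightarrow> x + y \<in> rz" "x \<in> rz \<Longrightarrow> y \<in> rz \<Longrightarrow> x - y \<in> rz"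
  "x \<in> rz \<Longrightarrow> y \<in> rz \<Longrightarrow> x \<star> y \<in> rz" "q \<in> \<rat> \<Longrightarrow> x \<in> rz \<Longrightarrow> fscale q x \<in> rz" "e1 \<in> rz" "0 \<in> rz"
proof -
  show "x \<star> y \<in> rz" if "x \<in> rz" "y \<in> rz"
    using that by (metis rc_conv conv_zalg rz_iff)
  show "e1 \<in> rz" using e1_zalg by (simp add: rz_def) (simp add: delta_def)
qed (auto simp: rz_def fscale_apply)

lemma ind_rz [simp, intro]: "C \<in> CC \<Longrightarrow> ind C \<in> rz"
  by (auto simp: rz_def) (auto simp: ind_def)

lemma rz_star: "x \<in> rz \<Longrightarrow> C.star x \<in> rz"
  using star_zalg[of x] by (simp add: rz_def) (simp add: C.star_def Rats_cnj)

lemma rz_bar: "x \<in> rz \<Longrightarrow> bar x = x"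
  by (auto simp: rz_def bar_def fun_eq_iff Rats_cnj)

lemma lam_bar_rz: "e \<in> PCI \<Longrightarrow> x \<in> rz \<Longrightarrow> lam (bar e) x = cnj (lam e x)"
  using lam_bar[of e x] rz_bar rz_zalg by metis

text \<open>The class sums are rational and span the complex centre, so \<open>lam e\<close> and
  \<open>lam f\<close> agree everywhere, in particular at \<open>e\<close>.\<close>

lemma lam_separates:
  assumes e: "e \<in> PCI" and f: "f \<in> PCI" and eq: "\<And>x. x \<in> rz \<Longrightarrow> lam e x = lam f x"
  shows "e = f"
proof -
  have "lam e z = lam f z" if z: "z \<in> zalg" for z
    by (subst (1 2) zalg_ind_expand[OF z]) (simp add: lam_sum lam_scale e f eq)
  then have "lam f e = 1" using lam_PCI[OF e e] PCI_D(1)[OF e] by simp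
  then show ?thesis using lam_PCI[OF f e] by (simp split: if_splits)
qed

section \<open>Rational idempotents, their fields and the embeddings of these fields\<close>

definition EQ :: "('a \<Rightarrow> complex) set" where "EQ = rc ` PCI"

definition J :: "('a \<Rightarrow> complex) \<Rightarrow> ('a \<Rightarrow> complex) set" where
  "J \<epsilon> = {e \<in> PCI. \<epsilon> \<star> e = e}"

definition K :: "('a \<Rightarrow> complex) \<Rightarrow> ('a \<Rightarrow> complex) set" where
  "K \<epsilon> = {x \<in> rz. x \<star> \<epsilon> = x}"

lemma finite_EQ [simp]: "finite EQ" by (simp add: EQ_def)

lemma finite_J [simp]: "finite (J \<epsilon>)" by (simp add: J_def)

lemma J_PCI: "e \<in> J \<epsilon> \<Longrightarrow> e \<in> PCI" by (simp add: J_def)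

lemma EQ_D:
  assumes "\<epsilon> \<in> EQ"
  shows "\<epsilon> \<in> rz" "\<epsilon> \<in> zalg" "\<epsilon> \<star> \<epsilon> = \<epsilon>" "\<epsilon> \<noteq> 0" "\<epsilon> \<in> K \<epsilon>"
proof -
  obtain f where f: "f \<in> PCI" "\<epsilon> = rc f" using assms by (auto simp: EQ_def)
  show 1: "\<epsilon> \<in> rz" "\<epsilon> \<star> \<epsilon> = \<epsilon>" "\<epsilon> \<noteq> 0"
    using f PCI_D[OF f(1)] by (auto simp: rz_iff simp flip: rc_conv)
  then show "\<epsilon> \<in> zalg" "\<epsilon> \<in> K \<epsilon>" by (auto simp: rz_zalg K_def)
qed

lemma EQ_orth: "\<epsilon> \<in> EQ \<Longrightarrow> \<delta> \<in> EQ \<Longrightarrow> \<epsilon> \<noteq> \<delta> \<Longrightarrow> \<epsilon> \<star> \<delta> = 0"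
  using PCI_orth by (auto simp: EQ_def simp flip: rc_conv)

lemma EQ_sum: "(\<Sum>\<epsilon>\<in>EQ. \<epsilon>) = e1"
proof -
  have "(\<Sum>\<epsilon>\<in>EQ. \<epsilon>) = rc (\<Sum>e\<in>PCI. e)"
    unfolding EQ_def rc_sum by (subst sum.reindex) (auto simp: inj_on_def)
  then show ?thesis by (simp add: PCI_sum)
qed

lemma K_rz: "x \<in> K \<epsilon> \<Longrightarrow> x \<in> rz" and K_zalg: "x \<in> K \<epsilon> \<Longrightarrow> x \<in> zalg"
  by (auto simp: K_def rz_zalg)

lemma K_closed:
  assumes "\<epsilon> \<in> EQ"
  shows "x \<in> K \<epsilon> \<Longrightarrow> y \<in> K \<epsilon> \<Longrightarrow> x + y \<in> K \<epsilon>" "x \<in> K \<epsilon> \<Longrightarrow> y \<in> K \<epsilon> \<Longrightarrow> x - y \<in> K \<epsilon>"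
    "x \<in> K \<epsilon> \<Longrightarrow> y \<in> K \<epsilon> \<Longrightarrow> x \<star> y \<in> K \<epsilon>" "q \<in> \<rat> \<Longrightarrow> x \<in> K \<epsilon> \<Longrightarrow> fscale q x \<in> K \<epsilon>"
    "x \<in> rz \<Longrightarrow> x \<star> \<epsilon> \<in> K \<epsilon>" "0 \<in> K \<epsilon>"
  using EQ_D[OF assms] by (auto simp: K_def conv_distribs conv_scale_left conv_assoc)

lemma K_inverse:
  assumes \<epsilon>: "\<epsilon> \<in> EQ" and y: "y \<in> K \<epsilon>" "y \<noteq> 0"
  obtains a where "a \<in> K \<epsilon>" "a \<star> y = \<epsilon>"
proof -
  obtain f where f: "f \<in> PCI" "\<epsilon> = rc f" using \<epsilon> by (auto simp: EQ_def)
  obtain q where q: "q \<in> zalg" "y = rc q" using y(1) by (auto simp: K_def rz_iff)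
  have "q \<star> f = q" "q \<noteq> 0" using y q f by (auto simp: K_def simp flip: rc_conv)
  then obtain a where "a \<in> zalg" "a \<star> f = a" "a \<star> q = f" using Q.PCI_inverse[OF f(1) q(1)] by blast
  then show ?thesis by (intro that[of "rc a"]) (auto simp: K_def rz_iff f q simp flip: rc_conv)
qed

lemma lam_EQ:
  assumes "\<epsilon> \<in> EQ" "e \<in> PCI"
  shows "lam e \<epsilon> = (if e \<in> J \<epsilon> then 1 else 0)"
proof -
  have l: "\<epsilon> \<star> e = fscale (lam e \<epsilon>) e" using lam assms EQ_D by blast
  have "lam e \<epsilon> * lam e \<epsilon> = lam e \<epsilon>"
    using lam_mult[OF assms(2) EQ_D(2)[OF assms(1)] EQ_D(2)[OF assms(1)]] EQ_D(3)[OF assms(1)] by simp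
  then have "lam e \<epsilon> = 0 \<or> lam e \<epsilon> = 1" by simp
  then show ?thesis using l assms(2) PCI_D(3)[OF assms(2)] by (auto simp: J_def fvs.scale_zero_left fvs.scale_one)
qed

lemma lam_J: "\<epsilon> \<in> EQ \<Longrightarrow> e \<in> J \<epsilon> \<Longrightarrow> lam e \<epsilon> = 1"
  using lam_EQ J_PCI by simp

lemma lam_J_conv: "\<epsilon> \<in> EQ \<Longrightarrow> e \<in> J \<epsilon> \<Longrightarrow> x \<in> zalg \<Longrightarrow> lam e (x \<star> \<epsilon>) = lam e x"
  using lam_mult[of e x \<epsilon>] lam_J J_PCI EQ_D by simp

lemma lam_K_outside: "\<epsilon> \<in> EQ \<Longrightarrow> x \<in> K \<epsilon> \<Longrightarrow> e \<in> PCI \<Longrightarrow> e \<notin> J \<epsilon> \<Longrightarrow> lam e x = 0"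
  using lam_mult[of e x \<epsilon>] lam_EQ[of \<epsilon> e] K_zalg[of x \<epsilon>] EQ_D(2)[of \<epsilon>] by (simp add: K_def)

text \<open>The values \<open>lam e \<epsilon>\<close> are 0 or 1 and add up to
  \<open>lam e e1 = 1\<close>; two of them cannot be nonzero, by orthogonality of
  \<open>EQ\<close>.\<close>

lemma J_unique:
  assumes "e \<in> PCI"
  shows "\<exists>!\<epsilon>. \<epsilon> \<in> EQ \<and> e \<in> J \<epsilon>"
proof -
  have "(\<Sum>\<epsilon>\<in>EQ. lam e \<epsilon>) = 1"
    using lam_sum[of e EQ "\<lambda>x. x"] assms EQ_D by (simp add: EQ_sum)
  then obtain \<epsilon> where "\<epsilon> \<in> EQ" "lam e \<epsilon> \<noteq> 0" by (metis sum.neutral zero_neq_one)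
  moreover have "\<delta> = \<epsilon>" if "\<delta> \<in> EQ" "\<epsilon> \<in> EQ" "e \<in> J \<epsilon>" "e \<in> J \<delta>" for \<epsilon> \<delta>
  proof (rule ccontr)
    assume "\<delta> \<noteq> \<epsilon>"
    then have "\<delta> \<star> \<epsilon> = 0" using EQ_orth that by blast
    then have "lam e \<delta> * lam e \<epsilon> = 0" using lam_mult[of e \<delta> \<epsilon>] assms that EQ_D by simp
    then show False using lam_J that by simp
  qed
  ultimately show ?thesis using lam_EQ assms by (metis)
qed

lemma J_nonempty: "\<epsilon> \<in> EQ \<Longrightarrow> J \<epsilon> \<noteq> {}"
proof
  assume \<epsilon>: "\<epsilon> \<in> EQ" "J \<epsilon> = {}"
  then have "\<epsilon> = 0" by (intro lam_ext) (auto simp: EQ_D lam_EQ)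
  then show False using EQ_D(4) \<epsilon> by blast
qed

text \<open>On the field \<open>K \<epsilon>\<close>, the character of \<open>e\<close> is a unital
  homomorphism, hence injective.\<close>

lemma K_ext:
  assumes "\<epsilon> \<in> EQ" "x \<in> K \<epsilon>" "y \<in> K \<epsilon>" "e \<in> J \<epsilon>" "lam e x = lam e y"
  shows "x = y"
proof (rule ccontr)
  assume "x \<noteq> y"
  then obtain a where a: "a \<in> K \<epsilon>" "a \<star> (x - y) = \<epsilon>"
    using K_inverse[OF assms(1), of "x - y"] K_closed(2)[OF assms(1)] assms by auto
  then have "lam e a * (lam e x - lam e y) = 1"
    using lam_mult[of e a "x - y"] lam_diff[of e x y] lam_J assms K_zalg J_PCI by force
  then show False using assms by simp
qed

lemma J_separates:
  assumes "\<epsilon> \<in> EQ" "e \<in> J \<epsilon>" "f \<in> J \<epsilon>" "\<And>x. x \<in> K \<epsilon> \<Longrightarrow> lam e x = lam f x"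
  shows "e = f"
proof (rule lam_separates)
  fix x assume x: "x \<in> rz"
  then show "lam e x = lam f x"
    using assms(4)[OF K_closed(5)[OF assms(1) x]] lam_J_conv assms rz_zalg by simp
qed (use assms J_PCI in auto)

lemma bar_J: "\<epsilon> \<in> EQ \<Longrightarrow> e \<in> J \<epsilon> \<Longrightarrow> bar e \<in> J \<epsilon>"
  using bar_conv[of \<epsilon> e] rz_bar EQ_D(1) by (auto simp: J_def bar_PCI)

lemma EQ_star: "\<epsilon> \<in> EQ \<Longrightarrow> C.star \<epsilon> = \<epsilon>"
  by (rule lam_ext) (auto simp: star_zalg EQ_D lam_star lam_EQ)

lemma K_star: "\<epsilon> \<in> EQ \<Longrightarrow> x \<in> K \<epsilon> \<Longrightarrow> C.star x \<in> K \<epsilon>"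
proof -
  assume "\<epsilon> \<in> EQ" "x \<in> K \<epsilon>"
  moreover have "C.star (x \<star> \<epsilon>) = C.star x \<star> \<epsilon>"
    using calculation zalg_commute[of "C.star x"] by (simp add: C.star_conv EQ_star star_zalg K_zalg)
  ultimately show ?thesis by (simp add: K_def rz_star)
qed

text \<open>The positive involution restricts to complex conjugation under every embedding of \<open>K \<epsilon>\<close>, so
  \<open>K \<epsilon>\<close> is either totally real or totally complex.\<close>

lemma J_real_dichotomy:
  assumes \<epsilon>: "\<epsilon> \<in> EQ" and e: "e \<in> J \<epsilon>" "bar e = e" and f: "f \<in> J \<epsilon>"
  shows "bar f = f"
proof (rule J_separates[OF \<epsilon> bar_J[OF \<epsilon> f] f])
  fix y assume y: "y \<in> K \<epsilon>"
  have "lam e (C.star y) = lam e y"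
    using lam_star[of e y] lam_bar_rz[of e y] e J_PCI K_zalg K_rz y by simp
  then have "C.star y = y" using K_ext[OF \<epsilon> K_star[OF \<epsilon> y] y e(1)] by simp
  then show "lam (bar f) y = lam f y"
    using lam_star[of f y] lam_bar_rz[of f y] f J_PCI K_zalg K_rz y by simp
qed

lemma rc_ip: "C.ip (rc f) (rc h) = of_rat (Q.ip f h)"
  by (simp add: C.ip_explicit Q.ip_explicit rc_def of_rat_sum of_rat_mult Rats_cnj)

lemma rational_basis:
  assumes f: "f \<in> PCI"
  obtains B where "Q.orth_set B" "B \<subseteq> {x \<in> zalg. x \<star> f = x}"
    "\<And>v. v \<in> zalg \<Longrightarrow> v \<star> f = v \<Longrightarrow> v = Q.proj B v" "card B = card (J (rc f))"
proof -
  define S where "S = {x \<in> zalg. x \<star> f = x}"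
  have "fvs.subspace S"
    by (rule fvs.subspaceI) (auto simp: S_def conv_add_left conv_scale_left)
  moreover have "S \<subseteq> galg" by (auto simp: S_def zalg_galg)
  ultimately obtain B where B: "Q.orth_set B" "B \<subseteq> S" "\<And>v. v \<in> S \<Longrightarrow> v = Q.proj B v"
    using Q.orth_basis_exists by blast
  have fB: "finite B" using B(1) by (simp add: Q.orth_set_def)
  define \<epsilon> where "\<epsilon> = rc f"
  have \<epsilon>: "\<epsilon> \<in> EQ" using f by (auto simp: \<epsilon>_def EQ_def)
  define V where "V = {x \<in> zalg. x \<star> \<epsilon> = x}"
  have ind1: "fvs.independent (rc ` B)"
  proof (rule C.orth_set_independent)
    show "C.orth_set (rc ` B)" using B(1) by (auto simp: C.orth_set_def Q.orth_set_def rc_ip)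
  qed
  have ind2: "fvs.independent (J \<epsilon>)"
    by (rule fvs.independent_mono[OF PCI_independent]) (auto simp: J_def)
  have rS: "rc v \<in> fvs.span (rc ` B)" if "v \<in> S" for v
  proof -
    have "rc v = rc (Q.proj B v)" using B(3)[OF that] by simp
    also have "\<dots> \<in> fvs.span (rc ` B)"
      unfolding Q.proj_def rc_sum rc_scale by (intro fvs.span_sum fvs.span_scale fvs.span_base) auto
    finally show ?thesis .
  qed
  have 1: "V \<subseteq> fvs.span (rc ` B)"
  proof
    fix z assume "z \<in> V"
    then have z: "z \<in> zalg" "z \<star> \<epsilon> = z" by (auto simp: V_def)
    have "z = (\<Sum>C\<in>CC. fscale (z (crep C)) (ind C)) \<star> \<epsilon>" using z zalg_ind_expand by metis
    also have "\<dots> = (\<Sum>C\<in>CC. fscale (z (crep C)) (rc (ind C \<star> f)))"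
      by (simp add: conv_sum_left conv_scale_left rc_conv \<epsilon>_def)
    also have "\<dots> \<in> fvs.span (rc ` B)"
      by (intro fvs.span_sum fvs.span_scale rS) (auto simp: S_def PCI_D[OF f] conv_assoc)
    finally show "z \<in> fvs.span (rc ` B)" .
  qed
  have 2: "V \<subseteq> fvs.span (J \<epsilon>)"
  proof
    fix z assume "z \<in> V"
    then have z: "z \<in> zalg" "z \<star> \<epsilon> = z" by (auto simp: V_def)
    have "lam e z = 0" if "e \<in> PCI" "e \<notin> J \<epsilon>" for e
      using that lam_mult[of e z \<epsilon>] lam_EQ[OF \<epsilon>, of e] z EQ_D[OF \<epsilon>] by simp
    then have "z = (\<Sum>e\<in>J \<epsilon>. fscale (lam e z) e)"
      by (subst zalg_expand[OF z(1)], intro sum.mono_neutral_right) (auto simp: J_def fvs.scale_zero_left)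
    also have "\<dots> \<in> fvs.span (J \<epsilon>)"
      by (intro fvs.span_sum fvs.span_scale fvs.span_base)
    finally show "z \<in> fvs.span (J \<epsilon>)" .
  qed
  have 3: "rc ` B \<subseteq> V" using B(2) by (auto simp: V_def S_def \<epsilon>_def simp flip: rc_conv)
  have 4: "J \<epsilon> \<subseteq> V" using zalg_commute[OF EQ_D(2)[OF \<epsilon>]] by (auto simp: V_def J_def PCI_D)
  have "card (rc ` B) \<le> card (J \<epsilon>)"
    using fvs.independent_span_bound[OF finite_J ind1, of \<epsilon>] 2 3 by blast
  moreover have "card (J \<epsilon>) \<le> card (rc ` B)"
    using fvs.independent_span_bound[OF finite_imageI[OF fB] ind2, of rc] 1 4 by blast
  moreover have "card (rc ` B) = card B" by (rule card_image) (auto simp: inj_on_def)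
  ultimately show ?thesis using B by (intro that[of B]) (auto simp: S_def \<epsilon>_def)
qed

section \<open>Integral class functions and their norms\<close>

text \<open>The centre of the integral group ring, seen inside \<open>rz\<close>. In general it does
  not contain the idempotents in \<open>EQ\<close>.\<close>

definition oz :: "('a \<Rightarrow> complex) set" where "oz = {x \<in> zalg. \<forall>g. x g \<in> \<int>}"

lemma oz_rz: "x \<in> oz \<Longrightarrow> x \<in> rz"
  using Ints_subset_Rats by (auto simp: oz_def rz_def)

lemma oz_zalg: "x \<in> oz \<Longrightarrow> x \<in> zalg"
  by (simp add: oz_def)

lemma Ints_sum': "(\<And>i. i \<in> I \<Longrightarrow> f i \<in> \<int>) \<Longrightarrow> (\<Sum>i\<in>I. f i) \<in> (\<int> :: 'k::ring_1 set)"
  by (induction I rule: infinite_finite_induct) auto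

lemma oz_closed [simp, intro]:
  "x \<in> oz \<Longrightarrow> y \<in> oz \<Longrightarrow> x + y \<in> oz" "x \<in> oz \<Longrightarrow> y \<in> oz \<Longrightarrow> x - y \<in> oz"
  "x \<in> oz \<Longrightarrow> y \<in> oz \<Longrightarrow> x \<star> y \<in> oz" "q \<in> \<int> \<Longrightarrow> x \<in> oz \<Longrightarrow> fscale q x \<in> oz" "e1 \<in> oz" "0 \<in> oz"
proof -
  show "x \<star> y \<in> oz" if xy: "x \<in> oz" "y \<in> oz"
  proof -
    have "x \<star> y \<in> zalg" using xy oz_zalg by blast
    moreover have "(x \<star> y) g \<in> \<int>" for g
      using xy unfolding conv_def by (auto simp: oz_def intro!: Ints_sum')
    ultimately show ?thesis by (simp add: oz_def)
  qed
  show "e1 \<in> oz" using e1_zalg by (simp add: oz_def) (simp add: delta_def)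
qed (auto simp: oz_def fscale_apply)

lemma oz_sum: "(\<And>i. i \<in> I \<Longrightarrow> f i \<in> oz) \<Longrightarrow> (\<Sum>i\<in>I. f i) \<in> oz"
  by (induction I rule: infinite_finite_induct) auto

lemma ind_oz [simp, intro]: "C \<in> CC \<Longrightarrow> ind C \<in> oz"
  by (auto simp: oz_def) (auto simp: ind_def)

text \<open>Both sets are bases of the complex centre. The equality makes the change of basis in
  \<open>nrm_integral\<close> a square matrix.\<close>

lemma card_PCI: "card (PCI :: ('a \<Rightarrow> complex) set) = card CC"
proof -
  define I where "I = (ind ` CC :: ('a \<Rightarrow> complex) set)"
  have inj: "inj_on (ind :: _ \<Rightarrow> 'a \<Rightarrow> complex) CC"
    by (rule inj_onI) (metis ind_crep zero_neq_one)
  have ind1: "fvs.independent I"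
  proof (rule fvs.independent_if_scalars_zero)
    fix c x assume 0: "(\<Sum>x\<in>I. fscale (c x) x) = 0" and "x \<in> I"
    then obtain D where D: "D \<in> CC" "x = ind D" by (auto simp: I_def)
    have "0 = (\<Sum>x\<in>I. fscale (c x) x) (crep D)" using 0 by simp
    also have "\<dots> = (\<Sum>C\<in>CC. if C = D then c (ind D) else 0)"
      unfolding I_def sum.reindex[OF inj] sum_fun_apply using D(1)
      by (intro sum.cong) (auto simp: fscale_apply ind_crep)
    finally show "c x = 0" using D by simp
  qed (simp add: I_def)
  have "PCI \<subseteq> fvs.span I"
  proof
    fix e :: "'a \<Rightarrow> complex" assume "e \<in> PCI"
    then have "e = (\<Sum>C\<in>CC. fscale (e (crep C)) (ind C))" by (intro zalg_ind_expand PCI_D)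
    also have "\<dots> \<in> fvs.span I" by (intro fvs.span_sum fvs.span_scale fvs.span_base) (auto simp: I_def)
    finally show "e \<in> fvs.span I" .
  qed
  moreover have "finite I" by (simp add: I_def)
  moreover have "I \<subseteq> fvs.span PCI"
  proof
    fix x assume "x \<in> I"
    then have "x \<in> zalg" by (auto simp: I_def)
    then have "x = (\<Sum>e\<in>PCI. fscale (lam e x) e)" by (rule zalg_expand)
    also have "\<dots> \<in> fvs.span PCI" by (intro fvs.span_sum fvs.span_scale fvs.span_base)
    finally show "x \<in> fvs.span PCI" .
  qed
  ultimately have "card (PCI :: ('a \<Rightarrow> complex) set) = card I"
    using fvs.independent_span_bound[of I PCI] fvs.independent_span_bound[of PCI I] PCI_independent ind1 by force
  then show ?thesis by (simp add: I_def card_image[OF inj])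
qed

definition nrm :: "('a \<Rightarrow> complex) \<Rightarrow> complex" where "nrm x = (\<Prod>e\<in>PCI. lam e x)"

text \<open>The norm is the determinant of multiplication by \<open>x\<close> on the class sums, and the adjugate matrix
  provides the cofactor \<open>v\<close>.\<close>

lemma nrm_integral:
  assumes x: "x \<in> oz"
  obtains n v where "nrm x = of_int n" "v \<in> oz" "x \<star> v = fscale (of_int n) e1"
proof -
  define m where "m = card CC"
  have xz: "x \<in> zalg" using x by (rule oz_zalg)
  obtain c where c: "bij_betw c {0..<m} CC" unfolding m_def using ex_bij_betw_nat_finite[OF finite_CC] by blast
  obtain es where es: "bij_betw es {0..<m} (PCI :: ('a \<Rightarrow> complex) set)"
    unfolding m_def card_PCI[symmetric] using ex_bij_betw_nat_finite[OF finite_PCI] by blast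
  have cC: "c i \<in> CC" and eP: "es i \<in> PCI" if "i < m" for i
    using that bij_betwE[OF c] bij_betwE[OF es] by auto
  have c_inj: "c i = c j \<longleftrightarrow> i = j" if "i < m" "j < m" for i j
    using that c by (auto simp: bij_betw_def inj_on_def)
  have expand: "z = (\<Sum>l\<in>{0..<m}. fscale (z (crep (c l))) (ind (c l)))" if "z \<in> zalg" for z :: "'a \<Rightarrow> complex"
    using zalg_ind_expand[OF that] sum.reindex_bij_betw[OF c, of "\<lambda>C. fscale (z (crep C)) (ind C)"] by simp
  \<comment> \<open>Coordinates of \<open>x\<close> times a class sum, that is, multiplication by
    \<open>x\<close> in the basis of class sums. The entries are integers; \<open>MI\<close> is the
    same matrix over \<open>int\<close>.\<close>
  define Mf where "Mf r l = (x \<star> ind (c l)) (crep (c r))" for r l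
  define MI where "MI = mat m m (\<lambda>(r, l). \<lfloor>Re (Mf r l)\<rfloor>)"
  define M where "M = mat m m (\<lambda>(r, l). Mf r l)"
  \<comment> \<open>\<open>P\<close> holds the coordinates of the idempotents in the class sums and
    \<open>Q\<close> those of the class sums in the idempotents. The columns of \<open>P\<close> are
    eigenvectors, which gives \<open>MP\<close>.\<close>
  define P where "P = mat m m (\<lambda>(r, j). es j (crep (c r)))"
  define Q where "Q = mat m m (\<lambda>(j, l). lam (es j) (ind (c l)))"
  define D where "D = mat m m (\<lambda>(i, j). if i = j then lam (es i) x else 0)"
  have MfI: "of_int \<lfloor>Re (Mf r l)\<rfloor> = Mf r l" if "l < m" for r l
  proof -
    have "x \<star> ind (c l) \<in> oz" using x cC[OF that] by blast
    then have "Mf r l \<in> \<int>" by (simp add: Mf_def oz_def)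
    then show ?thesis by (auto elim: Ints_cases)
  qed
  have carr: "M \<in> carrier_mat m m" "MI \<in> carrier_mat m m" "P \<in> carrier_mat m m" "Q \<in> carrier_mat m m" "D \<in> carrier_mat m m"
    by (auto simp: M_def MI_def P_def Q_def D_def)
  have MI: "M = map_mat of_int MI"
    by (rule eq_matI) (auto simp: M_def MI_def MfI)
  have MP: "M * P = P * D"
  proof (rule eq_matI)
    fix r j assume rj: "r < dim_row (P * D)" "j < dim_col (P * D)"
    then have r: "r < m" and j: "j < m" by (auto simp: P_def D_def)
    have "(M * P) $$ (r, j) = (\<Sum>l\<in>{0..<m}. Mf r l * es j (crep (c l)))"
      using r j by (simp add: M_def P_def scalar_prod_def)
    also have "\<dots> = (x \<star> (\<Sum>l\<in>{0..<m}. fscale (es j (crep (c l))) (ind (c l)))) (crep (c r))"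
      by (simp add: conv_sum_right conv_scale_right sum_fun_apply fscale_apply Mf_def mult.commute)
    also have "\<dots> = (x \<star> es j) (crep (c r))"
      using expand[OF PCI_D(1)[OF eP[OF j]]] by simp
    also have "\<dots> = lam (es j) x * es j (crep (c r))"
      by (simp add: lam[OF eP[OF j] xz] fscale_apply)
    also have "\<dots> = (P * D) $$ (r, j)"
      using r j by (simp add: P_def D_def scalar_prod_def if_distrib[of "\<lambda>u. _ * u"] sum.delta' cong: if_cong)
    finally show "(M * P) $$ (r, j) = (P * D) $$ (r, j)" .
  qed (auto simp: M_def P_def D_def)
  have PQ: "P * Q = 1\<^sub>m m"
  proof (rule eq_matI)
    fix r l assume rl: "r < dim_row (1\<^sub>m m)" "l < dim_col (1\<^sub>m m)"
    then have r: "r < m" and l: "l < m" by auto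
    have "(P * Q) $$ (r, l) = (\<Sum>j\<in>{0..<m}. es j (crep (c r)) * lam (es j) (ind (c l)))"
      using r l by (simp add: P_def Q_def scalar_prod_def)
    also have "\<dots> = (\<Sum>e\<in>PCI. e (crep (c r)) * lam e (ind (c l)))"
      by (rule sum.reindex_bij_betw[OF es])
    also have "\<dots> = (\<Sum>e\<in>PCI. fscale (lam e (ind (c l))) e) (crep (c r))"
      by (simp add: sum_fun_apply fscale_apply mult.commute)
    also have "\<dots> = ind (c l) (crep (c r))"
      using zalg_expand[of "ind (c l)"] cC[OF l] by simp
    finally show "(P * Q) $$ (r, l) = 1\<^sub>m m $$ (r, l)"
      using r l by (auto simp: ind_crep cC c_inj)
  qed (auto simp: P_def Q_def)
  have "det P * det Q = 1" using det_mult[OF carr(3,4)] PQ by simp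
  moreover have "det M * det P = det P * det D"
    using det_mult[OF carr(1,3)] det_mult[OF carr(3,5)] by (metis MP)
  ultimately have "det M = det D" by (metis mult.commute mult_cancel_left mult_zero_left zero_neq_one)
  also have "det D = prod_list (diag_mat D)"
    by (rule det_upper_triangular[OF _ carr(5)]) (auto simp: D_def)
  also have "\<dots> = (\<Prod>i\<in>{0..<m}. lam (es i) x)"
    by (simp add: diag_mat_def D_def prod.distinct_set_conv_list[symmetric] cong: map_cong)
  also have "\<dots> = nrm x" unfolding nrm_def by (rule prod.reindex_bij_betw[OF es])
  finally have nx: "nrm x = of_int (det MI)" by (simp add: MI of_int_hom.hom_det)
  \<comment> \<open>The coordinate vector of \<open>e1\<close>, as the class of the identity is a
    singleton. Since the adjugate \<open>adj_mat MI\<close> inverts \<open>MI\<close> up to the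
    determinant, the element \<open>v\<close> with coordinates \<open>w\<close> satisfies
    \<open>x \<star> v = det MI\<close> times \<open>e1\<close>.\<close>
  define u where "u = vec m (\<lambda>r. if crep (c r) = \<one> then 1 else 0 :: int)"
  define w where "w = adj_mat MI *\<^sub>v u"
  define v where "v = (\<Sum>l\<in>{0..<m}. fscale (of_int (w $ l)) (ind (c l) :: 'a \<Rightarrow> complex))"
  have wc: "w \<in> carrier_vec m" using adj_mat(1)[OF carr(2)] by (simp add: w_def u_def)
  have vo: "v \<in> oz" unfolding v_def using cC by (intro oz_sum) auto
  have Mw: "MI *\<^sub>v w = det MI \<cdot>\<^sub>v u"
  proof -
    have "MI *\<^sub>v w = (MI * adj_mat MI) *\<^sub>v u"
      unfolding w_def using adj_mat(1)[OF carr(2)] carr(2)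
      by (intro assoc_mult_mat_vec[symmetric, where ?n\<^sub>2.0 = m and ?n\<^sub>3.0 = m]) (auto simp: u_def)
    also have "MI * adj_mat MI = det MI \<cdot>\<^sub>m 1\<^sub>m m" by (rule adj_mat(2)[OF carr(2)])
    also have "(det MI \<cdot>\<^sub>m 1\<^sub>m m) *\<^sub>v u = det MI \<cdot>\<^sub>v u" by (auto simp: u_def)
    finally show ?thesis .
  qed
  have val: "(x \<star> v) (crep (c r)) = of_int (det MI) * e1 (crep (c r))" if r: "r < m" for r
  proof -
    have "(x \<star> v) (crep (c r)) = (\<Sum>l\<in>{0..<m}. of_int (w $ l) * Mf r l)"
      by (simp add: v_def conv_sum_right conv_scale_right sum_fun_apply fscale_apply Mf_def)
    also have "\<dots> = (\<Sum>l\<in>{0..<m}. of_int (MI $$ (r, l) * w $ l))"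
      using r MfI by (intro sum.cong) (auto simp: MI_def)
    also have "\<dots> = of_int ((MI *\<^sub>v w) $ r)"
      using r carr(2) wc by (simp add: scalar_prod_def)
    also have "\<dots> = of_int (det MI) * e1 (crep (c r))"
      unfolding Mw using r by (simp add: u_def delta_def)
    finally show ?thesis .
  qed
  have "x \<star> v = fscale (of_int (det MI)) e1"
    by (subst expand, use xz oz_zalg[OF vo] in blast, subst (2) expand, simp)
      (auto intro!: sum.cong simp: val fscale_apply)
  with nx vo show ?thesis by (rule that)
qed

lemma rz_denominator:
  assumes "x \<in> rz"
  obtains q where "q > 0" "fscale (of_nat q) x \<in> oz"
proof -
  have "\<forall>g. \<exists>d>0. of_nat d * x g \<in> \<int>"
  proof
    fix g
    have "x g \<in> \<rat>" using assms by (simp add: rz_def)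
    then obtain a b where "b > 0" "x g = of_int a / of_int b" by (auto elim: Rats_cases')
    then have "of_nat (nat b) * x g = of_int a" by simp
    then show "\<exists>d>0. of_nat d * x g \<in> \<int>" using \<open>b > 0\<close> by (intro exI[of _ "nat b"]) auto
  qed
  then obtain d where d: "\<And>g. d g > 0" "\<And>g. of_nat (d g :: nat) * x g \<in> \<int>" by metis
  define q where "q = (\<Prod>g\<in>carrier G. d g)"
  have "of_nat q * x g \<in> \<int>" for g
  proof (cases "g \<in> carrier G")
    case True
    have "of_nat q * x g = of_nat (\<Prod>h\<in>carrier G - {g}. d h) * (of_nat (d g) * x g)"
      unfolding q_def using True by (subst prod.remove[of _ g]) auto
    then show ?thesis using d(2)[of g] by (simp only: Ints_mult Ints_of_nat)
  next
    case False
    then have "x g = 0" using rz_zalg[OF assms] by (auto simp: zalg_def galg_def)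
    then show ?thesis by simp
  qed
  then have "fscale (of_nat q) x \<in> oz"
    using rz_zalg[OF assms] by (simp add: oz_def) (simp add: fscale_apply)
  moreover have "q > 0" using d(1) by (simp add: q_def prod_pos)
  ultimately show ?thesis using that by blast
qed

lemma common_denominator:
  obtains q where "q > 0" "\<And>\<epsilon>. \<epsilon> \<in> EQ \<Longrightarrow> fscale (of_nat q) \<epsilon> \<in> oz"
proof -
  have "\<forall>\<epsilon>. \<exists>q>0. \<epsilon> \<in> EQ \<longrightarrow> fscale (of_nat q) \<epsilon> \<in> oz"
  proof
    fix \<epsilon>
    show "\<exists>q>0. \<epsilon> \<in> EQ \<longrightarrow> fscale (of_nat q) \<epsilon> \<in> oz"
    proof (cases "\<epsilon> \<in> EQ")
      case True
      obtain q where "q > 0" "fscale (of_nat q) \<epsilon> \<in> oz" using rz_denominator[OF EQ_D(1)[OF True]] .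
      then show ?thesis by blast
    qed auto
  qed
  then obtain d where d: "\<And>\<epsilon>. d \<epsilon> > 0" "\<And>\<epsilon>. \<epsilon> \<in> EQ \<Longrightarrow> fscale (of_nat (d \<epsilon> :: nat)) \<epsilon> \<in> oz" by metis
  show ?thesis
  proof (rule that)
    show "(\<Prod>\<epsilon>\<in>EQ. d \<epsilon>) > 0" using d(1) by (simp add: prod_pos)
    fix \<epsilon> assume \<epsilon>: "\<epsilon> \<in> EQ"
    have "fscale (of_nat (\<Prod>\<epsilon>\<in>EQ. d \<epsilon>)) \<epsilon> = fscale (of_nat (\<Prod>\<delta>\<in>EQ - {\<epsilon>}. d \<delta>)) (fscale (of_nat (d \<epsilon>)) \<epsilon>)"
      using \<epsilon> by (subst prod.remove[of _ \<epsilon>]) (auto simp: mult.commute)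
    also have "\<dots> \<in> oz" using d(2)[OF \<epsilon>] by (rule oz_closed(4)[rotated]) (rule Ints_of_nat)
    finally show "fscale (of_nat (\<Prod>\<epsilon>\<in>EQ. d \<epsilon>)) \<epsilon> \<in> oz" .
  qed
qed

text \<open>The coefficients of \<open>x\<close> are fixed linear combinations of the values
  \<open>lam e x\<close>, so bounded values leave only finitely many integer coefficients.\<close>

lemma finite_bounded_oz: "finite {x \<in> oz. \<forall>e\<in>PCI. cmod (lam e x) \<le> R}" (is "finite ?S")
proof -
  define B where "B = (\<Sum>e\<in>(PCI :: ('a \<Rightarrow> complex) set). \<Sum>g\<in>carrier G. \<bar>R\<bar> * cmod (e g))"
  define T where "T = (of_int ` {- \<lceil>B\<rceil>..\<lceil>B\<rceil>} :: complex set)"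
  have "?S \<subseteq> {f. \<forall>x. (x \<in> carrier G \<longrightarrow> f x \<in> T) \<and> (x \<notin> carrier G \<longrightarrow> f x = 0)}"
  proof (intro subsetI CollectI allI conjI impI)
    fix x g assume x: "x \<in> ?S"
    then have xz: "x \<in> zalg" by (auto simp: oz_def)
    show "x g = 0" if "g \<notin> carrier G" using xz that by (auto simp: zalg_def galg_def)
    assume g: "g \<in> carrier G"
    have "x g = (\<Sum>e\<in>PCI. lam e x * e g)"
      by (subst zalg_expand[OF xz]) (simp add: sum_fun_apply fscale_apply)
    then have "cmod (x g) \<le> (\<Sum>e\<in>(PCI :: ('a \<Rightarrow> complex) set). cmod (lam e x * e g))"
      by (simp add: norm_sum)
    also have "\<dots> \<le> (\<Sum>e\<in>(PCI :: ('a \<Rightarrow> complex) set). \<bar>R\<bar> * cmod (e g))"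
      using x by (intro sum_mono) (auto simp: norm_mult intro!: mult_right_mono order_trans[OF _ abs_ge_self])
    also have "\<dots> \<le> B"
      unfolding B_def using g by (intro sum_mono member_le_sum) auto
    finally have b: "cmod (x g) \<le> B" .
    obtain n where n: "x g = of_int n" using x unfolding oz_def by (metis (mono_tags, lifting) Ints_cases mem_Collect_eq)
    have "\<bar>real_of_int n\<bar> \<le> B" using b by (simp add: n)
    then have "n \<in> {- \<lceil>B\<rceil>..\<lceil>B\<rceil>}" by (simp; linarith)
    then show "x g \<in> T" using n by (auto simp: T_def)
  qed
  moreover have "finite {f. \<forall>x. (x \<in> carrier G \<longrightarrow> f x \<in> T) \<and> (x \<notin> carrier G \<longrightarrow> f x = (0::complex))}"
    by (rule finite_set_of_finite_funs) (auto simp: T_def)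
  ultimately show ?thesis by (rule finite_subset)
qed

section \<open>The norm on a single component\<close>

definition nrmJ :: "('a \<Rightarrow> complex) \<Rightarrow> ('a \<Rightarrow> complex) \<Rightarrow> complex" where
  "nrmJ \<epsilon> x = (\<Prod>e\<in>J \<epsilon>. lam e x)"

lemma lam_extend:
  assumes "\<epsilon> \<in> EQ" "y \<in> K \<epsilon>" "e \<in> PCI"
  shows "lam e (y + fscale c (e1 - \<epsilon>)) = (if e \<in> J \<epsilon> then lam e y else c)"
proof -
  have "lam e (y + fscale c (e1 - \<epsilon>)) = lam e y + c * (1 - lam e \<epsilon>)"
    using assms K_zalg EQ_D by (simp add: lam_add lam_scale lam_diff)
  then show ?thesis using assms lam_EQ lam_K_outside by auto
qed

lemma nrm_extend:
  assumes "\<epsilon> \<in> EQ" "y \<in> K \<epsilon>"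
  shows "nrm (y + fscale c (e1 - \<epsilon>)) = nrmJ \<epsilon> y * c ^ card (PCI - J \<epsilon>)"
proof -
  have "nrm (y + fscale c (e1 - \<epsilon>)) = (\<Prod>e\<in>PCI. if e \<in> J \<epsilon> then lam e y else c)"
    unfolding nrm_def using assms by (intro prod.cong) (auto simp: lam_extend)
  also have "\<dots> = (\<Prod>e\<in>J \<epsilon>. lam e y) * (\<Prod>e\<in>PCI - J \<epsilon>. c)"
    by (subst prod.If_cases) (auto simp: J_def Int_def Diff_eq Compl_eq intro!: arg_cong2[where f = "(*)"] prod.cong)
  finally show ?thesis by (simp add: nrmJ_def)
qed

lemma nrmJ_nonzero: "\<epsilon> \<in> EQ \<Longrightarrow> y \<in> K \<epsilon> \<Longrightarrow> y \<noteq> 0 \<Longrightarrow> nrmJ \<epsilon> y \<noteq> 0"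
  unfolding nrmJ_def using K_ext[of \<epsilon> y 0] K_closed(6) J_PCI by (auto simp: prod_zero_iff)

text \<open>The norm of \<open>y + q (e1 - \<epsilon>)\<close> is a nonzero integer; the power of
  \<open>q\<close> is the contribution of the characters outside
  \<open>J \<epsilon>\<close>.\<close>

lemma nrmJ_lower:
  assumes q: "q > 0" "fscale (of_nat q) \<epsilon> \<in> oz" and \<epsilon>: "\<epsilon> \<in> EQ" and y: "y \<in> K \<epsilon>" "y \<in> oz" "y \<noteq> 0"
  shows "cmod (nrmJ \<epsilon> y) * real q ^ card (PCI - J \<epsilon>) \<ge> 1"
proof -
  define x where "x = y + fscale (of_nat q) (e1 - \<epsilon>)"
  have "fscale (of_nat q) (e1 - \<epsilon>) = fscale (of_nat q) e1 - fscale (of_nat q) \<epsilon>"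
    by (rule fvs.scale_right_diff_distrib)
  also have "\<dots> \<in> oz" using q(2) by (intro oz_closed(2) oz_closed(4)[OF _ oz_closed(5)]) auto
  finally have "x \<in> oz" using y by (auto simp: x_def)
  then obtain n v where n: "nrm x = of_int n" by (rule nrm_integral)
  have e: "nrm x = nrmJ \<epsilon> y * of_nat q ^ card (PCI - J \<epsilon>)"
    unfolding x_def by (rule nrm_extend[OF \<epsilon> y(1)])
  then have "nrm x \<noteq> 0" using nrmJ_nonzero[OF \<epsilon> y(1,3)] q(1) by simp
  then have "cmod (nrm x) \<ge> 1" using n by simp
  then show ?thesis by (simp add: e norm_mult norm_power)
qed

lemma oz_power:
  assumes "u \<in> oz"
  obtains w where "w \<in> oz" "\<And>e. e \<in> PCI \<Longrightarrow> lam e w = lam e u ^ k"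
proof -
  have "\<exists>w\<in>oz. \<forall>e\<in>PCI. lam e w = lam e u ^ k"
  proof (induction k)
    case 0
    show ?case by (intro bexI[of _ e1]) auto
  next
    case (Suc k)
    then obtain w where "w \<in> oz" "\<forall>e\<in>PCI. lam e w = lam e u ^ k" by blast
    then show ?case using assms by (intro bexI[of _ "u \<star> w"]) (auto simp: lam_mult oz_zalg)
  qed
  then show ?thesis using that by blast
qed

text \<open>If the norm of \<open>u\<close> on the component were smaller than 1, the elements
  obtained by cutting high powers of \<open>u\<close> down by \<open>q \<epsilon>\<close> would be
  integral, nonzero, and of arbitrarily small norm, against \<open>nrmJ_lower\<close>.\<close>

lemma nrmJ_unit_ge_1:
  assumes u: "u \<in> oz" "u' \<in> oz" "u \<star> u' = e1" and \<epsilon>: "\<epsilon> \<in> EQ"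
  shows "cmod (nrmJ \<epsilon> u) \<ge> 1"
proof (rule ccontr)
  assume "\<not> cmod (nrmJ \<epsilon> u) \<ge> 1"
  then have lt: "cmod (nrmJ \<epsilon> u) < 1" by simp
  obtain q where q: "q > 0" "\<And>\<epsilon>. \<epsilon> \<in> EQ \<Longrightarrow> fscale (of_nat q) \<epsilon> \<in> oz" using common_denominator by blast
  \<comment> \<open>The first power of \<open>q\<close> comes from the factor
    \<open>q \<epsilon>\<close> in \<open>y\<close>, the second one from
    \<open>nrmJ_lower\<close>.\<close>
  define c where "c = real q ^ card (J \<epsilon>) * real q ^ card (PCI - J \<epsilon>)"
  have c: "c > 0" using q(1) by (simp add: c_def)
  obtain k where k: "cmod (nrmJ \<epsilon> u) ^ k < 1 / c" using real_arch_pow_inv[OF _ lt, of "1 / c"] c by auto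
  obtain w where w: "w \<in> oz" "\<And>e. e \<in> PCI \<Longrightarrow> lam e w = lam e u ^ k" using oz_power[OF u(1), of k] by blast
  define y where "y = w \<star> fscale (of_nat q) \<epsilon>"
  have yo: "y \<in> oz" using w(1) q(2)[OF \<epsilon>] by (auto simp: y_def)
  have yK: "y \<in> K \<epsilon>"
    using K_closed(4,5)[OF \<epsilon>] oz_rz[OF w(1)] by (simp add: y_def conv_scale_right)
  have ly: "lam e y = of_nat q * lam e u ^ k" if "e \<in> J \<epsilon>" for e
    using that w J_PCI[OF that] EQ_D[OF \<epsilon>] lam_J[OF \<epsilon> that] by (simp add: y_def lam_mult lam_scale oz_zalg)
  have nz: "lam e u \<noteq> 0" if "e \<in> PCI" for e
    using lam_mult[OF that oz_zalg[OF u(1)] oz_zalg[OF u(2)]] u(3) that by auto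
  obtain e where e: "e \<in> J \<epsilon>" using J_nonempty[OF \<epsilon>] by blast
  have "lam e y \<noteq> 0" using ly[OF e] nz[OF J_PCI[OF e]] q(1) by simp
  then have "y \<noteq> 0" using J_PCI[OF e] by auto
  then have "1 \<le> cmod (nrmJ \<epsilon> y) * real q ^ card (PCI - J \<epsilon>)"
    by (intro nrmJ_lower q \<epsilon> yK yo)
  also have "nrmJ \<epsilon> y = of_nat q ^ card (J \<epsilon>) * nrmJ \<epsilon> u ^ k"
    unfolding nrmJ_def by (simp add: ly prod.distrib prod_power_distrib)
  finally have "1 \<le> c * cmod (nrmJ \<epsilon> u) ^ k" by (simp add: norm_mult norm_power c_def ac_simps)
  then show False using k c by (simp add: field_simps)
qed

text \<open>The preceding bound holds for \<open>u\<close> and for its inverse, and the two absolute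
  values multiply to 1.\<close>

lemma nrmJ_unit:
  assumes u: "u \<in> oz" "u' \<in> oz" "u \<star> u' = e1" and \<epsilon>: "\<epsilon> \<in> EQ"
  shows "cmod (nrmJ \<epsilon> u) = 1"
proof -
  have "lam e u * lam e u' = 1" if "e \<in> J \<epsilon>" for e
    using lam_mult[of e u u'] u J_PCI[OF that] by (simp add: oz_zalg)
  then have "nrmJ \<epsilon> u * nrmJ \<epsilon> u' = 1"
    unfolding nrmJ_def prod.distrib[symmetric] by (simp cong: prod.cong)
  then have "cmod (nrmJ \<epsilon> u) * cmod (nrmJ \<epsilon> u') = 1" by (metis norm_mult norm_one)
  moreover have "cmod (nrmJ \<epsilon> u') \<ge> 1"
    using nrmJ_unit_ge_1[OF u(2,1) _ \<epsilon>] u zalg_commute[OF oz_zalg[OF u(1)]] by simp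
  ultimately show ?thesis using nrmJ_unit_ge_1[OF u \<epsilon>]
      mult_left_mono[of 1 "cmod (nrmJ \<epsilon> u')" "cmod (nrmJ \<epsilon> u)"] by simp
qed

section \<open>Existence of units\<close>

text \<open>Clearing denominators in a rational orthogonal basis preserves orthogonality, so
  independence over the complex numbers again comes for free.\<close>

lemma integral_basis:
  assumes \<epsilon>: "\<epsilon> \<in> EQ"
  obtains B where "finite B" "B \<subseteq> K \<epsilon> \<inter> oz" "card B = card (J \<epsilon>)" "fvs.independent B"
proof -
  obtain f where f: "f \<in> PCI" "\<epsilon> = rc f" using \<epsilon> by (auto simp: EQ_def)
  obtain B where B: "Q.orth_set B" "B \<subseteq> {x \<in> zalg. x \<star> f = x}" "card B = card (J \<epsilon>)"
    by (rule rational_basis[OF f(1), folded f(2)])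
  have BK: "rc b \<in> K \<epsilon>" if "b \<in> B" for b
  proof -
    have "b \<in> zalg" "b \<star> f = b" using that B(2) by blast+
    then show ?thesis using rc_conv[of b f] by (auto simp: K_def rz_iff f(2))
  qed
  have "\<forall>b. \<exists>q>0. b \<in> B \<longrightarrow> fscale (of_nat q) (rc b) \<in> oz"
  proof
    fix b
    show "\<exists>q>0. b \<in> B \<longrightarrow> fscale (of_nat q) (rc b) \<in> oz"
    proof (cases "b \<in> B")
      case True
      obtain q where "q > 0" "fscale (of_nat q) (rc b) \<in> oz" using rz_denominator[OF K_rz[OF BK[OF True]]] .
      then show ?thesis by blast
    qed auto
  qed
  then obtain q where q: "\<And>b. q b > 0" "\<And>b. b \<in> B \<Longrightarrow> fscale (of_nat (q b :: nat)) (rc b) \<in> oz" by metis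
  define \<beta> where "\<beta> b = fscale (of_nat (q b)) (rc b)" for b
  have \<beta>: "\<beta> b = rc (fscale (of_nat (q b)) b)" for b by (simp add: \<beta>_def rc_scale)
  have ip\<beta>: "C.ip (\<beta> b) (\<beta> b') = of_rat (of_nat (q b) * of_nat (q b') * Q.ip b b')" for b b'
    unfolding \<beta> rc_ip by (simp add: Q.ip_explicit fscale_apply sum_distrib_left mult_ac)
  have nz: "\<beta> b \<noteq> 0" if "b \<in> B" for b
    using that B(1) q(1)[of b] by (auto simp: \<beta>_def Q.orth_set_def)
  have gal: "\<beta> b \<in> galg" if "b \<in> B" for b
    using that B(2) by (auto simp: \<beta>_def zalg_galg)
  have inj: "inj_on \<beta> B"
  proof (rule inj_onI, rule ccontr)
    fix b b' assume b: "b \<in> B" "b' \<in> B" "\<beta> b = \<beta> b'" "b \<noteq> b'"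
    then have "C.ip (\<beta> b) (\<beta> b) = 0" using ip\<beta>[of b b'] B(1) by (auto simp: Q.orth_set_def)
    then show False using C.ip_self nz gal b(1) by blast
  qed
  have fB: "finite B" using B(1) by (simp add: Q.orth_set_def)
  have "C.orth_set (\<beta> ` B)"
    using B(1) nz gal fB by (auto simp: C.orth_set_def ip\<beta>) (metis Q.orth_set_def)
  then have "fvs.independent (\<beta> ` B)" by (rule C.orth_set_independent)
  moreover have "\<beta> ` B \<subseteq> K \<epsilon> \<inter> oz"
    using q(2) BK K_closed(4)[OF \<epsilon>] by (auto simp: \<beta>_def)
  ultimately show ?thesis using fB B(3) by (intro that[of "\<beta> ` B"]) (auto simp: card_image[OF inj])
qed

text \<open>Dirichlet's pigeonhole argument: on \<open>W\<close>, the real linear forms \<open>Re + Im\<close> of the values at the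
  conjugation-invariant set \<open>W\<close> of places determine the values themselves.\<close>

lemma small_elements:
  assumes \<epsilon>: "\<epsilon> \<in> EQ" and v: "v \<in> J \<epsilon>" and W: "W = J \<epsilon> - {v, bar v}" "W \<noteq> {}"
  obtains C where "C > 0"
    "\<And>\<delta>. \<delta> > 0 \<Longrightarrow> \<exists>y\<in>K \<epsilon> \<inter> oz. y \<noteq> 0 \<and> (\<forall>w\<in>W. cmod (lam w y) < \<delta>) \<and> cmod (nrmJ \<epsilon> y) \<le> C"
proof -
  obtain B where B: "finite B" "B \<subseteq> K \<epsilon> \<inter> oz" "card B = card (J \<epsilon>)" "fvs.independent B"
    using integral_basis[OF \<epsilon>] .
  define n where "n = card (J \<epsilon>)"
  \<comment> \<open>The place of \<open>v\<close>: one embedding if \<open>v\<close> is real, two if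
    it is complex. The exponent \<open>s\<close> treats both cases at once.\<close>
  define V where "V = {v, bar v}"
  define s where "s = card V"
  have JVW: "J \<epsilon> = V \<union> W" "V \<inter> W = {}" using v bar_J[OF \<epsilon> v] by (auto simp: W V_def)
  have fVW: "finite V" "finite W" by (auto simp: W V_def)
  have s: "s \<ge> 1" using fVW by (auto simp: s_def V_def card_gt_0_iff Suc_le_eq)
  have n: "n = s + card W" unfolding n_def s_def JVW(1) by (rule card_Un_disjoint[OF fVW JVW(2)])
  have barW: "bar w \<in> W" if "w \<in> W" for w
    using that bar_J[OF \<epsilon>, of w] unfolding W by (metis Diff_iff bar_bar insert_iff singletonD)
  have BzP: "b \<in> zalg" if "b \<in> B" for b using that B(2) oz_zalg by auto
  \<comment> \<open>The summand 1 turns the estimate \<open>H (c - 1)\<close> of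
    \<open>Xbound\<close> into the strict estimate \<open>H c\<close> that keeps all values inside
    the grid.\<close>
  define c where "c = 1 + (\<Sum>b\<in>B. \<Sum>e\<in>J \<epsilon>. cmod (lam e b))"
  have c1: "c \<ge> 1" unfolding c_def by (simp add: sum_nonneg)
  define comb where "comb a = (\<Sum>b\<in>B. fscale (of_int (a b)) b)" for a :: "('a \<Rightarrow> complex) \<Rightarrow> int"
  have XK: "comb a \<in> K \<epsilon> \<inter> oz" for a
  proof
    show "comb a \<in> oz" unfolding comb_def using B(2) by (intro oz_sum oz_closed(4)) auto
    have "comb a \<star> \<epsilon> = comb a"
      unfolding comb_def conv_sum_left conv_scale_left using B(2) by (intro sum.cong) (auto simp: K_def)
    then show "comb a \<in> K \<epsilon>" using oz_rz[OF \<open>comb a \<in> oz\<close>] by (simp add: K_def)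
  qed
  have lamX: "lam e (comb a) = (\<Sum>b\<in>B. of_int (a b) * lam e b)" if "e \<in> PCI" for e a
    unfolding comb_def using that BzP by (subst lam_sum) (auto simp: lam_scale)
  have Xbound: "cmod (lam e (comb a)) \<le> real H * (c - 1)"
    if e: "e \<in> J \<epsilon>" and a: "\<And>b. b \<in> B \<Longrightarrow> \<bar>a b\<bar> \<le> int H" for e a H
  proof -
    have "cmod (lam e (comb a)) \<le> (\<Sum>b\<in>B. cmod (of_int (a b) * lam e b))"
      unfolding lamX[OF J_PCI[OF e]] by (rule norm_sum)
    also have "\<dots> \<le> (\<Sum>b\<in>B. real H * (\<Sum>e\<in>J \<epsilon>. cmod (lam e b)))"
    proof (rule sum_mono)
      fix b assume b: "b \<in> B"
      have "cmod (of_int (a b)) \<le> real H" using a[OF b] by simp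
      moreover have "cmod (lam e b) \<le> (\<Sum>e\<in>J \<epsilon>. cmod (lam e b))" using e by (intro member_le_sum) auto
      ultimately show "cmod (of_int (a b) * lam e b) \<le> real H * (\<Sum>e\<in>J \<epsilon>. cmod (lam e b))"
        unfolding norm_mult by (intro mult_mono) auto
    qed
    finally show ?thesis by (simp add: c_def sum_distrib_left)
  qed
  \<comment> \<open>This is \<open>(H c) ^ s * (2 h) ^ card W\<close> for the parameters
    \<open>H\<close> and \<open>h\<close> chosen below: the powers of \<open>t\<close> in
    \<open>H\<close> and in \<open>h\<close> cancel, so the bound does not depend on
    \<delta>.\<close>
  define C where "C = c ^ s * (8 * c) ^ card W"
  have "C > 0" using c1 by (simp add: C_def)
  moreover have "\<exists>y\<in>K \<epsilon> \<inter> oz. y \<noteq> 0 \<and> (\<forall>w\<in>W. cmod (lam w y) < \<delta>) \<and> cmod (nrmJ \<epsilon> y) \<le> C"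
    if \<delta>: "\<delta> > 0" for \<delta>
  proof -
    \<comment> \<open>Chosen so that \<open>2 h = 8 c / t ^ s\<close>, the bound for the values on
      \<open>W\<close>, is below \<delta>.\<close>
    obtain t where t: "real t > 8 * c / \<delta>" using reals_Archimedean2 by blast
    moreover have "8 * c / \<delta> > 0" using c1 \<delta> by simp
    ultimately have t0: "t > 0" using of_nat_0_less_iff[where ?'a = real, of t] by linarith
    \<comment> \<open>Coefficients range over \<open>0..H\<close> and each of the
      \<open>card W\<close> forms is divided into \<open>T\<close> cells. The exponents are balanced
      so that \<open>T ^ card W = H ^ n\<close>, just below the number \<open>(H + 1) ^ n\<close> of
      coefficient vectors.\<close>
    define H where "H = t ^ card W"
    define T where "T = t ^ n"
    have H0: "H > 0" and T0: "T > 0" using t0 by (auto simp: H_def T_def)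
    \<comment> \<open>The cell width: the forms take values strictly between \<open>- 2 c H\<close>
      and \<open>2 c H\<close>, an interval of length \<open>4 c H\<close>.\<close>
    define h where "h = 4 * c * real H / real T"
    have h0: "h > 0" using c1 H0 T0 by (simp add: h_def)
    have h_eq: "h = 4 * c / real t ^ s"
      using t0 by (simp add: h_def H_def T_def n power_add field_simps)
    define F where "F w y = Re (lam w y) + Im (lam w y)" for w y
    define A where "A = B \<rightarrow>\<^sub>E {0..int H}"
    \<comment> \<open>The shift by \<open>2 c H\<close> makes the argument of the floor positive, so
      that the cells are numbered from 0 to \<open>T - 1\<close>.\<close>
    define cell where "cell a = (\<lambda>w\<in>W. \<lfloor>(F w (comb a) + 2 * c * H) / h\<rfloor>)" for a
    have "cell ` A \<subseteq> W \<rightarrow>\<^sub>E {0..<int T}"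
    proof (intro image_subsetI)
      fix a assume a: "a \<in> A"
      show "cell a \<in> W \<rightarrow>\<^sub>E {0..<int T}"
      proof (intro PiE_I)
        fix w assume w: "w \<in> W"
        have ab: "\<bar>a b\<bar> \<le> int H" if "b \<in> B" for b
          using PiE_mem[OF a[unfolded A_def] that] by simp
        have "cmod (lam w (comb a)) \<le> real H * (c - 1)"
          using w W(1) by (intro Xbound ab) auto
        also have "\<dots> < real H * c" using H0 by simp
        finally have m: "cmod (lam w (comb a)) < c * real H" by (simp add: mult.commute)
        have "\<bar>F w (comb a)\<bar> < 2 * (c * real H)"
          using m abs_Re_le_cmod[of "lam w (comb a)"] abs_Im_le_cmod[of "lam w (comb a)"] by (simp add: F_def)
        then have 1: "0 < F w (comb a) + 2 * c * H" "F w (comb a) + 2 * c * H < 4 * c * H" by linarith+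
        have "(F w (comb a) + 2 * c * H) / h < (4 * c * H) / h" using 1(2) h0 by (rule divide_strict_right_mono)
        also have "\<dots> = T" using c1 H0 T0 by (simp add: h_def)
        finally have "(F w (comb a) + 2 * c * H) / h < T" .
        moreover have "0 \<le> (F w (comb a) + 2 * c * H) / h" using 1(1) h0 by simp
        ultimately show "cell a w \<in> {0..<int T}" using w by (simp add: cell_def floor_less_iff)
      qed (simp add: cell_def)
    qed
    moreover have "card (W \<rightarrow>\<^sub>E {0..<int T}) = T ^ card W" using fVW by (simp add: card_PiE)
    moreover have "card A = (H + 1) ^ n" using B(1,3) by (simp add: A_def card_PiE n_def nat_add_distrib)
    moreover have "T ^ card W = H ^ n" by (simp add: T_def H_def mult.commute flip: power_mult)
    moreover have "H ^ n < (H + 1) ^ n" using n s by (intro power_strict_mono) auto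
    moreover have "finite (W \<rightarrow>\<^sub>E {0..<int T})" using fVW by (intro finite_PiE) auto
    ultimately have "card (cell ` A) < card A" by (metis card_mono le_less_trans)
    then have "\<not> inj_on cell A" by (metis card_image less_irrefl)
    then obtain a a' where a: "a \<in> A" "a' \<in> A" "a \<noteq> a'" "cell a = cell a'" by (auto simp: inj_on_def)
    define d where "d b = a b - a' b" for b
    define y where "y = comb d"
    have yX: "y = comb a - comb a'"
      by (simp add: y_def comb_def d_def fvs.scale_left_diff_distrib sum_subtractf)
    have db: "\<bar>d b\<bar> \<le> int H" if "b \<in> B" for b
      using PiE_mem[OF a(1)[unfolded A_def] that] PiE_mem[OF a(2)[unfolded A_def] that]
      unfolding atLeastAtMost_iff d_def by linarith
    have y0: "y \<noteq> 0"
    proof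
      assume "y = 0"
      have "a b = a' b" if "b \<in> B" for b
      proof -
        have "(\<Sum>b\<in>B. fscale (of_int (d b) :: complex) b) = 0" using \<open>y = 0\<close> by (simp add: y_def comb_def)
        then have "(of_int (d b) :: complex) = 0"
          by (rule fvs.independentD[OF B(4) B(1) order_refl _ that])
        then show ?thesis by (simp add: d_def)
      qed
      then have "a = a'" using a(1,2) unfolding A_def by (intro PiE_ext)
      then show False using a(3) by simp
    qed
    have Fy: "\<bar>F w y\<bar> < h" if w: "w \<in> W" for w
    proof -
      have wP: "w \<in> PCI" using w W(1) J_PCI by blast
      have "\<lfloor>(F w (comb a) + 2 * c * H) / h\<rfloor> = \<lfloor>(F w (comb a') + 2 * c * H) / h\<rfloor>"
        using fun_cong[OF a(4), of w] w by (simp add: cell_def)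
      then have "\<bar>(F w (comb a) + 2 * c * H) / h - (F w (comb a') + 2 * c * H) / h\<bar> < 1" by linarith
      moreover have "(F w (comb a) + 2 * c * H) / h - (F w (comb a') + 2 * c * H) / h = F w y / h"
        using XK wP oz_zalg by (simp add: yX F_def lam_diff diff_divide_distrib[symmetric])
      ultimately show ?thesis using h0 by (simp add: abs_divide)
    qed
    have yW: "cmod (lam w y) < 2 * h" if w: "w \<in> W" for w
    proof -
      have wP: "w \<in> PCI" using w W(1) J_PCI by blast
      have yr: "y \<in> rz" using XK oz_rz by (auto simp: y_def)
      have "F (bar w) y = Re (lam w y) - Im (lam w y)" by (simp add: F_def lam_bar_rz[OF wP yr])
      then have "\<bar>Re (lam w y)\<bar> < h \<and> \<bar>Im (lam w y)\<bar> < h"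
        using Fy[OF w] Fy[OF barW[OF w]] by (auto simp: F_def)
      then show ?thesis using cmod_le[of "lam w y"] by linarith
    qed
    have th: "2 * h < \<delta>"
    proof -
      have "real t \<le> real t ^ s" using t0 s by (intro self_le_power) auto
      then have "8 * c / real t ^ s \<le> 8 * c / real t" using t0 c1 by (intro divide_left_mono) auto
      also have "\<dots> < \<delta>" using t t0 \<delta> by (simp add: field_simps)
      finally show ?thesis by (simp add: h_eq)
    qed
    have "cmod (nrmJ \<epsilon> y) = (\<Prod>e\<in>V. cmod (lam e y)) * (\<Prod>e\<in>W. cmod (lam e y))"
      unfolding nrmJ_def JVW(1) prod_norm[symmetric] by (rule prod.union_disjoint[OF fVW JVW(2)])
    also have "\<dots> \<le> (\<Prod>e\<in>V. real H * c) * (\<Prod>e\<in>W. 2 * h)"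
    proof (intro mult_mono prod_mono conjI prod_nonneg)
      fix e assume "e \<in> V"
      then have "cmod (lam e y) \<le> real H * (c - 1)" unfolding y_def using JVW db by (intro Xbound) auto
      also have "\<dots> \<le> real H * c" by (intro mult_left_mono) auto
      finally show "cmod (lam e y) \<le> real H * c" .
    qed (use yW c1 in \<open>auto intro: less_imp_le\<close>)
    also have "\<dots> = (real H * c) ^ s * (2 * h) ^ card W" by (simp add: s_def)
    also have "\<dots> = C"
      using t0 by (simp add: C_def h_eq H_def power_mult_distrib power_divide mult.commute flip: power_mult)
    finally have "cmod (nrmJ \<epsilon> y) \<le> C" .
    then show ?thesis using y0 yW th XK unfolding y_def by (meson less_trans)
  qed
  ultimately show ?thesis by (rule that)
qed

text \<open>Among infinitely many integral elements with strictly decreasing values on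
  \<open>W\<close> and bounded norm, two completed ones have the same norm and are congruent modulo
  it. The quotient of the later one by the earlier one is then an integral unit, small on
  \<open>W\<close> and trivial outside the component.\<close>

lemma unit_exists:
  assumes \<epsilon>: "\<epsilon> \<in> EQ" and v: "v \<in> J \<epsilon>" and W: "W = J \<epsilon> - {v, bar v}" "W \<noteq> {}"
  obtains u u' where "u \<in> oz" "u' \<in> oz" "u \<star> u' = e1" "\<And>e. e \<in> PCI \<Longrightarrow> e \<notin> J \<epsilon> \<Longrightarrow> lam e u = 1"
    "\<And>w. w \<in> W \<Longrightarrow> cmod (lam w u) < 1"
proof -
  obtain C where C: "C > 0"
    "\<And>\<delta>. \<delta> > 0 \<Longrightarrow> \<exists>y\<in>K \<epsilon> \<inter> oz. y \<noteq> 0 \<and> (\<forall>w\<in>W. cmod (lam w y) < \<delta>) \<and> cmod (nrmJ \<epsilon> y) \<le> C"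
    using small_elements[OF \<epsilon> v W] by blast
  define P where "P y \<longleftrightarrow> y \<in> K \<epsilon> \<and> y \<in> oz \<and> y \<noteq> 0 \<and> cmod (nrmJ \<epsilon> y) \<le> C" for y
  have fW: "finite W" by (simp add: W)
  have lam_nz: "lam w y \<noteq> 0" if "P y" "w \<in> W" for y w
    using that K_ext[OF \<epsilon>, of y 0 w] K_closed(6)[OF \<epsilon>] J_PCI W(1) by (auto simp: P_def)
  have "\<exists>y. P y" using C(2)[of 1] by (auto simp: P_def)
  moreover have "\<exists>y'. P y' \<and> (\<forall>w\<in>W. cmod (lam w y') < cmod (lam w y))" if y: "P y" for y
  proof -
    \<comment> \<open>Undercutting the least of the current values makes the next element smaller at
      all places of \<open>W\<close> simultaneously.\<close>
    define \<delta> where "\<delta> = Min ((\<lambda>w. cmod (lam w y)) ` W)"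
    have "\<delta> > 0" unfolding \<delta>_def using fW W(2) lam_nz[OF y] by (subst Min_gr_iff) auto
    then obtain y' where "P y'" "\<forall>w\<in>W. cmod (lam w y') < \<delta>" using C(2)[of \<delta>] by (auto simp: P_def)
    moreover have "\<delta> \<le> cmod (lam w y)" if "w \<in> W" for w
      unfolding \<delta>_def using fW that by (intro Min_le) auto
    ultimately show ?thesis by (meson less_le_trans)
  qed
  ultimately obtain y where y: "\<And>k. P (y k)" "\<And>k w. w \<in> W \<Longrightarrow> cmod (lam w (y (Suc k))) < cmod (lam w (y k))"
    using dependent_nat_choice[of "\<lambda>_. P" "\<lambda>_ y y'. \<forall>w\<in>W. cmod (lam w y') < cmod (lam w y)"] by metis
  have dec: "cmod (lam w (y l)) < cmod (lam w (y k))" if "k < l" "w \<in> W" for k l w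
    using lift_Suc_mono_less[of "\<lambda>k. - cmod (lam w (y k))" k l] y(2)[OF that(2)] that(1) by simp
  obtain q where q: "q > 0" "\<And>\<epsilon>. \<epsilon> \<in> EQ \<Longrightarrow> fscale (of_nat q) \<epsilon> \<in> oz" using common_denominator by blast
  define x where "x k = y k + fscale (of_nat q) (e1 - \<epsilon>)" for k
  have "fscale (of_nat q) (e1 - \<epsilon>) = fscale (of_nat q) e1 - fscale (of_nat q) \<epsilon>"
    by (rule fvs.scale_right_diff_distrib)
  also have "\<dots> \<in> oz" using q(2)[OF \<epsilon>] by (intro oz_closed(2) oz_closed(4)[OF _ oz_closed(5)]) auto
  finally have xo: "x k \<in> oz" for k using y(1)[of k] by (auto simp: x_def P_def)
  have lx: "lam e (x k) = (if e \<in> J \<epsilon> then lam e (y k) else of_nat q)" if "e \<in> PCI" for e k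
    unfolding x_def using y(1)[of k] that by (intro lam_extend \<epsilon>) (auto simp: P_def)
  have "\<forall>k. \<exists>n v. nrm (x k) = of_int n \<and> v \<in> oz \<and> x k \<star> v = fscale (of_int n) e1"
    using nrm_integral[OF xo] by metis
  then obtain N v where N: "\<And>k. nrm (x k) = of_int (N k)"
    and v: "\<And>k. v k \<in> oz" "\<And>k. x k \<star> v k = fscale (of_int (N k)) e1" by metis
  define M where "M = \<lceil>C * real q ^ card (PCI - J \<epsilon>)\<rceil>"
  have nx: "nrm (x k) = nrmJ \<epsilon> (y k) * of_nat q ^ card (PCI - J \<epsilon>)" for k
    unfolding x_def using y(1)[of k] by (intro nrm_extend[OF \<epsilon>]) (auto simp: P_def)
  have N0: "N k \<noteq> 0" for k
  proof -
    have "nrm (x k) \<noteq> 0" using nx[of k] q(1) nrmJ_nonzero[OF \<epsilon>] y(1)[of k] by (auto simp: P_def)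
    then show ?thesis using N[of k] by auto
  qed
  have NM: "\<bar>N k\<bar> \<le> M" for k
  proof -
    have "real_of_int \<bar>N k\<bar> = cmod (nrm (x k))" by (simp add: N)
    also have "\<dots> \<le> C * real q ^ card (PCI - J \<epsilon>)"
      unfolding nx norm_mult using y(1)[of k] C(1) by (intro mult_mono) (auto simp: P_def norm_power)
    finally show ?thesis unfolding M_def by linarith
  qed
  \<comment> \<open>The invariant of the pigeonhole argument: the norm together with all
    coefficients modulo the norm.\<close>
  define \<kappa> where "\<kappa> k = (N k, \<lambda>g. if g \<in> carrier G then \<lfloor>Re (x k g)\<rfloor> mod N k else 0)" for k
  have "range \<kappa> \<subseteq> {- M..M} \<times> {f. \<forall>g. (g \<in> carrier G \<longrightarrow> f g \<in> {- M..M}) \<and> (g \<notin> carrier G \<longrightarrow> f g = 0)}"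
  proof (intro image_subsetI)
    fix k
    have "\<bar>a mod N k\<bar> \<le> M" for a
      using NM[of k] N0[of k] pos_mod_bound[of "N k" a] pos_mod_sign[of "N k" a]
        neg_mod_bound[of "N k" a] neg_mod_sign[of "N k" a] by linarith
    then have "a mod N k \<in> {- M..M}" for a by (meson abs_le_iff atLeastAtMost_iff minus_le_iff)
    moreover have "N k \<in> {- M..M}" using NM[of k] by auto
    ultimately show "\<kappa> k \<in> {- M..M} \<times> {f. \<forall>g. (g \<in> carrier G \<longrightarrow> f g \<in> {- M..M}) \<and> (g \<notin> carrier G \<longrightarrow> f g = 0)}"
      unfolding \<kappa>_def by (simp del: atLeastAtMost_iff)
  qed
  moreover have "finite ({- M..M} \<times> {f. \<forall>g. (g \<in> carrier G \<longrightarrow> f g \<in> {- M..M}) \<and> (g \<notin> carrier G \<longrightarrow> f g = 0)})"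
    by (intro finite_cartesian_product finite_set_of_finite_funs) auto
  ultimately have "finite (range \<kappa>)" by (rule finite_subset)
  then have "\<not> inj \<kappa>" using finite_imageD infinite_UNIV_nat by blast
  then obtain i j where "i \<noteq> j" "\<kappa> i = \<kappa> j" by (auto simp: inj_def)
  then obtain k l where kl: "k < l" "\<kappa> k = \<kappa> l" by (metis linorder_neqE_nat)
  define n where "n = N k"
  have Nl: "N l = n" using kl(2) by (simp add: \<kappa>_def n_def)
  have n0: "n \<noteq> 0" using N0 by (simp add: n_def)
  define z where "z = fscale (1 / of_int n) (x l - x k)"
  have zz: "z \<in> zalg" using oz_zalg[OF xo] by (auto simp: z_def)
  have "z g \<in> \<int>" for g
  proof (cases "g \<in> carrier G")
    case True
    have "\<exists>a. x i g = of_int a" for i using xo[of i] by (auto simp: oz_def Ints_def)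
    then obtain a b where ab: "x k g = of_int a" "x l g = of_int b" by metis
    have "a mod n = b mod n"
      using fun_cong[OF arg_cong[OF kl(2), of snd], of g] True by (simp add: \<kappa>_def ab Nl flip: n_def)
    then have "n dvd b - a" by (metis mod_eq_dvd_iff)
    then obtain c where "b - a = n * c" by (elim dvdE)
    then have "(of_int b - of_int a :: complex) = of_int n * of_int c" by (metis of_int_diff of_int_mult)
    then have "z g = of_int c" using n0 by (simp add: z_def fscale_apply ab)
    then show ?thesis by simp
  next
    case False
    then have "z g = 0" using zz by (auto simp: zalg_def galg_def)
    then show ?thesis by simp
  qed
  then have zo: "z \<in> oz" using zz by (simp add: oz_def)
  have nz: "x l - x k = fscale (of_int n) z" using n0 by (simp add: z_def fvs.scale_scale fvs.scale_one)
  define u where "u = e1 + z \<star> v k"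
  define u' where "u' = e1 - z \<star> v l"
  have uo: "u \<in> oz" "u' \<in> oz" using zo v(1) by (auto simp: u_def u'_def)
  have lz: "lam e (x l) - lam e (x k) = of_int n * lam e z" if "e \<in> PCI" for e
    using arg_cong[OF nz, of "lam e"] that oz_zalg[OF xo] zz by (simp add: lam_diff lam_scale)
  have lv: "lam e (x i) * lam e (v i) = of_int (N i)" if "e \<in> PCI" for e i
    using arg_cong[OF v(2)[of i], of "lam e"] that oz_zalg[OF xo] oz_zalg[OF v(1)] by (simp add: lam_mult lam_scale)
  have lx0: "lam e (x i) \<noteq> 0" if "e \<in> PCI" for e i using lv[OF that, of i] N0[of i] by auto
  have lu: "lam e (x k) * lam e u = lam e (x l)" if e: "e \<in> PCI" for e
  proof -
    have "lam e (x k) * lam e u = lam e (x k) + lam e z * (lam e (x k) * lam e (v k))"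
      using e zz oz_zalg[OF v(1)] by (simp add: u_def lam_add lam_mult algebra_simps)
    then show ?thesis using lz[OF e] lv[OF e, of k] by (simp add: n_def algebra_simps)
  qed
  have lu': "lam e (x l) * lam e u' = lam e (x k)" if e: "e \<in> PCI" for e
  proof -
    have "lam e (x l) * lam e u' = lam e (x l) - lam e z * (lam e (x l) * lam e (v l))"
      using e zz oz_zalg[OF v(1)] by (simp add: u'_def lam_diff lam_mult algebra_simps)
    then show ?thesis using lz[OF e] lv[OF e, of l] by (simp add: Nl algebra_simps)
  qed
  have "u \<star> u' = e1"
  proof (rule lam_ext)
    fix e :: "'a \<Rightarrow> complex" assume e: "e \<in> PCI"
    have "lam e (x k) * (lam e u * lam e u') = lam e (x k)" using lu[OF e] lu'[OF e] by (simp add: mult.assoc[symmetric])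
    then show "lam e (u \<star> u') = lam e e1" using e lx0[OF e, of k] uo oz_zalg by (simp add: lam_mult)
  qed (use uo oz_zalg in auto)
  moreover have "lam e u = 1" if "e \<in> PCI" "e \<notin> J \<epsilon>" for e
    using lu[OF that(1)] lx[OF that(1)] that(2) q(1) by simp
  moreover have "cmod (lam w u) < 1" if w: "w \<in> W" for w
  proof -
    have wJ: "w \<in> J \<epsilon>" using w W(1) by blast
    have "cmod (lam w (y k)) * cmod (lam w u) = cmod (lam w (y l))"
      using lu[OF J_PCI[OF wJ]] lx[OF J_PCI[OF wJ]] wJ by (metis norm_mult)
    then have "cmod (lam w (y k)) * cmod (lam w u) < cmod (lam w (y k)) * 1" using dec[OF kl(1) w] by simp
    then show ?thesis using lam_nz[OF y(1) w] by (simp add: mult_less_cancel_left)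
  qed
  ultimately show ?thesis using uo by (intro that)
qed

end

section \<open>The group of central units\<close>

text \<open>If \<open>L\<close> is not identically zero, local finiteness provides an element
  \<open>a\<close> with least positive value. Division with remainder writes every element as a
  power of \<open>a\<close> times an element of the kernel \<open>T\<close>, and
  \<open>L a > 0\<close> makes the powers of \<open>a\<close> distinct and disjoint from
  \<open>T\<close> except for the identity.\<close>

lemma (in group) cyclic_complement:
  fixes L :: "'a \<Rightarrow> real"
  assumes L: "\<And>x y. x \<in> carrier G \<Longrightarrow> y \<in> carrier G \<Longrightarrow> L (x \<otimes> y) = L x + L y"
    and T: "T = {x \<in> carrier G. L x = 0}"
    and fin: "\<And>R. finite {L x | x. x \<in> carrier G \<and> 0 < L x \<and> L x \<le> R}"
  obtains A r where "r \<le> 1" "subgroup A G" "T \<inter> A = {\<one>}" "T <#> A = carrier G"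
    "G\<lparr>carrier := A\<rparr> \<cong> free_Abelian_group {..<r :: nat}"
proof -
  have L1: "L \<one> = 0" using L[of \<one> \<one>] by simp
  have Linv: "L (inv x) = - L x" if "x \<in> carrier G" for x using L[of x "inv x"] that L1 by simp
  show ?thesis
  proof (cases "\<forall>x\<in>carrier G. L x = 0")
    case True
    show ?thesis
    proof (rule that)
      show "(0::nat) \<le> 1" by simp
      show "subgroup {\<one>} G" by (rule triv_subgroup)
      show "T \<inter> {\<one>} = {\<one>}" using T L1 by auto
      show "T <#> {\<one>} = carrier G" using True by (auto simp: T set_mult_def)
      have "(\<lambda>_. 0) \<in> iso (G\<lparr>carrier := {\<one>}\<rparr>) (free_Abelian_group {..<0::nat})"
        by (auto simp: iso_def hom_def bij_betw_def free_Abelian_group_def)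
      then show "G\<lparr>carrier := {\<one>}\<rparr> \<cong> free_Abelian_group {..<0::nat}" by (auto simp: is_iso_def)
    qed
  next
    case False
    then obtain x where x: "x \<in> carrier G" "L x \<noteq> 0" by blast
    obtain x0 where x0: "x0 \<in> carrier G" "0 < L x0"
      using x Linv[OF x(1)] by (cases "0 < L x") (force intro: that[of "inv x"])+
    define S where "S = {L x | x. x \<in> carrier G \<and> 0 < L x \<and> L x \<le> L x0}"
    have fS: "finite S" "S \<noteq> {}" using fin x0 by (auto simp: S_def)
    obtain a where a: "a \<in> carrier G" "0 < L a" "L a = Min S" "L a \<le> L x0"
      using Min_in[OF fS] by (auto simp: S_def)
    have amin: "L a \<le> L y" if "y \<in> carrier G" "0 < L y" for y
    proof (cases "L y \<le> L x0")
      case True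
      then have "L y \<in> S" using that by (auto simp: S_def)
      then show ?thesis using a(3) fS by simp
    qed (use a(4) in simp)
    have Lpow: "L (a [^] k) = of_int k * L a" for k :: int
    proof -
      have n: "L (a [^] n) = real n * L a" for n :: nat
        by (induction n) (use a(1) in \<open>auto simp: L L1 algebra_simps\<close>)
      show ?thesis
        by (cases k rule: int_cases2) (use a(1) in \<open>auto simp: int_pow_int int_pow_neg n Linv\<close>)
    qed
    define A where "A = range (\<lambda>k::int. a [^] k)"
    have Asub: "A \<subseteq> carrier G" using a(1) by (auto simp: A_def)
    have Agroup: "subgroup A G"
    proof (rule subgroupI[OF Asub])
      show "A \<noteq> {}" by (auto simp: A_def)
      show "inv b \<in> A" if "b \<in> A" for b
        using that a(1) by (auto simp: A_def int_pow_neg[symmetric])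
      show "b \<otimes> c \<in> A" if "b \<in> A" "c \<in> A" for b c
        using that a(1) by (auto simp: A_def int_pow_mult[symmetric])
    qed
    have inj: "k = l" if "a [^] k = a [^] l" for k l :: int
    proof -
      have "of_int k * L a = of_int l * L a" using Lpow that by metis
      then show ?thesis using a(2) by simp
    qed
    show ?thesis
    proof (rule that)
      show "(1::nat) \<le> 1" by simp
      show "T \<inter> A = {\<one>}"
        using a(2) L1 by (auto simp: T A_def Lpow intro!: image_eqI[where x = "0::int"])
      show "T <#> A = carrier G"
      proof
        show "T <#> A \<subseteq> carrier G" using Asub by (auto simp: set_mult_def T)
        show "carrier G \<subseteq> T <#> A"
        proof
          fix y assume y: "y \<in> carrier G"
          \<comment> \<open>The quotient of the division; the remainder \<open>L z\<close> is
            nonnegative and below the least positive value, hence zero.\<close>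
          define k where "k = \<lfloor>L y / L a\<rfloor>"
          define z where "z = y \<otimes> inv (a [^] k)"
          have z: "z \<in> carrier G" using y a(1) by (simp add: z_def)
          have Lz: "L z = L y - of_int k * L a" using y a(1) by (simp add: z_def L Linv Lpow)
          have "of_int k \<le> L y / L a" "L y / L a < of_int k + 1" unfolding k_def by linarith+
          then have "0 \<le> L z" "L z < L a" using a(2) by (simp_all add: Lz field_simps)
          then have "L z = 0" using amin[OF z] by linarith
          then have "z \<in> T" using z by (simp add: T)
          moreover have "y = z \<otimes> a [^] k" using y a(1) by (simp add: z_def m_assoc)
          ultimately show "y \<in> T <#> A" by (auto simp: set_mult_def A_def)
        qed
      qed
      \<comment> \<open>The free Abelian group on \<open>{..<1}\<close> consists of the multiples of
        its generator \<open>frag_of 0\<close>; the coefficient at 0 becomes the exponent of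
        \<open>a\<close>.\<close>
      define h where "h c = a [^] Poly_Mapping.lookup c (0::nat)" for c :: "nat \<Rightarrow>\<^sub>0 int"
      have key: "c = frag_cmul (Poly_Mapping.lookup c 0) (frag_of 0)"
        if "Poly_Mapping.keys c \<subseteq> {..<1}" for c :: "nat \<Rightarrow>\<^sub>0 int"
      proof (rule poly_mapping_eqI)
        fix i show "Poly_Mapping.lookup c i = Poly_Mapping.lookup (frag_cmul (Poly_Mapping.lookup c 0) (frag_of 0)) i"
          using that by (cases "i = 0") (auto simp: in_keys_iff subset_iff lookup_one)
      qed
      have "h \<in> iso (free_Abelian_group {..<1}) (G\<lparr>carrier := A\<rparr>)"
        unfolding iso_def
      proof (intro CollectI conjI homI bij_betw_imageI)
        show "h (c \<otimes>\<^bsub>free_Abelian_group {..<1}\<^esub> d) = h c \<otimes>\<^bsub>G\<lparr>carrier := A\<rparr>\<^esub> h d" for c d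
          using a(1) by (simp add: h_def int_pow_mult lookup_add)
        show "inj_on h (carrier (free_Abelian_group {..<1}))"
        proof (rule inj_onI)
          fix c d assume "c \<in> carrier (free_Abelian_group {..<1::nat})" "d \<in> carrier (free_Abelian_group {..<1::nat})" "h c = h d"
          then show "c = d" using key[of c] key[of d] inj by (simp add: h_def) metis
        qed
        have hk: "h (frag_cmul k (frag_of 0)) = a [^] k" for k by (simp add: h_def)
        have ck: "frag_cmul k (frag_of 0) \<in> carrier (free_Abelian_group {..<1::nat})" for k
          by (auto dest: subsetD[OF keys_cmul])
        show "h ` carrier (free_Abelian_group {..<1}) = carrier (G\<lparr>carrier := A\<rparr>)"
        proof (intro equalityI image_subsetI subsetI)
          fix y assume "y \<in> carrier (G\<lparr>carrier := A\<rparr>)"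
          then obtain k where "y = h (frag_cmul k (frag_of 0))" unfolding hk by (auto simp: A_def)
          then show "y \<in> h ` carrier (free_Abelian_group {..<1})" using ck by blast
        qed (simp add: h_def A_def)
      qed (auto simp: h_def A_def)
      then have "inv_into (carrier (free_Abelian_group {..<1})) h \<in> iso (G\<lparr>carrier := A\<rparr>) (free_Abelian_group {..<1})"
        by (rule group.iso_set_sym[OF group_free_Abelian_group])
      then show "G\<lparr>carrier := A\<rparr> \<cong> free_Abelian_group {..<1::nat}" by (auto simp: is_iso_def)
    qed (rule Agroup)
  qed
qed

context fin_group
begin

section \<open>Translation between the integral group ring and convolution\<close>

definition ic :: "('a \<Rightarrow> int) \<Rightarrow> 'a \<Rightarrow> complex" where
  "ic f = (\<lambda>x. if x \<in> carrier G then of_int (f x) else 0)"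

lemma ic_galg [simp]: "ic f \<in> galg"
  by (simp add: ic_def galg_def)

lemma group_ring_simps:
  "carrier (group_ring R G) = carrier G \<rightarrow>\<^sub>E carrier R"
  "f \<otimes>\<^bsub>group_ring R G\<^esub> h = (\<lambda>x\<in>carrier G. \<Oplus>\<^bsub>R\<^esub>y\<in>carrier G. f y \<otimes>\<^bsub>R\<^esub> h (inv y \<otimes> x))"
  "\<one>\<^bsub>group_ring R G\<^esub> = (\<lambda>x\<in>carrier G. if x = \<one> then \<one>\<^bsub>R\<^esub> else \<zero>\<^bsub>R\<^esub>)"
  "\<zero>\<^bsub>group_ring R G\<^esub> = (\<lambda>x\<in>carrier G. \<zero>\<^bsub>R\<^esub>)"
  "f \<oplus>\<^bsub>group_ring R G\<^esub> h = (\<lambda>x\<in>carrier G. f x \<oplus>\<^bsub>R\<^esub> h x)"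
  by (simp_all add: group_ring_def)

lemma ic_mult: "ic (f \<otimes>\<^bsub>group_ring \<Z> G\<^esub> h) = ic f \<star> ic h"
  by (auto simp: ic_def conv_def group_ring_simps int_finsum_eq fun_eq_iff intro!: sum.cong)

lemma ic_one: "ic \<one>\<^bsub>group_ring \<Z> G\<^esub> = e1"
  by (auto simp: ic_def group_ring_simps delta_def fun_eq_iff)

lemma ic_inj: "f \<in> carrier (group_ring \<Z> G) \<Longrightarrow> h \<in> carrier (group_ring \<Z> G) \<Longrightarrow> ic f = ic h \<longleftrightarrow> f = h"
proof
  assume fh: "f \<in> carrier (group_ring \<Z> G)" "h \<in> carrier (group_ring \<Z> G)" and eq: "ic f = ic h"
  show "f = h"
  proof (rule PiE_ext[OF fh[unfolded group_ring_simps]])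
    fix x assume "x \<in> carrier G"
    then show "f x = h x" using fun_cong[OF eq, of x] by (simp add: ic_def)
  qed
qed simp

lemma ic_eqD: "f \<in> carrier (group_ring \<Z> G) \<Longrightarrow> h \<in> carrier (group_ring \<Z> G) \<Longrightarrow> ic f = ic h \<Longrightarrow> f = h"
  using ic_inj by blast

lemma ZG_mult_closed:
  "f \<otimes>\<^bsub>group_ring \<Z> G\<^esub> h \<in> carrier (group_ring \<Z> G)" "\<one>\<^bsub>group_ring \<Z> G\<^esub> \<in> carrier (group_ring \<Z> G)"
  unfolding group_ring_simps by auto

lemma group_ring_elt_carrier: "group_ring_elt \<Z> G g \<in> carrier (group_ring \<Z> G)"
  unfolding group_ring_simps by (auto simp: group_ring_elt_def)

lemma ic_elt: "g \<in> carrier G \<Longrightarrow> ic (group_ring_elt \<Z> G g) = delta g"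
  by (auto simp: ic_def group_ring_elt_def delta_def fun_eq_iff)

text \<open>The inverse of \<open>ic\<close> on integral functions. The floor only changes the type
  of a coefficient that is already an integer.\<close>

definition unfloor :: "('a \<Rightarrow> complex) \<Rightarrow> 'a \<Rightarrow> int" where
  "unfloor v = (\<lambda>x\<in>carrier G. \<lfloor>Re (v x)\<rfloor>)"

lemma unfloor_carrier: "unfloor v \<in> carrier (group_ring \<Z> G)"
  unfolding group_ring_simps by (auto simp: unfloor_def)

lemma ic_unfloor: "v \<in> oz \<Longrightarrow> ic (unfloor v) = v"
proof (rule galg_eqI)
  fix x assume "v \<in> oz" "x \<in> carrier G"
  moreover from this obtain n where "v x = of_int n" by (auto simp: oz_def Ints_def)
  ultimately show "ic (unfloor v) x = v x" by (simp add: ic_def unfloor_def)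
qed (auto simp: oz_zalg zalg_galg)

definition OU :: "('a \<Rightarrow> complex) set" where
  "OU = {u \<in> oz. \<exists>v\<in>oz. u \<star> v = e1}"

lemma ZG_Units: "Units (group_ring \<Z> G) =
  {f \<in> carrier (group_ring \<Z> G). \<exists>h\<in>carrier (group_ring \<Z> G). ic f \<star> ic h = e1 \<and> ic h \<star> ic f = e1}"
  unfolding Units_def using ic_inj[OF ZG_mult_closed]
  by (auto simp: ic_mult[symmetric] ic_one[symmetric])

text \<open>A priori \<open>central_units\<close> tests commutation with units only. Since the group
  elements are units and span the algebra, its members are class functions, and so are their
  inverses.\<close>

lemma central_units_simps:
  "carrier (central_units G) = {f \<in> carrier (group_ring \<Z> G). ic f \<in> OU}"
  "f \<otimes>\<^bsub>central_units G\<^esub> h = f \<otimes>\<^bsub>group_ring \<Z> G\<^esub> h" "\<one>\<^bsub>central_units G\<^esub> = \<one>\<^bsub>group_ring \<Z> G\<^esub>"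
proof -
  show "carrier (central_units G) = {f \<in> carrier (group_ring \<Z> G). ic f \<in> OU}"
  proof (intro equalityI subsetI)
    fix f assume "f \<in> carrier (central_units G)"
    then have f: "f \<in> Units (group_ring \<Z> G)"
      "\<And>x. x \<in> Units (group_ring \<Z> G) \<Longrightarrow> f \<otimes>\<^bsub>group_ring \<Z> G\<^esub> x = x \<otimes>\<^bsub>group_ring \<Z> G\<^esub> f"
      by (auto simp: central_units_def centre_def units_of_def)
    obtain h where h: "h \<in> carrier (group_ring \<Z> G)" "ic f \<star> ic h = e1" "ic h \<star> ic f = e1"
      using f(1) unfolding ZG_Units by blast
    have fz: "ic f \<in> zalg"
    proof (rule zalgI_delta)
      fix g assume g: "g \<in> carrier G"
      have "group_ring_elt \<Z> G g \<in> Units (group_ring \<Z> G)"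
        unfolding ZG_Units using g group_ring_elt_carrier
        by (auto intro!: bexI[of _ "group_ring_elt \<Z> G (inv g)"] simp: ic_elt delta_conv_delta)
      then show "ic f \<star> delta g = delta g \<star> ic f" using f(2) ic_elt[OF g] ic_mult by metis
    qed simp
    \<comment> \<open>The inverse of a central element is central; this places the inverse in
      \<open>oz\<close>, as \<open>OU\<close> demands.\<close>
    have hz: "ic h \<in> zalg"
    proof (rule zalgI)
      fix k :: "'a \<Rightarrow> complex" assume k: "k \<in> galg"
      have "ic h \<star> k = ic h \<star> k \<star> (ic f \<star> ic h)" using h by simp
      also have "\<dots> = ic h \<star> (k \<star> ic f) \<star> ic h" by (simp add: conv_assoc)
      also have "k \<star> ic f = ic f \<star> k" by (rule zalg_commute[OF fz, symmetric])
      also have "ic h \<star> (ic f \<star> k) \<star> ic h = (ic h \<star> ic f) \<star> k \<star> ic h" by (simp only: conv_assoc)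
      finally show "ic h \<star> k = k \<star> ic h" using h(3) k by simp
    qed simp
    have "ic k \<in> oz" if "ic k \<in> zalg" for k using that by (simp add: oz_def) (simp add: ic_def)
    then show "f \<in> {f \<in> carrier (group_ring \<Z> G). ic f \<in> OU}"
      using f(1) fz hz h(2) by (auto simp: OU_def Units_def)
  next
    fix f assume "f \<in> {f \<in> carrier (group_ring \<Z> G). ic f \<in> OU}"
    then obtain v where f: "f \<in> carrier (group_ring \<Z> G)" "ic f \<in> oz" "v \<in> oz" "ic f \<star> v = e1"
      by (auto simp: OU_def)
    have "f \<in> Units (group_ring \<Z> G)"
      unfolding ZG_Units using f unfloor_carrier ic_unfloor[OF f(3)] zalg_commute[OF oz_zalg[OF f(3)], of "ic f"]
      by (auto intro!: bexI[of _ "unfloor v"])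
    moreover have "f \<otimes>\<^bsub>group_ring \<Z> G\<^esub> x = x \<otimes>\<^bsub>group_ring \<Z> G\<^esub> f" for x
      using ic_inj[OF ZG_mult_closed(1)[of f x] ZG_mult_closed(1)[of x f]] zalg_commute[OF oz_zalg[OF f(2)]]
      by (simp add: ic_mult)
    ultimately show "f \<in> carrier (central_units G)" by (simp add: central_units_def centre_def units_of_def)
  qed
qed (simp_all add: central_units_def centre_def units_of_def)

lemma OU_mult: "u \<in> OU \<Longrightarrow> w \<in> OU \<Longrightarrow> u \<star> w \<in> OU"
proof -
  assume "u \<in> OU" "w \<in> OU"
  then obtain u' w' where *: "u \<in> oz" "w \<in> oz" "u' \<in> oz" "u \<star> u' = e1" "w' \<in> oz" "w \<star> w' = e1"
    by (auto simp: OU_def)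
  have "u \<star> w \<star> (w' \<star> u') = u \<star> (w \<star> w') \<star> u'" by (simp add: conv_assoc)
  then have "u \<star> w \<star> (w' \<star> u') = e1" using * by (simp add: oz_zalg zalg_galg)
  then show ?thesis using * by (auto simp: OU_def intro!: bexI[of _ "w' \<star> u'"])
qed

lemma group_central_units: "group (central_units G)"
proof (rule groupI)
  show "x \<otimes>\<^bsub>central_units G\<^esub> y \<in> carrier (central_units G)"
    if "x \<in> carrier (central_units G)" "y \<in> carrier (central_units G)" for x y
    using that by (simp add: central_units_simps ZG_mult_closed ic_mult OU_mult)
  show "\<one>\<^bsub>central_units G\<^esub> \<in> carrier (central_units G)"
    by (auto simp: central_units_simps ZG_mult_closed ic_one OU_def intro!: bexI[of _ e1])
  show "x \<otimes>\<^bsub>central_units G\<^esub> y \<otimes>\<^bsub>central_units G\<^esub> z = x \<otimes>\<^bsub>central_units G\<^esub> (y \<otimes>\<^bsub>central_units G\<^esub> z)" for x y z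
    unfolding central_units_simps by (rule ic_eqD) (simp_all add: ZG_mult_closed ic_mult conv_assoc)
  show "\<one>\<^bsub>central_units G\<^esub> \<otimes>\<^bsub>central_units G\<^esub> x = x" if "x \<in> carrier (central_units G)" for x
    using that unfolding central_units_simps by (intro ic_eqD) (simp_all add: ZG_mult_closed ic_mult ic_one)
  show "\<exists>y\<in>carrier (central_units G). y \<otimes>\<^bsub>central_units G\<^esub> x = \<one>\<^bsub>central_units G\<^esub>"
    if x: "x \<in> carrier (central_units G)" for x
  proof -
    obtain v where v: "ic x \<in> oz" "v \<in> oz" "ic x \<star> v = e1" using x by (auto simp: central_units_simps OU_def)
    have vx: "v \<star> ic x = e1" using v zalg_commute[OF oz_zalg[OF v(1)]] by simp
    have "unfloor v \<otimes>\<^bsub>central_units G\<^esub> x = \<one>\<^bsub>central_units G\<^esub>"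
      unfolding central_units_simps
      by (rule ic_eqD) (simp_all add: ZG_mult_closed ic_mult ic_one ic_unfloor[OF v(2)] vx)
    moreover have "unfloor v \<in> carrier (central_units G)"
      using v(1,2) vx by (auto simp: central_units_simps unfloor_carrier ic_unfloor OU_def)
    ultimately show ?thesis by blast
  qed
qed

text \<open>A central unit all of whose conjugates lie on the unit circle satisfies \<open>u u\<^sup>* = 1\<close>; comparing
  coefficients at \<open>1\<close> shows that it is trivial.\<close>

lemma unit_circle_trivial:
  assumes u: "u \<in> oz" "\<And>e. e \<in> PCI \<Longrightarrow> cmod (lam e u) = 1"
  obtains g where "g \<in> carrier (centre G)" "u = delta g \<or> u = - delta g"
proof -
  have uz: "u \<in> zalg" using u(1) by (rule oz_zalg)
  have "u \<star> C.star u = e1"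
  proof (rule lam_ext)
    fix e :: "'a \<Rightarrow> complex" assume e: "e \<in> PCI"
    have "lam e u * cnj (lam e u) = of_real ((cmod (lam e u))\<^sup>2)" by (simp only: complex_norm_square)
    then show "lam e (u \<star> C.star u) = lam e e1"
      using e uz u(2)[OF e] by (simp add: lam_mult star_zalg lam_star)
  qed (use uz star_zalg in auto)
  \<comment> \<open>The coefficient at 1 is a sum of squares of integers. Being 1, it leaves exactly
    one nonzero coefficient, equal to 1 or -1.\<close>
  then have "C.ip u u = 1" by (simp add: C.ip_def delta_def)
  then have s: "(\<Sum>x\<in>carrier G. u x * cnj (u x)) = 1" by (simp add: C.ip_explicit)
  have "\<forall>x. \<exists>n. u x = of_int n" using u(1) by (auto simp: oz_def Ints_def)
  then obtain n where n: "\<And>x. u x = of_int (n x)" by metis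
  have "of_int (\<Sum>x\<in>carrier G. (n x)\<^sup>2) = (1 :: complex)" using s by (simp add: n power2_eq_square)
  then have s2: "(\<Sum>x\<in>carrier G. (n x)\<^sup>2) = 1" by (metis of_int_eq_1_iff)
  then obtain g where g: "g \<in> carrier G" "n g \<noteq> 0" by (metis sum.neutral zero_eq_power2 zero_neq_one)
  have "(\<Sum>x\<in>carrier G. (n x)\<^sup>2) = (n g)\<^sup>2 + (\<Sum>x\<in>carrier G - {g}. (n x)\<^sup>2)"
    using g(1) by (simp add: sum.remove)
  moreover have "(n g)\<^sup>2 \<ge> 1" using g(2) by (metis int_one_le_iff_zero_less zero_less_power2)
  moreover have "(\<Sum>x\<in>carrier G - {g}. (n x)\<^sup>2) \<ge> 0" by (simp add: sum_nonneg)
  ultimately have "(n g)\<^sup>2 = 1" "(\<Sum>x\<in>carrier G - {g}. (n x)\<^sup>2) = 0" using s2 by linarith+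
  then have ng: "n g = 1 \<or> n g = -1" and no: "\<And>x. x \<in> carrier G \<Longrightarrow> x \<noteq> g \<Longrightarrow> n x = 0"
    by (auto simp: power2_eq_1_iff sum_nonneg_eq_0_iff)
  have ux: "u x = of_int (n g) * delta g x" for x
    using no[of x] g(1) n uz by (cases "x \<in> carrier G") (auto simp: delta_def zalg_def galg_def)
  \<comment> \<open>The class function \<open>u\<close> is supported at \<open>g\<close> alone, so
    \<open>g\<close> is its only conjugate.\<close>
  have "g \<otimes> y = y \<otimes> g" if y: "y \<in> carrier G" for y
  proof -
    have "u (y \<otimes> (g \<otimes> inv y)) = u (g \<otimes> inv y \<otimes> y)" using uz g(1) y by (intro zalg_swap) auto
    also have "g \<otimes> inv y \<otimes> y = g" using g(1) y by (simp add: m_assoc)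
    finally have "u (y \<otimes> (g \<otimes> inv y)) \<noteq> 0" using g(2) n by simp
    then have "y \<otimes> (g \<otimes> inv y) = g" using ux by (auto simp: delta_def split: if_splits)
    then have "y \<otimes> (g \<otimes> inv y) \<otimes> y = g \<otimes> y" by simp
    then show ?thesis using g(1) y by (simp add: m_assoc)
  qed
  then have "g \<in> carrier (centre G)" using g(1) by (simp add: centre_def)
  moreover have "u = delta g \<or> u = - delta g" using ng ux by (auto simp: fun_eq_iff)
  ultimately show ?thesis by (rule that)
qed

lemma ic_minus:
  assumes f: "f \<in> carrier (group_ring \<Z> G)"
  shows "\<ominus>\<^bsub>group_ring \<Z> G\<^esub> f = (\<lambda>x\<in>carrier G. - f x)"
  unfolding a_inv_def m_inv_def
proof (rule the_equality)
  show "(\<lambda>x\<in>carrier G. - f x) \<in> carrier (add_monoid (group_ring \<Z> G)) \<and>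
    f \<otimes>\<^bsub>add_monoid (group_ring \<Z> G)\<^esub> (\<lambda>x\<in>carrier G. - f x) = \<one>\<^bsub>add_monoid (group_ring \<Z> G)\<^esub> \<and>
    (\<lambda>x\<in>carrier G. - f x) \<otimes>\<^bsub>add_monoid (group_ring \<Z> G)\<^esub> f = \<one>\<^bsub>add_monoid (group_ring \<Z> G)\<^esub>"
    by (simp add: group_ring_simps cong: restrict_cong)
  fix h assume "h \<in> carrier (add_monoid (group_ring \<Z> G)) \<and>
    f \<otimes>\<^bsub>add_monoid (group_ring \<Z> G)\<^esub> h = \<one>\<^bsub>add_monoid (group_ring \<Z> G)\<^esub> \<and>
    h \<otimes>\<^bsub>add_monoid (group_ring \<Z> G)\<^esub> f = \<one>\<^bsub>add_monoid (group_ring \<Z> G)\<^esub>"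
  then have h: "h \<in> carrier G \<rightarrow>\<^sub>E UNIV" "(\<lambda>x\<in>carrier G. f x + h x) = (\<lambda>x\<in>carrier G. 0)"
    by (simp_all add: group_ring_simps)
  show "h = (\<lambda>x\<in>carrier G. - f x)"
  proof (rule PiE_ext[OF h(1)])
    show "(\<lambda>x\<in>carrier G. - f x) \<in> carrier G \<rightarrow>\<^sub>E UNIV" by simp
    fix x assume "x \<in> carrier G"
    then show "h x = (\<lambda>x\<in>carrier G. - f x) x" using fun_cong[OF h(2), of x] by simp
  qed
qed

lemma ic_neg: "f \<in> carrier (group_ring \<Z> G) \<Longrightarrow> ic (\<ominus>\<^bsub>group_ring \<Z> G\<^esub> f) = - ic f"
  by (simp add: ic_minus) (simp add: ic_def fun_eq_iff)

text \<open>The trivial units are the kernel of the logarithms. One inclusion is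
  \<open>unit_circle_trivial\<close>; for the other one, \<open>star\<close> sends
  \<open>delta g\<close> to its inverse, whence \<open>lam e (delta g)\<close> times its conjugate
  is 1.\<close>

lemma trivial_central_units_iff:
  "trivial_central_units G = {f \<in> carrier (central_units G). \<forall>e\<in>PCI. cmod (lam e (ic f)) = 1}"
proof (intro equalityI subsetI)
  fix f assume "f \<in> trivial_central_units G"
  then obtain g where g: "g \<in> carrier (centre G)"
    and f: "f = group_ring_elt \<Z> G g \<or> f = \<ominus>\<^bsub>group_ring \<Z> G\<^esub> group_ring_elt \<Z> G g"
    by (auto simp: trivial_central_units_def)
  have gG: "g \<in> carrier G" and gc: "\<And>y. y \<in> carrier G \<Longrightarrow> g \<otimes> y = y \<otimes> g"
    using g by (auto simp: centre_def)
  have icg: "ic f = delta g \<or> ic f = - delta g"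
    using f ic_elt[OF gG] ic_neg[OF group_ring_elt_carrier] by auto
  have fc: "f \<in> carrier (group_ring \<Z> G)"
    using f group_ring_elt_carrier ic_minus[OF group_ring_elt_carrier] by (auto simp: group_ring_simps)
  have dz: "delta h \<in> oz" if h: "h \<in> carrier G" "\<And>y. y \<in> carrier G \<Longrightarrow> h \<otimes> y = y \<otimes> h" for h
  proof -
    have "delta h \<in> (zalg :: ('a \<Rightarrow> complex) set)"
      by (rule zalgI_delta) (use h in \<open>auto simp: delta_conv_delta\<close>)
    then show ?thesis by (simp add: oz_def) (simp add: delta_def)
  qed
  have ginv: "inv g \<otimes> y = y \<otimes> inv g" if "y \<in> carrier G" for y
    using gc[of "inv y"] gG that by (metis inv_closed inv_inv inv_mult_group)
  have d: "delta g \<in> oz" "delta (inv g) \<in> oz" using gG gc ginv by (auto intro!: dz)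
  have prod: "(delta g :: 'a \<Rightarrow> complex) \<star> delta (inv g) = e1" using gG by (simp add: delta_conv_delta)
  have "ic f \<in> OU"
  proof -
    have "- delta g \<in> oz" "- delta (inv g) \<in> oz" using oz_closed(2)[OF oz_closed(6)] d by force+
    moreover have "(- delta g :: 'a \<Rightarrow> complex) \<star> (- delta (inv g)) = e1"
      using prod by (simp add: conv_minus_left conv_minus_right)
    ultimately show ?thesis using icg d prod by (auto simp: OU_def)
  qed
  moreover have "cmod (lam e (ic f)) = 1" if e: "e \<in> PCI" for e
  proof -
    have st: "C.star (delta g) = delta (inv g)"
      using gG by (auto simp: C.star_def delta_def fun_eq_iff)
    have "lam e (delta g) * cnj (lam e (delta g)) = 1"
      using lam_mult[OF e oz_zalg[OF d(1)] oz_zalg[OF d(2)]] prod lam_star[OF e oz_zalg[OF d(1)]] e by (simp add: st)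
    then have "complex_of_real ((cmod (lam e (delta g)))\<^sup>2) = 1" by (simp only: complex_norm_square)
    then have "(cmod (lam e (delta g)))\<^sup>2 = 1" by (metis of_real_eq_1_iff)
    then have 1: "cmod (lam e (delta g)) = 1" 
      unfolding power2_eq_1_iff using norm_ge_zero[of "lam e (delta g)"] by linarith
    have "lam e (- delta g) = - lam e (delta g)"
      using lam_diff[OF e zalg_closed(1) oz_zalg[OF d(1)]] e by simp
    then show ?thesis using icg 1 by auto
  qed
  ultimately show "f \<in> {f \<in> carrier (central_units G). \<forall>e\<in>PCI. cmod (lam e (ic f)) = 1}"
    using fc by (simp add: central_units_simps)
next
  fix f assume "f \<in> {f \<in> carrier (central_units G). \<forall>e\<in>PCI. cmod (lam e (ic f)) = 1}"
  then have f: "f \<in> carrier (group_ring \<Z> G)" "ic f \<in> oz" "\<And>e. e \<in> PCI \<Longrightarrow> cmod (lam e (ic f)) = 1"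
    by (auto simp: central_units_simps OU_def)
  obtain g where g: "g \<in> carrier (centre G)" "ic f = delta g \<or> ic f = - delta g"
    using unit_circle_trivial[OF f(2,3)] by blast
  have gG: "g \<in> carrier G" using g(1) by (simp add: centre_def)
  have "ic f = ic (group_ring_elt \<Z> G g) \<or> ic f = ic (\<ominus>\<^bsub>group_ring \<Z> G\<^esub> group_ring_elt \<Z> G g)"
    using g(2) ic_elt[OF gG] ic_neg[OF group_ring_elt_carrier] by auto
  moreover have "\<ominus>\<^bsub>group_ring \<Z> G\<^esub> group_ring_elt \<Z> G g \<in> carrier (group_ring \<Z> G)"
    using ic_minus[OF group_ring_elt_carrier] by (auto simp: group_ring_simps)
  ultimately have "f = group_ring_elt \<Z> G g \<or> f = \<ominus>\<^bsub>group_ring \<Z> G\<^esub> group_ring_elt \<Z> G g"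
    using ic_inj[OF f(1)] group_ring_elt_carrier by blast
  then show "f \<in> trivial_central_units G" using g(1) by (auto simp: trivial_central_units_def)
qed

text \<open>The infimum is attained when some complement exists; otherwise it is infinite, so
  \<open>rho G \<le> 1\<close> cannot hold vacuously.\<close>

lemma ecut_iff: "ecut G \<longleftrightarrow> (\<exists>A r. r \<le> 1 \<and> free_complement G A r)"
proof
  assume "ecut G"
  then have le: "rho G \<le> 1" by (simp add: ecut_def)
  have ne: "{enat r | r. \<exists>A. free_complement G A r} \<noteq> {}"
  proof
    assume "{enat r | r. \<exists>A. free_complement G A r} = {}"
    then have "rho G = \<infinity>" by (simp add: rho_def top_enat_def)
    then show False using le by simp
  qed
  then obtain z where z: "z \<in> {enat r | r. \<exists>A. free_complement G A r}" by (meson ex_in_conv)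
  have "rho G \<in> {enat r | r. \<exists>A. free_complement G A r}"
    unfolding rho_def by (rule wellorder_InfI[OF z])
  then obtain r A where "rho G = enat r" "free_complement G A r" by blast
  then show "\<exists>A r. r \<le> 1 \<and> free_complement G A r" using le by (auto simp: one_enat_def)
next
  assume "\<exists>A r. r \<le> 1 \<and> free_complement G A r"
  then obtain A r where r: "r \<le> 1" "free_complement G A r" by blast
  then have "rho G \<le> enat r" unfolding rho_def by (intro Inf_lower) auto
  also have "\<dots> \<le> 1" using r(1) by (simp add: one_enat_def)
  finally show "ecut G" by (simp add: ecut_def)
qed

section \<open>Logarithms of central units and the number of places\<close>

lemma lam_OU_nonzero: "u \<in> OU \<Longrightarrow> e \<in> PCI \<Longrightarrow> lam e u \<noteq> 0"
proof
  assume u: "u \<in> OU" and e: "e \<in> PCI" and 0: "lam e u = 0"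
  obtain v where v: "u \<in> oz" "v \<in> oz" "u \<star> v = e1" using u by (auto simp: OU_def)
  show False using lam_mult[OF e oz_zalg[OF v(1)] oz_zalg[OF v(2)]] v(3) 0 e by simp
qed

definition loglam :: "('a \<Rightarrow> complex) \<Rightarrow> ('a \<Rightarrow> complex) \<Rightarrow> real" where
  "loglam e u = ln (cmod (lam e u))"

lemma loglam_mult: "u \<in> OU \<Longrightarrow> w \<in> OU \<Longrightarrow> e \<in> PCI \<Longrightarrow> loglam e (u \<star> w) = loglam e u + loglam e w"
  using lam_OU_nonzero[of u e] lam_OU_nonzero[of w e] oz_zalg
  by (auto simp: loglam_def OU_def lam_mult norm_mult ln_mult)

text \<open>The trivial units have zero logarithms and the complement is generated by at most one
  element; \<open>la\<close> is the logarithm vector of this generator.\<close>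

lemma ecut_logs:
  assumes "ecut G"
  obtains la where "\<And>u. u \<in> OU \<Longrightarrow> \<exists>k::int. \<forall>e\<in>PCI. loglam e u = of_int k * la e"
proof -
  interpret U: group "central_units G" by (rule group_central_units)
  obtain A r where r: "r \<le> 1" and c: "free_complement G A r" using assms ecut_iff by blast
  have A: "subgroup A (central_units G)" and TA: "trivial_central_units G <#>\<^bsub>central_units G\<^esub> A = carrier (central_units G)"
    and iso: "(central_units G)\<lparr>carrier := A\<rparr> \<cong> free_Abelian_group {..<r}"
    using c by (auto simp: free_complement_def)
  obtain \<phi> where \<phi>: "\<phi> \<in> iso ((central_units G)\<lparr>carrier := A\<rparr>) (free_Abelian_group {..<r})"
    using iso by (auto simp: is_iso_def)
  define \<psi> where "\<psi> = inv_into A \<phi>"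
  have "\<psi> \<in> iso (free_Abelian_group {..<r}) ((central_units G)\<lparr>carrier := A\<rparr>)"
    unfolding \<psi>_def using group.iso_set_sym[OF subgroup.subgroup_is_group[OF A group_central_units] \<phi>] by simp
  then have \<psi>m: "\<psi> (x + y) = \<psi> x \<otimes>\<^bsub>central_units G\<^esub> \<psi> y" and \<psi>c: "\<psi> x \<in> A"
    if "Poly_Mapping.keys x \<subseteq> {..<r}" "Poly_Mapping.keys y \<subseteq> {..<r}" for x y
    using that by (auto simp: iso_def hom_def)
  have Ac: "A \<subseteq> carrier (central_units G)" using A by (rule subgroup.subset)
  have \<psi>U: "ic (\<psi> x) \<in> OU" if "Poly_Mapping.keys x \<subseteq> {..<r}" for x
    using \<psi>c[OF that that] Ac by (auto simp: central_units_simps)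
  \<comment> \<open>In rank 0 the neutral element stands in for the missing generator, which gives
    the zero vector.\<close>
  define la where "la e = loglam e (ic (\<psi> (if r = 0 then 0 else frag_of 0)))" for e
  have *: "loglam e (ic (\<psi> (frag_cmul k x))) = of_int k * loglam e (ic (\<psi> x))"
    if x: "Poly_Mapping.keys x \<subseteq> {..<r}" and e: "e \<in> PCI" for x k e
  proof -
    define g where "g k = loglam e (ic (\<psi> (frag_cmul k x)))" for k
    have keys: "Poly_Mapping.keys (frag_cmul k x) \<subseteq> {..<r}" for k using x keys_cmul by (metis order_trans)
    have add: "g (k + l) = g k + g l" for k l
      unfolding g_def frag_cmul_distrib using \<psi>m[OF keys keys] \<psi>U[OF keys] e
      by (simp add: central_units_simps ic_mult loglam_mult)
    have g0: "g 0 = 0" using add[of 0 0] by simp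
    have n: "g (int n) = real n * g 1" for n
      by (induction n) (auto simp: g0 add algebra_simps)
    have "g k = of_int k * g 1"
      by (cases k rule: int_cases2) (use n add[of k "- k"] g0 in auto)
    then show ?thesis by (simp add: g_def)
  qed
  show ?thesis
  proof (rule that)
    fix u assume u: "u \<in> OU"
    then have uo: "u \<in> oz" by (simp add: OU_def)
    have "unfloor u \<in> carrier (central_units G)"
      using u uo by (simp add: central_units_simps unfloor_carrier ic_unfloor)
    then obtain t a where ta: "t \<in> trivial_central_units G" "a \<in> A" "unfloor u = t \<otimes>\<^bsub>central_units G\<^esub> a"
      unfolding TA[symmetric] by (auto simp: set_mult_def)
    have u_eq: "u = ic t \<star> ic a" using ta(3) ic_unfloor[OF uo] by (simp add: central_units_simps ic_mult)
    have t: "ic t \<in> OU" "\<And>e. e \<in> PCI \<Longrightarrow> cmod (lam e (ic t)) = 1"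
      using ta(1) unfolding trivial_central_units_iff by (auto simp: central_units_simps)
    have aU: "ic a \<in> OU" using ta(2) Ac by (auto simp: central_units_simps)
    define x where "x = \<phi> a"
    have "x \<in> carrier (free_Abelian_group {..<r})" 
      unfolding x_def using \<phi> ta(2) by (intro funcset_mem[of \<phi> A]) (simp_all add: iso_def hom_def)
    then have x: "Poly_Mapping.keys x \<subseteq> {..<r}" by (rule carrier_free_Abelian_group_iff[THEN iffD1])
    have ax: "a = \<psi> x"
      using \<phi> ta(2) by (auto simp: x_def \<psi>_def iso_def bij_betw_def)
    \<comment> \<open>The support of \<open>x\<close> lies in \<open>{..<r}\<close> with
      \<open>r \<le> 1\<close>, so only the coefficient at 0 can be nonzero.\<close>
    have xk: "x = frag_cmul (Poly_Mapping.lookup x 0) (if r = 0 then 0 else frag_of 0)"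
    proof (rule poly_mapping_eqI)
      fix i show "Poly_Mapping.lookup x i =
          Poly_Mapping.lookup (frag_cmul (Poly_Mapping.lookup x 0) (if r = 0 then 0 else frag_of 0)) i"
        using x r by (cases "i = 0") (auto simp: in_keys_iff subset_iff lookup_one)
    qed
    have "loglam e u = of_int (Poly_Mapping.lookup x 0) * la e" if e: "e \<in> PCI" for e
    proof -
      have "loglam e u = loglam e (ic a)" using loglam_mult[OF t(1) aU e] t(2)[OF e] by (simp add: u_eq loglam_def)
      also have "\<dots> = loglam e (ic (\<psi> (frag_cmul (Poly_Mapping.lookup x 0) (if r = 0 then 0 else frag_of 0))))"
        unfolding ax using xk by simp
      also have "\<dots> = of_int (Poly_Mapping.lookup x 0) * la e"
        unfolding la_def by (rule *[OF _ e]) (use r in auto)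
      finally show ?thesis .
    qed
    then show "\<exists>k::int. \<forall>e\<in>PCI. loglam e u = of_int k * la e" by blast
  qed
qed

text \<open>The archimedean places of \<open>K \<epsilon>\<close> are the sets
  \<open>{v, bar v}\<close> with \<open>v\<close> in \<open>J \<epsilon>\<close>.\<close>

definition one_place :: "('a \<Rightarrow> complex) \<Rightarrow> bool" where
  "one_place \<epsilon> \<longleftrightarrow> (\<forall>v\<in>J \<epsilon>. J \<epsilon> \<subseteq> {v, bar v})"

definition two_places :: "('a \<Rightarrow> complex) \<Rightarrow> bool" where
  "two_places \<epsilon> \<longleftrightarrow> (\<exists>v\<in>J \<epsilon>. \<exists>w\<in>J \<epsilon>. w \<notin> {v, bar v} \<and> J \<epsilon> = {v, bar v, w, bar w})"

lemma loglam_sum: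
  assumes "u \<in> OU" "\<epsilon> \<in> EQ"
  shows "(\<Sum>e\<in>J \<epsilon>. loglam e u) = 0"
proof -
  obtain u' where "u \<in> oz" "u' \<in> oz" "u \<star> u' = e1" using assms(1) by (auto simp: OU_def)
  then have "cmod (nrmJ \<epsilon> u) = 1" using nrmJ_unit assms(2) by blast
  moreover have "cmod (nrmJ \<epsilon> u) = (\<Prod>e\<in>J \<epsilon>. cmod (lam e u))" by (simp add: nrmJ_def prod_norm)
  moreover have "ln (\<Prod>e\<in>J \<epsilon>. cmod (lam e u)) = (\<Sum>e\<in>J \<epsilon>. loglam e u)"
    unfolding loglam_def by (rule ln_prod) (use lam_OU_nonzero[OF assms(1)] J_PCI in auto)
  ultimately show ?thesis by simp
qed

lemma loglam_bar: "u \<in> OU \<Longrightarrow> e \<in> PCI \<Longrightarrow> loglam (bar e) u = loglam e u"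
  by (simp add: loglam_def lam_bar_rz oz_rz OU_def)

text \<open>By \<open>unit_exists\<close> and \<open>loglam_sum\<close>, a place \<open>v\<close>
  that is not the only one of its component gives a unit whose logarithm is positive at
  \<open>v\<close>, negative at the other places of the component and zero elsewhere. All logarithm
  vectors being multiples of \<open>la\<close>, the vector \<open>la\<close> shows this pattern up
  to sign for each such \<open>v\<close>. This allows only one component of this kind, with only two
  places.\<close>

lemma ecut_imp_places:
  assumes "ecut G"
  shows "(\<forall>\<epsilon>\<in>EQ. one_place \<epsilon>) \<or> (\<exists>\<epsilon>\<in>EQ. two_places \<epsilon> \<and> (\<forall>\<delta>\<in>EQ - {\<epsilon>}. one_place \<delta>))"
proof -
  obtain la where la: "\<And>u. u \<in> OU \<Longrightarrow> \<exists>k::int. \<forall>e\<in>PCI. loglam e u = of_int k * la e"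
    using ecut_logs[OF assms] by blast
  have unit: "\<exists>k::int. k * la v > 0 \<and> (\<forall>w\<in>J \<epsilon> - {v, bar v}. k * la w < 0) \<and> (\<forall>e\<in>PCI - J \<epsilon>. la e = 0)"
    if \<epsilon>: "\<epsilon> \<in> EQ" and v: "v \<in> J \<epsilon>" and w: "w \<in> J \<epsilon> - {v, bar v}" for \<epsilon> v w
  proof -
    obtain u u' where u: "u \<in> oz" "u' \<in> oz" "u \<star> u' = e1" "\<And>e. e \<in> PCI \<Longrightarrow> e \<notin> J \<epsilon> \<Longrightarrow> lam e u = 1"
      "\<And>w. w \<in> J \<epsilon> - {v, bar v} \<Longrightarrow> cmod (lam w u) < 1"
      using unit_exists[OF \<epsilon> v refl] w by (metis empty_iff)
    have uU: "u \<in> OU" using u by (auto simp: OU_def)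
    obtain k :: int where k: "\<forall>e\<in>PCI. loglam e u = of_int k * la e" using la[OF uU] by blast
    have neg: "loglam w u < 0" if "w \<in> J \<epsilon> - {v, bar v}" for w
      unfolding loglam_def using u(5)[OF that] lam_OU_nonzero[OF uU, of w] that J_PCI by auto
    have kneg: "k * la w < 0" if "w \<in> J \<epsilon> - {v, bar v}" for w
      using neg[OF that] k that J_PCI by auto
    have "k \<noteq> 0" using kneg[OF w] by auto
    then have out: "la e = 0" if "e \<in> PCI - J \<epsilon>" for e
      using u(4)[of e] that k by (auto simp: loglam_def)
    \<comment> \<open>The total vanishes and the part off \<open>{v, bar v}\<close> is negative. The
      remaining part is \<open>loglam v u\<close>, counted once or twice, so it is positive.\<close>
    have "(\<Sum>e\<in>J \<epsilon>. loglam e u) = (\<Sum>e\<in>{v, bar v}. loglam e u) + (\<Sum>e\<in>J \<epsilon> - {v, bar v}. loglam e u)"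
      using v bar_J[OF \<epsilon> v] by (subst add.commute, intro sum.subset_diff) auto
    moreover have "(\<Sum>e\<in>J \<epsilon> - {v, bar v}. loglam e u) < 0"
      using sum_strict_mono[of "J \<epsilon> - {v, bar v}" "\<lambda>e. loglam e u" "\<lambda>_. 0"] neg w by auto
    ultimately have "(\<Sum>e\<in>{v, bar v}. loglam e u) > 0" using loglam_sum[OF uU \<epsilon>] by simp
    moreover have "(\<Sum>e\<in>{v, bar v}. loglam e u) = of_nat (card {v, bar v}) * loglam v u"
      using loglam_bar[OF uU J_PCI[OF v]] by (subst sum.cong[of _ _ _ "\<lambda>_. loglam v u"]) auto
    ultimately have "loglam v u > 0" by (simp add: zero_less_mult_iff)
    then have "k * la v > 0" using k J_PCI[OF v] by simp
    then show ?thesis using kneg out by blast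
  qed
  have multi: "\<exists>v\<in>J \<epsilon>. \<exists>w. w \<in> J \<epsilon> - {v, bar v}" if "\<not> one_place \<epsilon>" for \<epsilon>
    using that by (auto simp: one_place_def)
  have unique: "\<epsilon> = \<delta>" if ed: "\<epsilon> \<in> EQ" "\<delta> \<in> EQ" "\<not> one_place \<epsilon>" "\<not> one_place \<delta>" for \<epsilon> \<delta>
  proof (rule ccontr)
    assume "\<epsilon> \<noteq> \<delta>"
    obtain v w where v: "v \<in> J \<epsilon>" "w \<in> J \<epsilon> - {v, bar v}" using multi[OF ed(3)] by blast
    obtain v' w' where v': "v' \<in> J \<delta>" "w' \<in> J \<delta> - {v', bar v'}" using multi[OF ed(4)] by blast
    have "v' \<in> PCI - J \<epsilon>" using J_unique[OF J_PCI[OF v'(1)]] ed v'(1) \<open>\<epsilon> \<noteq> \<delta>\<close> J_PCI by blast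
    then have "la v' = 0" using unit[OF ed(1) v] by blast
    then show False using unit[OF ed(2) v'] by auto
  qed
  have two: "two_places \<epsilon>" if \<epsilon>: "\<epsilon> \<in> EQ" "\<not> one_place \<epsilon>" for \<epsilon>
  proof -
    obtain v w where v: "v \<in> J \<epsilon>" "w \<in> J \<epsilon> - {v, bar v}" using multi[OF \<epsilon>(2)] by blast
    have w: "w \<in> J \<epsilon>" "v \<in> J \<epsilon> - {w, bar w}" using v by auto
    have "J \<epsilon> \<subseteq> {v, bar v, w, bar w}"
    proof (rule ccontr)
      assume "\<not> J \<epsilon> \<subseteq> {v, bar v, w, bar w}"
      then obtain z where z: "z \<in> J \<epsilon> - {v, bar v}" "z \<in> J \<epsilon> - {w, bar w}" by blast
      \<comment> \<open>The unit for \<open>v\<close> gives \<open>la w\<close> and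
        \<open>la z\<close> the same sign, opposite to that of \<open>la v\<close>; the unit for
        \<open>w\<close> gives \<open>la v\<close> and \<open>la z\<close> the same sign.\<close>
      obtain k :: int where k: "k * la v > 0" "k * la w < 0" "k * la z < 0"
        using unit[OF \<epsilon>(1) v] v(2) z(1) by blast
      obtain k' :: int where k': "k' * la w > 0" "k' * la v < 0" "k' * la z < 0"
        using unit[OF \<epsilon>(1) w] w(2) z(2) by blast
      show False using k k' by (auto simp: zero_less_mult_iff mult_less_0_iff)
    qed
    then have "J \<epsilon> = {v, bar v, w, bar w}" using v w bar_J[OF \<epsilon>(1)] by blast
    then show ?thesis unfolding two_places_def using v by blast
  qed
  show ?thesis using unique two by blast
qed

text \<open>The hypotheses describe a single logarithm that controls all the others. Bounded values
  of \<open>L\<close> then belong to finitely many units by \<open>finite_bounded_oz\<close>, so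
  \<open>cyclic_complement\<close> applies.\<close>

lemma log_complement:
  assumes L: "\<And>u w. u \<in> OU \<Longrightarrow> w \<in> OU \<Longrightarrow> L (u \<star> w) = L u + (L w :: real)"
    and T: "\<And>u. u \<in> OU \<Longrightarrow> L u = 0 \<longleftrightarrow> (\<forall>e\<in>PCI. cmod (lam e u) = 1)"
    and bound: "\<And>R. \<exists>C. \<forall>u\<in>OU. \<bar>L u\<bar> \<le> R \<longrightarrow> (\<forall>e\<in>PCI. cmod (lam e u) \<le> C)"
  shows "ecut G"
proof -
  interpret U: group "central_units G" by (rule group_central_units)
  have fin: "finite {L (ic x) | x. x \<in> carrier (central_units G) \<and> 0 < L (ic x) \<and> L (ic x) \<le> R}" for R
  proof -
    obtain C where C: "\<forall>u\<in>OU. \<bar>L u\<bar> \<le> R \<longrightarrow> (\<forall>e\<in>PCI. cmod (lam e u) \<le> C)" using bound by blast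
    have "{L (ic x) | x. x \<in> carrier (central_units G) \<and> 0 < L (ic x) \<and> L (ic x) \<le> R}
        \<subseteq> L ` {x \<in> oz. \<forall>e\<in>PCI. cmod (lam e x) \<le> C}"
      using C by (auto simp: central_units_simps OU_def intro!: imageI)
    then show ?thesis by (rule finite_subset) (intro finite_imageI finite_bounded_oz)
  qed
  obtain A r where "r \<le> 1" "subgroup A (central_units G)" "trivial_central_units G \<inter> A = {\<one>\<^bsub>central_units G\<^esub>}"
    "trivial_central_units G <#>\<^bsub>central_units G\<^esub> A = carrier (central_units G)"
    "(central_units G)\<lparr>carrier := A\<rparr> \<cong> free_Abelian_group {..<r :: nat}"
  proof (rule U.cyclic_complement[where L = "\<lambda>x. L (ic x)" and T = "trivial_central_units G"])
    show "L (ic (x \<otimes>\<^bsub>central_units G\<^esub> y)) = L (ic x) + L (ic y)"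
      if "x \<in> carrier (central_units G)" "y \<in> carrier (central_units G)" for x y
      using that by (simp add: central_units_simps ic_mult L)
    show "trivial_central_units G = {x \<in> carrier (central_units G). L (ic x) = 0}"
      unfolding trivial_central_units_iff using T by (auto simp: central_units_simps)
  qed (use fin in blast)+
  then show ?thesis unfolding ecut_iff free_complement_def by blast
qed

text \<open>All the logarithms on the component coincide, and their sum is zero.\<close>

lemma one_place_unit:
  assumes "\<epsilon> \<in> EQ" "one_place \<epsilon>" "u \<in> OU" "e \<in> J \<epsilon>"
  shows "loglam e u = 0"
proof -
  have J: "J \<epsilon> = {e, bar e}" using assms(2,4) bar_J[OF assms(1,4)] by (auto simp: one_place_def)
  have "(\<Sum>f\<in>J \<epsilon>. loglam f u) = of_nat (card (J \<epsilon>)) * loglam e u"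
    unfolding J using loglam_bar[OF assms(3) J_PCI[OF assms(4)]]
    by (subst sum.cong[of _ _ _ "\<lambda>_. loglam e u"]) auto
  then show ?thesis using loglam_sum[OF assms(3,1)] J_nonempty[OF assms(1)] by simp
qed

lemma loglam_zero_iff: "u \<in> OU \<Longrightarrow> e \<in> PCI \<Longrightarrow> loglam e u = 0 \<longleftrightarrow> cmod (lam e u) = 1"
  unfolding loglam_def using lam_OU_nonzero by (simp add: ln_eq_zero_iff)

lemma places_imp_ecut:
  assumes "(\<forall>\<epsilon>\<in>EQ. one_place \<epsilon>) \<or> (\<exists>\<epsilon>\<in>EQ. two_places \<epsilon> \<and> (\<forall>\<delta>\<in>EQ - {\<epsilon>}. one_place \<delta>))"
  shows "ecut G"
  using assms
proof
  assume one: "\<forall>\<epsilon>\<in>EQ. one_place \<epsilon>"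
  have 1: "cmod (lam e u) = 1" if "u \<in> OU" "e \<in> PCI" for u e
    using J_unique[OF that(2)] one_place_unit one that loglam_zero_iff by metis
  \<comment> \<open>All central units are trivial, so the zero function serves as logarithm.\<close>
  show ?thesis by (rule log_complement[where L = "\<lambda>_. 0"]) (use 1 in auto)
next
  assume "\<exists>\<epsilon>\<in>EQ. two_places \<epsilon> \<and> (\<forall>\<delta>\<in>EQ - {\<epsilon>}. one_place \<delta>)"
  then obtain \<epsilon> where \<epsilon>: "\<epsilon> \<in> EQ" "two_places \<epsilon>" and one: "\<And>\<delta>. \<delta> \<in> EQ \<Longrightarrow> \<delta> \<noteq> \<epsilon> \<Longrightarrow> one_place \<delta>" by auto
  obtain v w where vw: "v \<in> J \<epsilon>" "w \<in> J \<epsilon>" "w \<notin> {v, bar v}" "J \<epsilon> = {v, bar v, w, bar w}"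
    using \<epsilon>(2) by (auto simp: two_places_def)
  have out: "loglam e u = 0" if "u \<in> OU" "e \<in> PCI" "e \<notin> J \<epsilon>" for u e
    using J_unique[OF that(2)] one_place_unit one that by metis
  have vP: "v \<in> PCI" "w \<in> PCI" using vw J_PCI by auto
  \<comment> \<open>By \<open>J_real_dichotomy\<close> the two places are both real or both complex,
    so \<open>loglam v u\<close> and \<open>loglam w u\<close> enter the vanishing sum with the same
    multiplicity.\<close>
  have rel: "loglam w u = - loglam v u" if u: "u \<in> OU" for u
  proof -
    have bb: "loglam (bar v) u = loglam v u" "loglam (bar w) u = loglam w u" using loglam_bar[OF u] vP by auto
    have ne: "w \<noteq> v" "w \<noteq> bar v" "v \<noteq> bar w" "bar w \<noteq> bar v" "bar w \<noteq> v" using vw(3) by auto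
    have s: "(\<Sum>e\<in>{v, bar v, w, bar w}. loglam e u) = 0" using loglam_sum[OF u \<epsilon>(1)] vw(4) by simp
    show ?thesis
    proof (cases "bar v = v")
      case True
      then have "bar w = w" using J_real_dichotomy[OF \<epsilon>(1) vw(1) _ vw(2)] by simp
      then show ?thesis using s True ne by simp
    next
      case False
      then have "bar w \<noteq> w" using J_real_dichotomy[OF \<epsilon>(1) vw(2) _ vw(1)] by auto
      then show ?thesis using s False ne bb by auto
    qed
  qed
  have abs: "\<bar>loglam e u\<bar> \<le> \<bar>loglam v u\<bar>" if "u \<in> OU" "e \<in> PCI" for e u
    using out[OF that] rel[OF that(1)] loglam_bar[OF that(1)] vP vw(4) by (cases "e \<in> J \<epsilon>") auto
  show ?thesis
  proof (rule log_complement[where L = "loglam v"])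
    show "loglam v (x \<star> y) = loglam v x + loglam v y" if "x \<in> OU" "y \<in> OU" for x y
      using loglam_mult that vP(1) by blast
    show "loglam v u = 0 \<longleftrightarrow> (\<forall>e\<in>PCI. cmod (lam e u) = 1)" if u: "u \<in> OU" for u
    proof
      assume 0: "loglam v u = 0"
      have "loglam e u = 0" if "e \<in> PCI" for e using abs[OF u that] 0 by simp
      then show "\<forall>e\<in>PCI. cmod (lam e u) = 1" using loglam_zero_iff[OF u] by blast
    next
      assume "\<forall>e\<in>PCI. cmod (lam e u) = 1"
      then show "loglam v u = 0" using loglam_zero_iff[OF u vP(1)] vP(1) by blast
    qed
    show "\<exists>C. \<forall>u\<in>OU. \<bar>loglam v u\<bar> \<le> R \<longrightarrow> (\<forall>e\<in>PCI. cmod (lam e u) \<le> C)" for R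
    proof (intro exI ballI impI)
      fix u e assume u: "u \<in> OU" "\<bar>loglam v u\<bar> \<le> R" and e: "e \<in> (PCI :: ('a \<Rightarrow> complex) set)"
      have "loglam e u \<le> R" using abs[OF u(1) e] u(2) by linarith
      then show "cmod (lam e u) \<le> exp R"
        using lam_OU_nonzero[OF u(1) e] by (metis exp_le_cancel_iff exp_ln loglam_def zero_less_norm_iff)
    qed
  qed
qed

end

section \<open>Wedderburn decomposition of the rational group algebra\<close>

lemma type_algebra_simps [simp]:
  "carrier ring_of_type_algebra = (UNIV :: 'k::comm_ring_1 set)"
  "x \<otimes>\<^bsub>ring_of_type_algebra\<^esub> y = x * (y :: 'k)" "x \<oplus>\<^bsub>ring_of_type_algebra\<^esub> y = x + (y :: 'k)"
  "\<one>\<^bsub>ring_of_type_algebra\<^esub> = (1 :: 'k)" "\<zero>\<^bsub>ring_of_type_algebra\<^esub> = (0 :: 'k)"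
  by (simp_all add: ring_of_type_algebra_def)

lemma finsum_type_algebra [simp]:
  "finsum ring_of_type_algebra f A = (\<Sum>a\<in>A. f a :: 'k::comm_ring_1)"
proof -
  interpret R: ring "ring_of_type_algebra :: 'k ring" by (rule ring_from_type_algebra)
  show ?thesis by (induction A rule: infinite_finite_induct) auto
qed

text \<open>A central idempotent matrix over a division ring is trivial, because it commutes with the
  matrix units and is therefore scalar.\<close>

lemma matrix_central_idempotent:
  assumes D: "is_division_ring D" and M: "M \<in> carrier (matrix_ring n D)"
    and comm: "\<And>N. N \<in> carrier (matrix_ring n D) \<Longrightarrow> M \<otimes>\<^bsub>matrix_ring n D\<^esub> N = N \<otimes>\<^bsub>matrix_ring n D\<^esub> M"
    and idem: "M \<otimes>\<^bsub>matrix_ring n D\<^esub> M = M"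
  shows "M = \<zero>\<^bsub>matrix_ring n D\<^esub> \<or> M = \<one>\<^bsub>matrix_ring n D\<^esub>"
proof (cases "n = 0")
  case True
  then show ?thesis using M by (auto simp: matrix_ring_def)
next
  case False
  interpret D: ring D using D by (simp add: is_division_ring_def)
  have Mc: "M (i, j) \<in> carrier D" if "i < n" "j < n" for i j
    using M that by (auto simp: matrix_ring_def)
  define E where "E a b = (\<lambda>(i, j)\<in>{..<n} \<times> {..<n}. if i = a \<and> j = b then \<one>\<^bsub>D\<^esub> else \<zero>\<^bsub>D\<^esub>)" for a b
  have Ec: "E a b \<in> carrier (matrix_ring n D)" for a b by (auto simp: matrix_ring_def E_def)
  have ME: "(M \<otimes>\<^bsub>matrix_ring n D\<^esub> E a b) (i, b) = M (i, a)" if "i < n" "a < n" "b < n" for i a b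
  proof -
    have "(M \<otimes>\<^bsub>matrix_ring n D\<^esub> E a b) (i, b) = (\<Oplus>\<^bsub>D\<^esub>k\<in>{..<n}. if a = k then M (i, k) else \<zero>\<^bsub>D\<^esub>)"
      using that by (auto simp: matrix_ring_def E_def Mc intro!: D.finsum_cong')
    also have "\<dots> = M (i, a)" using that Mc by (intro D.finsum_singleton) auto
    finally show ?thesis .
  qed
  have EM: "(E a b \<otimes>\<^bsub>matrix_ring n D\<^esub> M) (i, b) = (if i = a then M (b, b) else \<zero>\<^bsub>D\<^esub>)"
    if "i < n" "a < n" "b < n" for i a b
  proof -
    have "(E a b \<otimes>\<^bsub>matrix_ring n D\<^esub> M) (i, b)
        = (\<Oplus>\<^bsub>D\<^esub>k\<in>{..<n}. if b = k then (if i = a then M (k, b) else \<zero>\<^bsub>D\<^esub>) else \<zero>\<^bsub>D\<^esub>)"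
      using that by (auto simp: matrix_ring_def E_def Mc intro!: D.finsum_cong')
    also have "\<dots> = (if i = a then M (b, b) else \<zero>\<^bsub>D\<^esub>)" using that Mc by (intro D.finsum_singleton) auto
    finally show ?thesis .
  qed
  \<comment> \<open>Compares the entry \<open>(i, b)\<close> of the two products with a matrix unit:
    entries off the diagonal vanish and all diagonal entries agree.\<close>
  have rel: "M (i, a) = (if i = a then M (b, b) else \<zero>\<^bsub>D\<^esub>)" if "i < n" "a < n" "b < n" for i a b
    using ME[OF that] EM[OF that] comm[OF Ec[of a b]] by simp
  define m where "m = M (0, 0)"
  have mc: "m \<in> carrier D" using Mc False by (simp add: m_def)
  have Mij: "M (i, j) = (if i = j then m else \<zero>\<^bsub>D\<^esub>)" if "i < n" "j < n" for i j
    using rel[of i j 0] that False by (simp add: m_def)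
  have "m = (M \<otimes>\<^bsub>matrix_ring n D\<^esub> M) (0, 0)" by (simp add: idem m_def)
  also have "\<dots> = (\<Oplus>\<^bsub>D\<^esub>k\<in>{..<n}. if 0 = k then m \<otimes>\<^bsub>D\<^esub> m else \<zero>\<^bsub>D\<^esub>)"
    using False mc by (auto simp: matrix_ring_def Mij intro!: D.finsum_cong')
  also have "\<dots> = m \<otimes>\<^bsub>D\<^esub> m" using False mc by (intro D.finsum_singleton) auto
  finally have mm: "m \<otimes>\<^bsub>D\<^esub> m = m" by simp
  have "m = \<zero>\<^bsub>D\<^esub> \<or> m = \<one>\<^bsub>D\<^esub>"
  proof (cases "m = \<zero>\<^bsub>D\<^esub>")
    case False
    then have "m \<in> Units D" using D mc by (simp add: is_division_ring_def)
    then show ?thesis using mm by (metis D.Units_l_inv D.Units_inv_closed D.m_assoc D.l_one mc)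
  qed simp
  moreover have "M = (\<lambda>(i, j)\<in>{..<n} \<times> {..<n}. if i = j then m else \<zero>\<^bsub>D\<^esub>)"
    by (rule PiE_ext[of M "{..<n} \<times> {..<n}" "\<lambda>_. carrier D"])
      (use M Mij mc in \<open>auto simp: matrix_ring_def\<close>)
  ultimately show ?thesis by (auto simp: matrix_ring_def fun_eq_iff)
qed

context fin_group
begin

abbreviation QG :: "('a \<Rightarrow> rat) ring" where "QG \<equiv> rational_group_ring G"

text \<open>\<open>res\<close> and \<open>unr\<close> translate between functions vanishing off \<open>G\<close> and the extensional functions
  used in \<^const>\<open>group_ring\<close>.\<close>

definition res :: "('a \<Rightarrow> rat) \<Rightarrow> 'a \<Rightarrow> rat" where "res f = restrict f (carrier G)"

definition unr :: "('a \<Rightarrow> rat) \<Rightarrow> 'a \<Rightarrow> rat" where "unr f = (\<lambda>x. if x \<in> carrier G then f x else 0)"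

lemma unr_galg [simp]: "unr f \<in> galg"
  by (simp add: unr_def galg_def)

lemma unr_res [simp]: "f \<in> galg \<Longrightarrow> unr (res f) = f"
  by (auto simp: unr_def res_def galg_def)

lemma QG_carrier: "carrier QG = res ` galg"
proof
  show "carrier QG \<subseteq> res ` galg"
  proof
    fix f assume "f \<in> carrier QG"
    then have f: "f \<in> carrier G \<rightarrow>\<^sub>E UNIV" by (simp add: group_ring_simps)
    have "f = res (unr f)"
    proof
      fix x show "f x = res (unr f) x"
        using PiE_arb[OF f, of x] by (cases "x \<in> carrier G") (simp_all add: res_def unr_def)
    qed
    then show "f \<in> res ` galg" by (metis imageI unr_galg)
  qed
qed (auto simp: group_ring_simps res_def)

lemma res_unr [simp]: "f \<in> carrier QG \<Longrightarrow> res (unr f) = f"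
  by (auto simp: QG_carrier)

lemma res_inj: "f \<in> galg \<Longrightarrow> h \<in> galg \<Longrightarrow> res f = res h \<longleftrightarrow> f = h"
  by (metis unr_res)

lemma res_injD: "f \<in> galg \<Longrightarrow> h \<in> galg \<Longrightarrow> res f = res h \<Longrightarrow> f = h"
  by (metis unr_res)

lemma QG_ops: "res f \<otimes>\<^bsub>QG\<^esub> res h = res (f \<star> h)" "res f \<oplus>\<^bsub>QG\<^esub> res h = res (f + h)"
  "\<one>\<^bsub>QG\<^esub> = res e1" "\<zero>\<^bsub>QG\<^esub> = res 0"
  by (auto simp: group_ring_simps res_def conv_def delta_def fun_eq_iff intro!: sum.cong)

text \<open>The corner cut out by \<open>f\<close> on both sides. For central \<open>f\<close> it is
  an ideal, and these are the components; for primitive non-central \<open>f\<close> it is a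
  division ring.\<close>

definition corner :: "('a \<Rightarrow> rat) \<Rightarrow> ('a \<Rightarrow> rat) set" where
  "corner f = {x \<in> galg. f \<star> x = x \<and> x \<star> f = x}"

definition corner_ring :: "('a \<Rightarrow> rat) \<Rightarrow> ('a \<Rightarrow> rat) ring" where
  "corner_ring f = QG\<lparr>carrier := res ` corner f, one := res f\<rparr>"

lemma corner_galg: "x \<in> corner f \<Longrightarrow> x \<in> galg"
  by (simp add: corner_def)

lemma corner_closed:
  "x \<in> corner f \<Longrightarrow> y \<in> corner f \<Longrightarrow> x + y \<in> corner f" "x \<in> corner f \<Longrightarrow> y \<in> corner f \<Longrightarrow> x \<star> y \<in> corner f"
  "x \<in> corner f \<Longrightarrow> - x \<in> corner f" "0 \<in> corner f" "f \<star> f = f \<Longrightarrow> f \<in> corner f"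
  using galg_closed(6)[of f f]
  by (auto simp: corner_def conv_distribs conv_assoc) (simp_all add: conv_assoc[symmetric])

lemma corner_ring_simps:
  "carrier (corner_ring f) = res ` corner f" "\<one>\<^bsub>corner_ring f\<^esub> = res f" "\<zero>\<^bsub>corner_ring f\<^esub> = res 0"
  "res x \<otimes>\<^bsub>corner_ring f\<^esub> res y = res (x \<star> y)" "res x \<oplus>\<^bsub>corner_ring f\<^esub> res y = res (x + y)"
  by (simp_all add: corner_ring_def QG_ops)

lemma ring_corner_ring:
  assumes f: "f \<star> f = f"
  shows "ring (corner_ring f)"
proof (rule ringI)
  show "abelian_group (corner_ring f)"
  proof (rule abelian_groupI)
    show "\<exists>y\<in>carrier (corner_ring f). y \<oplus>\<^bsub>corner_ring f\<^esub> x = \<zero>\<^bsub>corner_ring f\<^esub>" if "x \<in> carrier (corner_ring f)" for x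
    proof -
      obtain z where z: "z \<in> corner f" "x = res z" using \<open>x \<in> carrier (corner_ring f)\<close> by (auto simp: corner_ring_simps)
      then show ?thesis using corner_closed(3) by (intro bexI[of _ "res (- z)"]) (auto simp: corner_ring_simps)
    qed
  qed (auto simp: corner_ring_simps corner_closed add_ac)
  show "monoid (corner_ring f)"
    by (rule monoidI) (auto simp: corner_ring_simps corner_closed f conv_assoc, auto simp: corner_def)
qed (auto simp: corner_ring_simps conv_distribs)

lemma finsum_corner_ring:
  assumes f: "f \<star> f = f" and h: "\<And>i. i \<in> I \<Longrightarrow> h i \<in> corner f"
  shows "finsum (corner_ring f) (\<lambda>i. res (h i)) I = res (\<Sum>i\<in>I. h i)"
proof -
  interpret R: ring "corner_ring f" by (rule ring_corner_ring[OF f])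
  show ?thesis using h
  proof (induction I rule: infinite_finite_induct)
    case (insert i I)
    have "finsum (corner_ring f) (\<lambda>i. res (h i)) (insert i I) = res (h i) \<oplus>\<^bsub>corner_ring f\<^esub> finsum (corner_ring f) (\<lambda>i. res (h i)) I"
      using insert by (intro R.finsum_insert) (auto simp: corner_ring_simps)
    also have "finsum (corner_ring f) (\<lambda>i. res (h i)) I = res (\<Sum>i\<in>I. h i)" using insert by blast
    finally show ?case unfolding corner_ring_simps sum.insert[OF insert(1,2)] .
  qed (simp_all add: corner_ring_simps)
qed

lemma corner_e1: "corner e1 = galg"
  by (auto simp: corner_def)

lemma QG_corner_ring: "QG = corner_ring e1"
  by (simp add: corner_ring_def corner_e1 QG_carrier[symmetric] QG_ops(3)[symmetric])

lemma ring_QG: "ring QG"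
  by (subst QG_corner_ring) (rule ring_corner_ring, simp)

lemma finsum_QG: "(\<And>i. i \<in> I \<Longrightarrow> h i \<in> galg) \<Longrightarrow> finsum QG (\<lambda>i. res (h i)) I = res (\<Sum>i\<in>I. h i)"
  by (subst QG_corner_ring) (rule finsum_corner_ring, simp_all add: corner_e1)

definition component :: "('a \<Rightarrow> rat) \<Rightarrow> ('a \<Rightarrow> rat) set" where "component e = res ` corner e"

lemma corner_central: "e \<in> zalg \<Longrightarrow> corner e = {x \<in> galg. x \<star> e = x}"
  by (auto simp: corner_def zalg_commute)

lemma component_ring_corner:
  assumes e: "e \<star> e = e"
  shows "component_ring QG (component e) = corner_ring e"
proof -
  have eg: "e \<in> corner e" using corner_closed(5)[OF e] .
  have "(THE d. d \<in> component e \<and> (\<forall>x\<in>component e. d \<otimes>\<^bsub>QG\<^esub> x = x \<and> x \<otimes>\<^bsub>QG\<^esub> d = x)) = res e"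
  proof (rule the_equality)
    show "res e \<in> component e \<and> (\<forall>x\<in>component e. res e \<otimes>\<^bsub>QG\<^esub> x = x \<and> x \<otimes>\<^bsub>QG\<^esub> res e = x)"
      using eg by (auto simp: component_def QG_ops) (auto simp: corner_def)
    fix d assume d: "d \<in> component e \<and> (\<forall>x\<in>component e. d \<otimes>\<^bsub>QG\<^esub> x = x \<and> x \<otimes>\<^bsub>QG\<^esub> d = x)"
    then obtain y where y: "y \<in> corner e" "d = res y" by (auto simp: component_def)
    have "d = d \<otimes>\<^bsub>QG\<^esub> res e" using y by (simp add: QG_ops) (simp add: corner_def)
    also have "\<dots> = res e" using d eg by (simp add: component_def)
    finally show "d = res e" .
  qed
  then show ?thesis by (simp add: component_ring_def corner_ring_def component_def)
qed

section \<open>Primitive idempotents and matrix units\<close>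

definition prim :: "('a \<Rightarrow> rat) \<Rightarrow> bool" where
  "prim f \<longleftrightarrow> f \<star> f = f \<and> f \<noteq> 0 \<and> (\<forall>g. g \<star> g = g \<longrightarrow> f \<star> g = g \<longrightarrow> g \<star> f = g \<longrightarrow> g \<noteq> 0 \<longrightarrow> g = f)"

lemma prim_below:
  assumes h: "h \<star> h = h" "h \<noteq> 0"
  obtains f where "prim f" "f \<star> h = f" "h \<star> f = f"
proof -
  define S where "S = {g. g \<star> g = g \<and> g \<noteq> 0 \<and> h \<star> g = g \<and> g \<star> h = g}"
  have "S \<noteq> {}" "S \<subseteq> {f. f \<star> f = f}" using h by (auto simp: S_def)
  then obtain f where f: "f \<in> S" "\<And>g. g \<in> S \<Longrightarrow> f \<star> g = g \<Longrightarrow> g \<star> f = g \<Longrightarrow> g = f"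
    by (rule minimal_idempotent) blast
  have "g = f" if g: "g \<star> g = g" "f \<star> g = g" "g \<star> f = g" "g \<noteq> 0" for g
  proof (rule f(2)[OF _ g(2,3)])
    have "h \<star> g = g" using f(1) g(2) conv_assoc[of h f g] by (simp add: S_def)
    moreover have "g \<star> h = g" using f(1) g(3) conv_assoc[of g f h] by (simp add: S_def)
    ultimately show "g \<in> S" using g by (simp add: S_def)
  qed
  then show ?thesis using f(1) by (intro that[of f]) (auto simp: prim_def S_def)
qed

text \<open>Take an orthogonal family of primitive idempotents below \<open>e\<close> of maximal
  size, with sum \<open>s\<close>. If \<open>s \<noteq> e\<close>, a primitive idempotent below
  \<open>e - s\<close> is orthogonal to the family and enlarges it.\<close>

lemma prim_decomposition:
  assumes e: "e \<star> e = e"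
  obtains F where "finite F" "\<And>f. f \<in> F \<Longrightarrow> prim f \<and> f \<star> e = f \<and> e \<star> f = f"
    "\<And>f g. f \<in> F \<Longrightarrow> g \<in> F \<Longrightarrow> f \<noteq> g \<Longrightarrow> f \<star> g = 0" "(\<Sum>f\<in>F. f) = e"
proof -
  define P where "P F \<longleftrightarrow> finite F \<and> (\<forall>f\<in>F. prim f \<and> f \<star> e = f \<and> e \<star> f = f) \<and>
    (\<forall>f\<in>F. \<forall>g\<in>F. f \<noteq> g \<longrightarrow> f \<star> g = 0)" for F
  have bd: "card F \<le> card (carrier G)" if "P F" for F
  proof (rule orthogonal_idempotents_card)
    show "finite F" using that by (simp add: P_def)
    show "f \<star> f = f \<and> f \<noteq> 0" if "f \<in> F" for f using \<open>P F\<close> that by (simp add: P_def prim_def)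
    show "f \<star> g = 0" if "f \<in> F" "g \<in> F" "f \<noteq> g" for f g using \<open>P F\<close> that by (simp add: P_def)
  qed
  have "P {}" by (simp add: P_def)
  then obtain F where F: "P F" "\<And>F'. P F' \<Longrightarrow> card F' \<le> card F"
    using ex_has_greatest_nat[of P "{}" card "Suc (card (carrier G))"] bd less_Suc_eq_le by (metis le_SucI)
  define s where "s = (\<Sum>f\<in>F. f)"
  have fs: "f \<star> s = f" "s \<star> f = f" if f: "f \<in> F" for f
  proof -
    have ff: "f \<star> f = f" "finite F" using F(1) f by (simp_all add: P_def prim_def)
    have FO: "g \<star> h = 0" if "g \<in> F" "h \<in> F" "g \<noteq> h" for g h using F(1) that by (simp add: P_def)
    have o: "f \<star> g = (if g = f then f else 0)" "g \<star> f = (if g = f then f else 0)" if "g \<in> F" for g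
      using FO[OF f that] FO[OF that f] ff(1) by simp_all
    have "f \<star> s = (\<Sum>g\<in>F. if g = f then f else 0)" "s \<star> f = (\<Sum>g\<in>F. if g = f then f else 0)"
      unfolding s_def conv_sum_left conv_sum_right by (rule sum.cong[OF refl], erule o)+
    then show "f \<star> s = f" "s \<star> f = f" using ff f by simp_all
  qed
  have Fe: "f \<star> e = f" "e \<star> f = f" if "f \<in> F" for f using F(1) that by (auto simp: P_def)
  have se: "s \<star> e = s" "e \<star> s = s"
    unfolding s_def conv_sum_left conv_sum_right by (rule sum.cong[OF refl], erule Fe)+
  have ss: "s \<star> s = s"
    by (subst (1 3) s_def, unfold conv_sum_left, rule sum.cong[OF refl], erule fs)
  have "s = e"
  proof (rule ccontr)
    assume "s \<noteq> e"
    then have "e - s \<noteq> 0" by simp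
    moreover have "(e - s) \<star> (e - s) = e - s" using e se ss by (simp add: conv_distribs)
    ultimately obtain g where g: "prim g" "g \<star> (e - s) = g" "(e - s) \<star> g = g" using prim_below by blast
    have ge: "g \<star> e = g" "e \<star> g = g"
      using g(2,3) conv_assoc[of g "e - s" e] conv_assoc[of e "e - s" g] e se by (simp_all add: conv_distribs)
    \<comment> \<open>Since \<open>e - s\<close> fixes \<open>g\<close> from both sides, and both
      products of \<open>f\<close> with \<open>e - s\<close> vanish.\<close>
    have fg: "f \<star> g = 0" "g \<star> f = 0" if f: "f \<in> F" for f
    proof -
      have fe: "f \<star> e = f" "e \<star> f = f" using F(1) f by (auto simp: P_def)
      have "f \<star> g = f \<star> (e - s) \<star> g" using g(3) by (simp add: conv_assoc)
      then show "f \<star> g = 0" using fs[OF f] fe by (simp add: conv_distribs)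
      have "g \<star> f = g \<star> ((e - s) \<star> f)" using g(2) by (simp add: conv_assoc[symmetric])
      then show "g \<star> f = 0" using fs[OF f] fe by (simp add: conv_distribs)
    qed
    have "g \<notin> F" using fg(1)[of g] g(1) by (auto simp: prim_def)
    moreover have "P (insert g F)" using F(1) g(1) ge fg by (auto simp: P_def)
    ultimately show False using F(2)[of "insert g F"] F(1) by (simp add: P_def)
  qed
  then show ?thesis using F(1) by (intro that[of F]) (auto simp: P_def s_def)
qed

text \<open>By \<open>regular\<close>, \<open>x = x \<star> a \<star> x\<close>, so
  \<open>g = a \<star> x\<close> is idempotent. Then \<open>f \<star> g\<close> is an idempotent
  below \<open>f\<close>, nonzero because \<open>x = x \<star> (f \<star> g)\<close>, hence equal to
  \<open>f\<close>. The left inverse is \<open>f \<star> a \<star> f'\<close>.\<close>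

lemma prim_left_inverse:
  assumes f: "prim f" and x: "x \<star> f = x" "f' \<star> x = x" "x \<noteq> 0" "f' \<star> f' = f'"
  obtains y where "f \<star> y = y" "y \<star> f' = y" "y \<star> x = f"
proof -
  have "x \<in> galg" using x(1) galg_closed(6) by metis
  then obtain a where a: "x \<star> a \<star> x = x" using Q.regular by blast
  define g where "g = a \<star> x"
  have ff: "f \<star> f = f" using f by (simp add: prim_def)
  have gf: "g \<star> f = g" using x(1) by (simp add: g_def conv_assoc)
  have gg: "g \<star> g = g" unfolding g_def using a conv_assoc by metis
  have xg: "x \<star> g = x" using a by (simp add: g_def conv_assoc)
  have "f \<star> g = f"
  proof -
    have "(f \<star> g) \<star> (f \<star> g) = f \<star> g"
      using gf gg by (metis conv_assoc)
    moreover have "f \<star> (f \<star> g) = f \<star> g" using ff by (metis conv_assoc)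
    moreover have "(f \<star> g) \<star> f = f \<star> g" using gf by (simp add: conv_assoc)
    moreover have "f \<star> g \<noteq> 0"
    proof
      assume "f \<star> g = 0"
      then have "x = 0" using xg x(1) conv_assoc[of x f g] by simp
      then show False using x(3) by simp
    qed
    ultimately show ?thesis using f by (simp add: prim_def)
  qed
  then have "(f \<star> a \<star> f') \<star> x = f" using x(2) by (simp add: g_def conv_assoc)
  moreover have "f \<star> (f \<star> a \<star> f') = f \<star> a \<star> f'" using ff by (simp add: conv_assoc[symmetric])
  moreover have "(f \<star> a \<star> f') \<star> f' = f \<star> a \<star> f'" using x(4) by (simp add: conv_assoc)
  ultimately show ?thesis by (intro that)
qed

text \<open>Schur's lemma for the left ideals of two primitive idempotents: with a left inverse
  \<open>y\<close> of \<open>x\<close>, the product \<open>x \<star> y\<close> is a nonzero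
  idempotent below \<open>f'\<close>.\<close>

lemma prim_inverse:
  assumes f: "prim f" "prim f'" and x: "x \<star> f = x" "f' \<star> x = x" "x \<noteq> 0"
  obtains y where "f \<star> y = y" "y \<star> f' = y" "y \<star> x = f" "x \<star> y = f'"
proof -
  obtain y where y: "f \<star> y = y" "y \<star> f' = y" "y \<star> x = f"
    using prim_left_inverse[OF f(1) x] f(2) by (auto simp: prim_def)
  have "(x \<star> y) \<star> (x \<star> y) = x \<star> (y \<star> x) \<star> y" by (simp add: conv_assoc)
  also have "\<dots> = x \<star> y" using y(3) x(1) by simp
  finally have 1: "(x \<star> y) \<star> (x \<star> y) = x \<star> y" .
  have 2: "f' \<star> (x \<star> y) = x \<star> y" "(x \<star> y) \<star> f' = x \<star> y"
    using x(2) y(2) conv_assoc[of f' x y] by (simp_all add: conv_assoc)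
  have "y \<star> (x \<star> y) \<star> x = f" using y(3) f(1) conv_assoc[of y x "y \<star> x"] by (simp add: conv_assoc prim_def)
  then have "x \<star> y \<noteq> 0" using f(1) by (auto simp: prim_def)
  then have "x \<star> y = f'" using f(2) 1 2 by (simp add: prim_def)
  with y show ?thesis by (rule that)
qed

text \<open>In a simple component two nonzero idempotents are linked, since the left annihilator of
  \<open>A f\<^sub>2\<close> is a two-sided ideal.\<close>

lemma PCI_linked:
  assumes e: "e \<in> PCI" and f: "f1 \<star> e = f1" "f2 \<star> e = f2" "f1 \<noteq> 0" "f2 \<noteq> (0 :: 'a \<Rightarrow> rat)"
  obtains a where "f1 \<star> a \<star> f2 \<noteq> 0"
proof (rule ccontr)
  assume "\<not> thesis"
  then have none: "f1 \<star> a \<star> f2 = 0" for a using that by blast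
  define I where "I = {x \<in> galg. \<forall>a. x \<star> (a \<star> f2) = 0}"
  have "fvs.subspace I" by (rule fvs.subspaceI) (auto simp: I_def conv_distribs conv_scale_left)
  moreover have "I \<subseteq> galg" by (auto simp: I_def)
  moreover have "b \<star> x \<in> I" "x \<star> b \<in> I" if x: "x \<in> I" for b x
  proof -
    have "x \<star> (a \<star> f2) = 0" for a using x by (simp add: I_def)
    from this this[of "b \<star> _"] show "b \<star> x \<in> I" "x \<star> b \<in> I" by (simp_all add: I_def conv_assoc)
  qed
  ultimately obtain p where p: "p \<in> I" "p \<in> zalg" "p \<star> p = p" "\<And>x. x \<in> I \<Longrightarrow> x \<star> p = x"
    using Q.ideal_idempotent[of I] by metis
  have "f1 \<in> I" using none f(1) galg_closed(6)[of f1 e] by (auto simp: I_def conv_assoc)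
  then have fp: "f1 \<star> p = f1" by (rule p(4))
  have "f1 \<star> (p \<star> e) = f1" using fp f(1) by (simp add: conv_assoc[symmetric])
  then have "p \<star> e \<noteq> 0" using f(3) by auto
  then have "p \<star> e = e"
    using PCI_primitive[OF e, of "p \<star> e"] zalg_idem_mult[OF p(2) PCI_D(1)[OF e] p(3) PCI_D(2)[OF e]] p(2) PCI_D(1)[OF e]
    by blast
  moreover have "p \<star> (e \<star> f2) = 0" using p(1) by (simp add: I_def)
  ultimately have "e \<star> f2 = 0" by (simp add: conv_assoc[symmetric])
  then show False using f(2,4) zalg_commute[OF PCI_D(1)[OF e], of f2] by simp
qed

text \<open>The case \<open>f' = f\<close> of \<open>prim_inverse\<close>.\<close>

lemma division_ring_prim:
  assumes f: "prim f"
  shows "is_division_ring (corner_ring f)"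
proof -
  have ff: "f \<star> f = f" and f0: "f \<noteq> 0" using f by (auto simp: prim_def)
  have fg: "f \<in> galg" using ff galg_closed(6) by metis
  interpret R: ring "corner_ring f" by (rule ring_corner_ring[OF ff])
  have ne: "\<one>\<^bsub>corner_ring f\<^esub> \<noteq> \<zero>\<^bsub>corner_ring f\<^esub>" using f0 fg by (simp add: corner_ring_simps res_inj)
  have "Units (corner_ring f) = carrier (corner_ring f) - {\<zero>\<^bsub>corner_ring f\<^esub>}"
  proof (intro equalityI subsetI)
    fix x assume x: "x \<in> Units (corner_ring f)"
    then have "x \<noteq> \<zero>\<^bsub>corner_ring f\<^esub>" using ne by (metis R.Units_l_inv R.r_null R.Units_inv_closed)
    then show "x \<in> carrier (corner_ring f) - {\<zero>\<^bsub>corner_ring f\<^esub>}" using x by auto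
  next
    fix x assume "x \<in> carrier (corner_ring f) - {\<zero>\<^bsub>corner_ring f\<^esub>}"
    then obtain z where z: "z \<in> corner f" "x = res z" "z \<noteq> 0" by (auto simp: corner_ring_simps)
    then obtain y where y: "f \<star> y = y" "y \<star> f = y" "y \<star> z = f" "z \<star> y = f"
      using prim_inverse[OF f f, of z] by (auto simp: corner_def)
    have "y \<in> corner f" using y(1,2) galg_closed(6)[of f y] by (simp add: corner_def)
    then have "x \<in> carrier (corner_ring f)" "res y \<in> carrier (corner_ring f)" using z(1,2) by (auto simp: corner_ring_simps)
    moreover have "res y \<otimes>\<^bsub>corner_ring f\<^esub> x = \<one>\<^bsub>corner_ring f\<^esub>" "x \<otimes>\<^bsub>corner_ring f\<^esub> res y = \<one>\<^bsub>corner_ring f\<^esub>"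
      unfolding z(2) corner_ring_simps y(3,4) by simp_all
    ultimately show "x \<in> Units (corner_ring f)" unfolding Units_def by blast
  qed
  then show ?thesis using ne R.ring_axioms by (simp add: is_division_ring_def)
qed

text \<open>Write \<open>e\<close> as an orthogonal sum of primitive idempotents
  \<open>fi i\<close>. Each of them is linked to \<open>f0\<close>, so all entries can be
  transported into the one corner of \<open>f0\<close>, which is the division ring.\<close>

lemma component_matrix_ring:
  assumes e: "e \<in> PCI"
  shows "\<exists>n\<ge>1. \<exists>D :: ('a \<Rightarrow> rat) ring. is_division_ring D \<and> component_ring QG (component e) \<simeq> matrix_ring n D"
proof -
  have ee: "e \<star> e = e" and e0: "e \<noteq> 0" and eg: "e \<in> galg" using PCI_D[OF e] by auto
  have ez: "e \<star> x = x \<star> e" for x using zalg_commute[OF PCI_D(1)[OF e]] .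
  obtain F where F: "finite F" "\<And>f. f \<in> F \<Longrightarrow> prim f \<and> f \<star> e = f \<and> e \<star> f = f"
    "\<And>f g. f \<in> F \<Longrightarrow> g \<in> F \<Longrightarrow> f \<noteq> g \<Longrightarrow> f \<star> g = 0" "(\<Sum>f\<in>F. f) = e"
    by (rule prim_decomposition[OF ee]) blast
  define n where "n = card F"
  obtain fi where fi: "bij_betw fi {0..<n} F" unfolding n_def using ex_bij_betw_nat_finite[OF F(1)] by blast
  have "F \<noteq> {}" using F(4) e0 by auto
  then have n1: "n \<ge> 1" using F(1) by (simp add: n_def card_gt_0_iff Suc_le_eq)
  have fF: "fi i \<in> F" if "i < n" for i using bij_betwE[OF fi] that by simp
  have fprim: "prim (fi i)" and fe: "fi i \<star> e = fi i" if "i < n" for i using F(2) fF[OF that] by auto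
  have fidem: "fi i \<star> fi i = fi i" and fne: "fi i \<noteq> 0" if "i < n" for i using fprim[OF that] by (auto simp: prim_def)
  have forth: "fi i \<star> fi j = (if i = j then fi i else 0)" if "i < n" "j < n" for i j
  proof (cases "i = j")
    case False
    then have "fi i \<noteq> fi j" using inj_onD[OF bij_betw_imp_inj_on[OF fi], of i j] that by auto
    then show ?thesis using F(3)[OF fF[OF that(1)] fF[OF that(2)]] False by simp
  qed (simp add: fidem that)
  have fsum: "(\<Sum>i\<in>{0..<n}. fi i) = e" using sum.reindex_bij_betw[OF fi, of "\<lambda>f. f"] F(4) by simp
  define f0 where "f0 = fi 0"
  have p0: "prim f0" "f0 \<star> f0 = f0" using fprim n1 by (auto simp: f0_def prim_def)
  \<comment> \<open>\<open>u\<close> and \<open>w\<close> are mutually inverse between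
    \<open>f0\<close> and \<open>fi i\<close>. The products \<open>w i \<star> u j\<close> of the
    resulting families multiply like matrix units.\<close>
  have "\<exists>u w. f0 \<star> u = u \<and> u \<star> fi i = u \<and> fi i \<star> w = w \<and> w \<star> f0 = w \<and> w \<star> u = fi i \<and> u \<star> w = f0"
    if i: "i < n" for i
  proof -
    obtain a where a: "f0 \<star> a \<star> fi i \<noteq> 0"
      using PCI_linked[OF e, of f0 "fi i"] fe fne i n1 unfolding f0_def by auto
    define u where "u = f0 \<star> a \<star> fi i"
    have u: "u \<star> fi i = u" "f0 \<star> u = u"
      using fidem[OF i] p0(2) by (simp_all add: u_def conv_assoc) (simp add: conv_assoc[symmetric])
    obtain w where "fi i \<star> w = w" "w \<star> f0 = w" "w \<star> u = fi i" "u \<star> w = f0"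
      using prim_inverse[OF fprim[OF i] p0(1) u] a unfolding u_def by blast
    then show ?thesis using u by blast
  qed
  then obtain u w where uw_all: "\<And>i. i < n \<Longrightarrow> f0 \<star> u i = u i \<and> u i \<star> fi i = u i \<and>
      fi i \<star> w i = w i \<and> w i \<star> f0 = w i \<and> w i \<star> u i = fi i \<and> u i \<star> w i = f0"
    by metis
  have u: "f0 \<star> u i = u i" "u i \<star> fi i = u i" and w: "fi i \<star> w i = w i" "w i \<star> f0 = w i"
    and wu: "w i \<star> u i = fi i" and uw: "u i \<star> w i = f0" if "i < n" for i
    using uw_all[OF that] by auto
  have uwij: "u i \<star> w j = (if i = j then f0 else 0)" if "i < n" "j < n" for i j
  proof -
    have "u i \<star> w j = u i \<star> (fi i \<star> fi j) \<star> w j" using u(2) w(1) that by (metis conv_assoc)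
    then show ?thesis using that forth u(2) uw by simp
  qed
  define D where "D = corner_ring f0"
  have Ddiv: "is_division_ring D" unfolding D_def by (rule division_ring_prim[OF p0(1)])
  interpret D: ring D using Ddiv by (simp add: is_division_ring_def)
  \<comment> \<open>The entry \<open>fi i \<star> x \<star> fi j\<close>, transported into the
    corner of \<open>f0\<close>.\<close>
  define ent where "ent x i j = u i \<star> x \<star> w j" for x i j
  have entc: "ent x i j \<in> corner f0" if "i < n" "j < n" for x i j
  proof -
    have "f0 \<star> ent x i j = (f0 \<star> u i) \<star> x \<star> w j" by (simp add: ent_def conv_assoc)
    moreover have "ent x i j \<star> f0 = u i \<star> x \<star> (w j \<star> f0)" by (simp add: ent_def conv_assoc)
    ultimately show ?thesis using u(1) w(2) that by (simp add: corner_def) (simp add: ent_def)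
  qed
  have Dc: "res (ent x i k) \<otimes>\<^bsub>D\<^esub> res (ent y k j) \<in> carrier D" if "i < n" "k < n" "j < n" for x y i j k
    using that entc by (intro D.m_closed) (auto simp: D_def corner_ring_simps)
  define \<phi> where "\<phi> r = (\<lambda>(i, j)\<in>{..<n} \<times> {..<n}. res (ent (unr r) i j))" for r
  have \<phi>: "\<phi> (res x) = (\<lambda>(i, j)\<in>{..<n} \<times> {..<n}. res (ent x i j))" if "x \<in> corner e" for x
    using corner_galg[OF that] by (simp add: \<phi>_def)
  \<comment> \<open>Transporting the entries back gives \<open>fi i \<star> x \<star> fi j\<close>,
    and these add up to \<open>e \<star> x \<star> e\<close>. The same formula provides preimages
    for surjectivity.\<close>
  have recover: "(\<Sum>i\<in>{0..<n}. \<Sum>j\<in>{0..<n}. w i \<star> ent x i j \<star> u j) = x" if x: "x \<in> corner e" for x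
  proof -
    have "w i \<star> ent x i j \<star> u j = fi i \<star> x \<star> fi j" if "i < n" "j < n" for i j
    proof -
      have "w i \<star> ent x i j \<star> u j = (w i \<star> u i) \<star> x \<star> (w j \<star> u j)" by (simp only: ent_def conv_assoc)
      then show ?thesis using wu that by simp
    qed
    then have "(\<Sum>i\<in>{0..<n}. \<Sum>j\<in>{0..<n}. w i \<star> ent x i j \<star> u j) = (\<Sum>i\<in>{0..<n}. \<Sum>j\<in>{0..<n}. fi i \<star> x \<star> fi j)"
      by (intro sum.cong refl) auto
    also have "\<dots> = e \<star> x \<star> e"
      by (simp add: fsum[symmetric] conv_sum_left conv_sum_right)
        (subst sum.swap, simp)
    finally show ?thesis using x by (simp add: corner_def)
  qed
  have "\<phi> \<in> ring_iso (corner_ring e) (matrix_ring n D)"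
  proof (rule ring_iso_memI)
    fix r assume "r \<in> carrier (corner_ring e)"
    then obtain x where x: "x \<in> corner e" "r = res x" by (auto simp: corner_ring_simps)
    show "\<phi> r \<in> carrier (matrix_ring n D)"
      using entc by (auto simp: x \<phi> matrix_ring_def D_def corner_ring_simps)
    fix s assume "s \<in> carrier (corner_ring e)"
    then obtain y where y: "y \<in> corner e" "s = res y" by (auto simp: corner_ring_simps)
    have xy: "x \<star> y \<in> corner e" "x + y \<in> corner e" using x y corner_closed by auto
    show "\<phi> (r \<oplus>\<^bsub>corner_ring e\<^esub> s) = \<phi> r \<oplus>\<^bsub>matrix_ring n D\<^esub> \<phi> s"
      unfolding x(2) y(2) corner_ring_simps \<phi>[OF x(1)] \<phi>[OF y(1)] \<phi>[OF xy(2)]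
      by (auto simp: matrix_ring_def D_def corner_ring_simps ent_def conv_distribs fun_eq_iff)
    show "\<phi> (r \<otimes>\<^bsub>corner_ring e\<^esub> s) = \<phi> r \<otimes>\<^bsub>matrix_ring n D\<^esub> \<phi> s"
    proof -
      have mult: "(\<Oplus>\<^bsub>D\<^esub>k\<in>{..<n}. res (ent x i k) \<otimes>\<^bsub>D\<^esub> res (ent y k j)) = res (ent (x \<star> y) i j)"
        if ij: "i < n" "j < n" for i j
      proof -
        have "(\<Oplus>\<^bsub>D\<^esub>k\<in>{..<n}. res (ent x i k) \<otimes>\<^bsub>D\<^esub> res (ent y k j)) = res (\<Sum>k\<in>{..<n}. ent x i k \<star> ent y k j)"
          unfolding D_def corner_ring_simps using ij entc p0(2) corner_closed(2) by (intro finsum_corner_ring) auto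
        also have "(\<Sum>k\<in>{..<n}. ent x i k \<star> ent y k j) = (\<Sum>k\<in>{..<n}. u i \<star> x \<star> fi k \<star> (y \<star> w j))"
        proof (intro sum.cong refl)
          fix k assume "k \<in> {..<n}"
          have "ent x i k \<star> ent y k j = u i \<star> x \<star> (w k \<star> u k) \<star> (y \<star> w j)" by (simp only: ent_def conv_assoc)
          then show "ent x i k \<star> ent y k j = u i \<star> x \<star> fi k \<star> (y \<star> w j)" using wu \<open>k \<in> {..<n}\<close> by simp
        qed
        also have "\<dots> = u i \<star> x \<star> e \<star> (y \<star> w j)"
          by (simp add: fsum[symmetric] conv_sum_left conv_sum_right atLeast0LessThan)
        also have "\<dots> = u i \<star> (x \<star> e) \<star> (y \<star> w j)" by (simp only: conv_assoc)
        also have "\<dots> = ent (x \<star> y) i j" using x(1) by (simp add: corner_def) (simp add: ent_def conv_assoc)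
        finally show ?thesis .
      qed
      have "(\<Oplus>\<^bsub>D\<^esub>k\<in>{..<n}. \<phi> r (i, k) \<otimes>\<^bsub>D\<^esub> \<phi> s (k, j)) = res (ent (x \<star> y) i j)"
        if ij: "i < n" "j < n" for i j
      proof -
        have "(\<Oplus>\<^bsub>D\<^esub>k\<in>{..<n}. \<phi> r (i, k) \<otimes>\<^bsub>D\<^esub> \<phi> s (k, j)) =
            (\<Oplus>\<^bsub>D\<^esub>k\<in>{..<n}. res (ent x i k) \<otimes>\<^bsub>D\<^esub> res (ent y k j))"
          using ij by (intro D.finsum_cong') (auto simp: x(2) y(2) \<phi>[OF x(1)] \<phi>[OF y(1)] Dc)
        then show ?thesis using mult[OF ij] by simp
      qed
      then show ?thesis
        unfolding x(2) y(2) corner_ring_simps \<phi>[OF xy(1)] unfolding matrix_ring_def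
        by (auto intro!: restrict_ext)
    qed
  next
    have eu: "u i \<star> e = u i" if "i < n" for i
      using u(2)[OF that] fe[OF that] conv_assoc[of "u i" "fi i" e] by simp
    have "ent e i j = (if i = j then f0 else 0)" if "i < n" "j < n" for i j
      using that by (simp add: ent_def eu uwij)
    then show "\<phi> \<one>\<^bsub>corner_ring e\<^esub> = \<one>\<^bsub>matrix_ring n D\<^esub>"
      unfolding corner_ring_simps \<phi>[OF corner_closed(5)[OF ee]]
      by (auto simp: matrix_ring_def D_def corner_ring_simps intro!: restrict_ext)
  next
    show "bij_betw \<phi> (carrier (corner_ring e)) (carrier (matrix_ring n D))"
    proof (rule bij_betw_imageI)
      show "inj_on \<phi> (carrier (corner_ring e))"
      proof (rule inj_onI)
        fix r s assume "r \<in> carrier (corner_ring e)" "s \<in> carrier (corner_ring e)" and eq: "\<phi> r = \<phi> s"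
        then obtain x y where xy: "x \<in> corner e" "r = res x" "y \<in> corner e" "s = res y" by (auto simp: corner_ring_simps)
        have eq': "ent x i j = ent y i j" if "i < n" "j < n" for i j
        proof -
          have "res (ent x i j) = res (ent y i j)"
            using fun_cong[OF eq, of "(i, j)"] that by (simp add: xy \<phi>)
          then show ?thesis by (rule res_injD[OF corner_galg[OF entc[OF that]] corner_galg[OF entc[OF that]]])
        qed
        have "(\<Sum>i\<in>{0..<n}. \<Sum>j\<in>{0..<n}. w i \<star> ent x i j \<star> u j) = (\<Sum>i\<in>{0..<n}. \<Sum>j\<in>{0..<n}. w i \<star> ent y i j \<star> u j)"
          by (intro sum.cong refl) (simp add: eq')
        then have "x = y" using recover[OF xy(1)] recover[OF xy(3)] by metis
        then show "r = s" by (simp add: xy)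
      qed
      show "\<phi> ` carrier (corner_ring e) = carrier (matrix_ring n D)"
      proof (intro equalityI subsetI)
        fix M assume M: "M \<in> carrier (matrix_ring n D)"
        define m where "m i j = unr (M (i, j))" for i j
        have mc: "m i j \<in> corner f0" and Mm: "M (i, j) = res (m i j)" if "i < n" "j < n" for i j
        proof -
          have "M (i, j) \<in> res ` corner f0" using M that by (auto simp: matrix_ring_def D_def corner_ring_simps)
          then show "m i j \<in> corner f0" "M (i, j) = res (m i j)" using corner_galg by (auto simp: m_def)
        qed
        define x where "x = (\<Sum>i\<in>{0..<n}. \<Sum>j\<in>{0..<n}. w i \<star> m i j \<star> u j)"
        have wm: "e \<star> (w i \<star> m i j \<star> u j) = w i \<star> m i j \<star> u j" if "i < n" "j < n" for i j
        proof -
          have "e \<star> w i = w i" using w(1)[OF that(1)] F(2)[OF fF[OF that(1)]] conv_assoc[of e "fi i" "w i"] by simp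
          then show ?thesis by (simp add: conv_assoc[symmetric])
        qed
        have "e \<star> x = x"
          unfolding x_def conv_sum_right by (intro sum.cong refl) (simp add: wm)
        then have xc: "x \<in> corner e" using ez[of x] galg_closed(6)[of e x] by (simp add: corner_def)
        have "ent x k l = m k l" if kl: "k < n" "l < n" for k l
        proof -
          have "ent x k l = (\<Sum>i\<in>{0..<n}. \<Sum>j\<in>{0..<n}. (u k \<star> w i) \<star> m i j \<star> (u j \<star> w l))"
            by (simp add: ent_def x_def conv_sum_left conv_sum_right conv_assoc)
          also have "\<dots> = (\<Sum>i\<in>{0..<n}. \<Sum>j\<in>{0..<n}. if i = k then if j = l then f0 \<star> m k l \<star> f0 else 0 else 0)"
            using kl by (intro sum.cong refl) (simp add: uwij)
          also have "\<dots> = (\<Sum>i\<in>{0..<n}. if i = k then \<Sum>j\<in>{0..<n}. if j = l then f0 \<star> m k l \<star> f0 else 0 else 0)"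
            by (intro sum.cong refl) simp
          also have "\<dots> = f0 \<star> m k l \<star> f0" using kl by simp
          also have "\<dots> = m k l" using mc[OF kl] by (simp add: corner_def)
          finally show ?thesis .
        qed
        then have "\<phi> (res x) = M"
          by (intro PiE_ext[of _ "{..<n} \<times> {..<n}" "\<lambda>_. carrier D"])
            (use M Mm mc entc in \<open>auto simp: matrix_ring_def \<phi>[OF xc] D_def corner_ring_simps\<close>)
        then show "M \<in> \<phi> ` carrier (corner_ring e)" using xc by (auto simp: corner_ring_simps)
      next
        fix M assume "M \<in> \<phi> ` carrier (corner_ring e)"
        then show "M \<in> carrier (matrix_ring n D)"
          using entc by (auto simp: \<phi> matrix_ring_def D_def corner_ring_simps)
      qed
    qed
  qed
  then have "component_ring QG (component e) \<simeq> matrix_ring n D"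
    by (auto simp: is_ring_iso_def component_ring_corner[OF ee])
  then show ?thesis using n1 Ddiv by blast
qed

section \<open>Existence and uniqueness of the Wedderburn decomposition\<close>

lemma ideal_component:
  assumes e: "e \<in> zalg"
  shows "ideal (component e) QG"
proof (rule idealI[OF ring_QG])
  interpret R: ring QG by (rule ring_QG)
  show "subgroup (component e) (add_monoid QG)"
  proof (rule R.add.subgroupI)
    show "component e \<subseteq> carrier QG" by (auto simp: component_def QG_carrier corner_def)
    show "component e \<noteq> {}" using corner_closed(4)[of e] by (auto simp: component_def)
    show "\<ominus>\<^bsub>QG\<^esub> a \<in> component e" if a: "a \<in> component e" for a
    proof -
      obtain x where x: "x \<in> corner e" "a = res x" using a by (auto simp: component_def)
      have "\<ominus>\<^bsub>QG\<^esub> a = res (- x)"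
        using x corner_galg[OF x(1)]
        by (intro R.minus_equality) (auto simp: QG_ops QG_carrier)
      then show ?thesis using corner_closed(3)[OF x(1)] by (simp add: component_def)
    qed
    show "a \<oplus>\<^bsub>QG\<^esub> b \<in> component e" if "a \<in> component e" "b \<in> component e" for a b
      using that corner_closed(1) by (auto simp: component_def QG_ops)
  qed
  show "x \<otimes>\<^bsub>QG\<^esub> a \<in> component e" "a \<otimes>\<^bsub>QG\<^esub> x \<in> component e" if ax: "a \<in> component e" "x \<in> carrier QG" for a x
  proof -
    obtain y z where "y \<in> corner e" "a = res y" "z \<in> galg" "x = res z" using ax by (auto simp: component_def QG_carrier)
    then show "x \<otimes>\<^bsub>QG\<^esub> a \<in> component e" "a \<otimes>\<^bsub>QG\<^esub> x \<in> component e"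
      using zalg_commute[OF e]
      by (auto simp: component_def QG_ops corner_central[OF e] conv_assoc intro!: imageI) (metis conv_assoc)
  qed
qed

lemma component_inj: "e \<in> PCI \<Longrightarrow> f \<in> PCI \<Longrightarrow> component e = component f \<Longrightarrow> e = f"
proof (rule ccontr)
  assume e: "e \<in> PCI" and f: "f \<in> PCI" and eq: "component e = component f" and ne: "e \<noteq> f"
  have "res e \<in> component f" using eq corner_closed(5)[OF PCI_D(2)[OF e]] by (auto simp: component_def)
  then obtain x where x: "x \<in> corner f" "res e = res x" by (auto simp: component_def)
  then have "e = x" using res_inj PCI_D(4)[OF e] corner_galg by blast
  then have "e \<star> f = e" using x(1) by (simp add: corner_def)
  then show False using PCI_orth[OF e f ne] PCI_D(3)[OF e] by simp
qed

lemma wedderburn_QG: "wedderburn_decomposition QG (component ` PCI)"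
  unfolding wedderburn_decomposition_def
proof (intro conjI ballI)
  show "finite (component ` PCI)" by simp
  fix B assume "B \<in> component ` PCI"
  then obtain e where e: "e \<in> PCI" "B = component e" by blast
  show "ideal B QG" unfolding e(2) by (rule ideal_component[OF PCI_D(1)[OF e(1)]])
  show "\<exists>n\<ge>1. \<exists>D :: ('a \<Rightarrow> rat) ring. is_division_ring D \<and> component_ring QG B \<simeq> matrix_ring n D"
    unfolding e(2) by (rule component_matrix_ring[OF e(1)])
next
  fix r assume "r \<in> carrier QG"
  then obtain x where x: "x \<in> galg" "r = res x" by (auto simp: QG_carrier)
  have inj: "inj_on component PCI" using component_inj by (auto intro: inj_onI)
  have fs: "(\<Oplus>\<^bsub>QG\<^esub>B\<in>component ` PCI. c B) = res (\<Sum>e\<in>PCI. unr (c (component e)))"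
    if c: "c \<in> (\<Pi>\<^sub>E B\<in>component ` PCI. B)" for c
  proof -
    have cg: "c B \<in> carrier QG" if B: "B \<in> component ` PCI" for B
    proof -
      have "c B \<in> B" using c B by (rule PiE_mem)
      then show ?thesis using B by (auto simp: component_def QG_carrier corner_def)
    qed
    have "(\<Oplus>\<^bsub>QG\<^esub>B\<in>component ` PCI. c B) = (\<Oplus>\<^bsub>QG\<^esub>B\<in>component ` PCI. res (unr (c B)))"
      by (rule abelian_monoid.finsum_cong') (use cg ring_QG ring.is_abelian_group abelian_group.axioms(1) in \<open>auto simp: QG_carrier\<close>)
    also have "\<dots> = res (\<Sum>B\<in>component ` PCI. unr (c B))" by (rule finsum_QG) simp
    finally show ?thesis by (simp add: sum.reindex[OF inj])
  qed
  define c where "c = (\<lambda>B\<in>component ` PCI. res (x \<star> inv_into PCI component B))"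
  have ce: "c (component e) = res (x \<star> e)" if "e \<in> PCI" for e
    using that inj by (simp add: c_def)
  show "\<exists>!c. c \<in> (\<Pi>\<^sub>E B\<in>component ` PCI. B) \<and> r = (\<Oplus>\<^bsub>QG\<^esub>B\<in>component ` PCI. c B)"
  proof (rule ex1I)
    have c: "c \<in> (\<Pi>\<^sub>E B\<in>component ` PCI. B)"
    proof (rule PiE_I)
      fix B assume "B \<in> component ` PCI"
      then obtain e where e: "e \<in> PCI" "B = component e" by blast
      have "x \<star> e \<in> corner e" using PCI_D[OF e(1)] by (simp add: corner_central conv_assoc)
      then show "c B \<in> B" unfolding e(2) ce[OF e(1)] by (simp add: component_def)
    qed (simp add: c_def)
    have "(\<Sum>e\<in>PCI. unr (c (component e))) = x"
      using PCI_decomp[OF x(1)] by (simp add: ce)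
    then show "c \<in> (\<Pi>\<^sub>E B\<in>component ` PCI. B) \<and> r = (\<Oplus>\<^bsub>QG\<^esub>B\<in>component ` PCI. c B)"
      using c fs[OF c] x(2) by simp
    fix d assume d: "d \<in> (\<Pi>\<^sub>E B\<in>component ` PCI. B) \<and> r = (\<Oplus>\<^bsub>QG\<^esub>B\<in>component ` PCI. d B)"
    have dc: "\<exists>y\<in>corner e. d (component e) = res y" if "e \<in> PCI" for e
      using PiE_mem[OF conjunct1[OF d], of "component e"] that by (auto simp: component_def)
    have xs: "x = (\<Sum>e\<in>PCI. unr (d (component e)))"
      using d fs x by (subst res_inj[symmetric]) auto
    show "d = c"
    proof (rule PiE_ext[OF conjunct1[OF d] c])
      fix B assume "B \<in> component ` PCI"
      then obtain e where e: "e \<in> PCI" "B = component e" by blast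
      \<comment> \<open>Multiplication by \<open>e\<close> isolates the coordinate in
        \<open>component e\<close>, which makes the coordinates unique.\<close>
      have "x \<star> e = (\<Sum>f\<in>PCI. if f = e then unr (d (component e)) else 0)"
        unfolding xs conv_sum_left
      proof (intro sum.cong refl)
        fix f :: "'a \<Rightarrow> rat" assume f: "f \<in> PCI"
        obtain y where y: "y \<in> corner f" "d (component f) = res y" using dc[OF f] by blast
        have "unr (d (component f)) = y" using y corner_galg by simp
        moreover have "y = y \<star> f" using y(1) by (simp add: corner_def)
        ultimately show "unr (d (component f)) \<star> e = (if f = e then unr (d (component e)) else 0)"
          using PCI_orth[OF f e(1)] conv_assoc[of y f e] by auto
      qed
      then have "x \<star> e = unr (d (component e))" using e(1) by simp
      moreover obtain y where "y \<in> corner e" "d (component e) = res y" using dc[OF e(1)] by blast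
      ultimately show "d B = c B" unfolding e(2) ce[OF e(1)] using corner_galg by simp
    qed
  qed
qed

text \<open>In any decomposition, the coordinate \<open>d\<close> of 1 in \<open>B\<close> is an
  identity of \<open>B\<close>, hence a central idempotent with \<open>B = component d\<close>. A
  matrix ring over a division ring has no central idempotents besides 0 and 1, so \<open>d\<close>
  is primitive.\<close>

lemma wedderburn_component:
  assumes wd: "wedderburn_decomposition QG \<B>" and B: "B \<in> \<B>"
  shows "B \<in> component ` PCI"
proof -
  interpret R: ring QG by (rule ring_QG)
  have fin: "finite \<B>" and idl: "\<And>B. B \<in> \<B> \<Longrightarrow> ideal B QG"
    and uniq: "\<And>x. x \<in> carrier QG \<Longrightarrow> \<exists>!c. c \<in> (\<Pi>\<^sub>E B\<in>\<B>. B) \<and> x = (\<Oplus>\<^bsub>QG\<^esub>B\<in>\<B>. c B)"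
    using wd by (auto simp: wedderburn_decomposition_def)
  have sub: "x \<in> carrier QG" if "x \<in> B'" "B' \<in> \<B>" for x B'
    using ideal.Icarr[OF idl[OF that(2)] that(1)] .
  have zero: "\<zero>\<^bsub>QG\<^esub> \<in> B'" if "B' \<in> \<B>" for B'
    using additive_subgroup.zero_closed[OF ideal.axioms(1)[OF idl[OF that]]] .
  obtain c where c: "c \<in> (\<Pi>\<^sub>E B\<in>\<B>. B)" "\<one>\<^bsub>QG\<^esub> = (\<Oplus>\<^bsub>QG\<^esub>B\<in>\<B>. c B)"
    using uniq[OF R.one_closed] by blast
  have cB: "c B' \<in> B'" "c B' \<in> carrier QG" if "B' \<in> \<B>" for B'
    using PiE_mem[OF c(1) that] sub that by auto
  have single: "x = (\<Oplus>\<^bsub>QG\<^esub>B'\<in>\<B>. (\<lambda>B'\<in>\<B>. if B = B' then x else \<zero>\<^bsub>QG\<^esub>) B')" if "x \<in> B" for x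
  proof -
    have "(\<Oplus>\<^bsub>QG\<^esub>B'\<in>\<B>. (\<lambda>B'\<in>\<B>. if B = B' then x else \<zero>\<^bsub>QG\<^esub>) B') = (\<Oplus>\<^bsub>QG\<^esub>B'\<in>\<B>. if B = B' then x else \<zero>\<^bsub>QG\<^esub>)"
      using sub[OF that B] by (intro R.finsum_cong') auto
    also have "\<dots> = x" using B fin sub[OF that B] by (intro R.finsum_singleton) auto
    finally show ?thesis by simp
  qed
  have id: "x \<otimes>\<^bsub>QG\<^esub> c B = x" "c B \<otimes>\<^bsub>QG\<^esub> x = x" if x: "x \<in> B" for x
  proof -
    have xc: "x \<in> carrier QG" using sub[OF x B] .
    define s where "s = (\<lambda>B'\<in>\<B>. if B = B' then x else \<zero>\<^bsub>QG\<^esub>)"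
    have s: "s \<in> (\<Pi>\<^sub>E B\<in>\<B>. B) \<and> x = (\<Oplus>\<^bsub>QG\<^esub>B'\<in>\<B>. s B')"
      using single[OF x] x zero unfolding s_def by auto
    \<comment> \<open>Besides the trivial decomposition \<open>s\<close> of \<open>x\<close>,
      multiplying the decomposition of 1 by \<open>x\<close> gives another one; uniqueness compares
      their coordinates in \<open>B\<close>.\<close>
    define l where "l = (\<lambda>B'\<in>\<B>. x \<otimes>\<^bsub>QG\<^esub> c B')"
    have "x = x \<otimes>\<^bsub>QG\<^esub> (\<Oplus>\<^bsub>QG\<^esub>B\<in>\<B>. c B)" using c(2) xc R.r_one by metis
    also have "\<dots> = (\<Oplus>\<^bsub>QG\<^esub>B'\<in>\<B>. x \<otimes>\<^bsub>QG\<^esub> c B')" using xc cB fin by (intro R.finsum_rdistr) auto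
    also have "\<dots> = (\<Oplus>\<^bsub>QG\<^esub>B'\<in>\<B>. l B')" using xc cB by (intro R.finsum_cong') (auto simp: l_def)
    finally have "l \<in> (\<Pi>\<^sub>E B\<in>\<B>. B) \<and> x = (\<Oplus>\<^bsub>QG\<^esub>B'\<in>\<B>. l B')"
      using cB xc ideal.I_l_closed[OF idl] by (auto simp: l_def)
    then have "l = s" using uniq[OF xc] s by blast
    then have "l B = s B" by simp
    then show "x \<otimes>\<^bsub>QG\<^esub> c B = x" using B by (simp add: l_def s_def)
    define r where "r = (\<lambda>B'\<in>\<B>. c B' \<otimes>\<^bsub>QG\<^esub> x)"
    have "x = (\<Oplus>\<^bsub>QG\<^esub>B\<in>\<B>. c B) \<otimes>\<^bsub>QG\<^esub> x" using c(2) xc R.l_one by metis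
    also have "\<dots> = (\<Oplus>\<^bsub>QG\<^esub>B'\<in>\<B>. c B' \<otimes>\<^bsub>QG\<^esub> x)" using xc cB fin by (intro R.finsum_ldistr) auto
    also have "\<dots> = (\<Oplus>\<^bsub>QG\<^esub>B'\<in>\<B>. r B')" using xc cB by (intro R.finsum_cong') (auto simp: r_def)
    finally have "r \<in> (\<Pi>\<^sub>E B\<in>\<B>. B) \<and> x = (\<Oplus>\<^bsub>QG\<^esub>B'\<in>\<B>. r B')"
      using cB xc ideal.I_r_closed[OF idl] by (auto simp: r_def)
    then have "r = s" using uniq[OF xc] s by blast
    then have "r B = s B" by simp
    then show "c B \<otimes>\<^bsub>QG\<^esub> x = x" using B by (simp add: r_def s_def)
  qed
  define d where "d = unr (c B)"
  have cd: "c B = res d" using cB[OF B] by (simp add: d_def)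
  have dg: "d \<in> galg" by (simp add: d_def)
  have dB: "res d \<in> B" using cB[OF B] cd by simp
  have idd: "x \<star> d = x" "d \<star> x = x" if x: "x \<in> galg" "res x \<in> B" for x
    using id[OF x(2)] x(1) res_inj dg by (auto simp: cd QG_ops res_inj)
  have dd: "d \<star> d = d" using idd dg dB by blast
  have idB: "res (a \<star> d) \<in> B" "res (d \<star> a) \<in> B" if "a \<in> galg" for a
    using ideal.I_l_closed[OF idl[OF B] dB, of "res a"] ideal.I_r_closed[OF idl[OF B] dB, of "res a"] that
    by (auto simp: QG_ops QG_carrier)
  have dz: "d \<in> zalg"
  proof (rule zalgI[OF dg])
    fix a :: "'a \<Rightarrow> rat" assume a: "a \<in> galg"
    have "d \<star> a = d \<star> a \<star> d" using idd(1)[OF _ idB(2)[OF a]] by simp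
    also have "\<dots> = a \<star> d" using idd(2)[OF _ idB(1)[OF a]] by (simp add: conv_assoc)
    finally show "d \<star> a = a \<star> d" .
  qed
  have Bd: "B = component d"
  proof (intro equalityI subsetI)
    fix r assume r: "r \<in> B"
    then obtain x where x: "x \<in> galg" "r = res x" using sub[OF r B] by (auto simp: QG_carrier)
    then show "r \<in> component d" using idd[OF x(1)] r by (auto simp: component_def corner_def)
  next
    fix r assume "r \<in> component d"
    then obtain x where "x \<in> galg" "x \<star> d = x" "r = res x" by (auto simp: component_def corner_def)
    then show "r \<in> B" using idB(1) by force
  qed
  obtain n D where n: "n \<ge> 1" and D: "is_division_ring (D :: ('a \<Rightarrow> rat) ring)"
    and iso: "component_ring QG B \<simeq> matrix_ring n D"
    using wd B by (auto simp: wedderburn_decomposition_def)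
  obtain \<phi> where \<phi>: "\<phi> \<in> ring_iso (corner_ring d) (matrix_ring n D)"
    using iso unfolding Bd component_ring_corner[OF dd] by (auto simp: is_ring_iso_def)
  interpret D: ring D using D by (simp add: is_division_ring_def)
  have D1: "\<one>\<^bsub>D\<^esub> \<noteq> \<zero>\<^bsub>D\<^esub>" using D by (simp add: is_division_ring_def)
  \<comment> \<open>The equation \<open>\<phi> 0 = \<phi> 0 + \<phi> 0\<close> is cancelled
    entrywise in \<open>D\<close>.\<close>
  have \<phi>0: "\<phi> (res 0) = \<zero>\<^bsub>matrix_ring n D\<^esub>"
  proof -
    have m: "\<phi> (res 0) \<in> {..<n} \<times> {..<n} \<rightarrow>\<^sub>E carrier D"
      using ring_iso_memE(1)[OF \<phi>, of "res 0"] corner_closed(4)[of d] by (simp add: corner_ring_simps matrix_ring_def)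
    have a: "\<phi> (res 0) = \<phi> (res 0) \<oplus>\<^bsub>matrix_ring n D\<^esub> \<phi> (res 0)"
      using ring_iso_memE(3)[OF \<phi>, of "res 0" "res 0"] corner_closed(4)[of d] by (simp add: corner_ring_simps)
    show ?thesis
    proof (rule PiE_ext[OF m])
      show "\<zero>\<^bsub>matrix_ring n D\<^esub> \<in> {..<n} \<times> {..<n} \<rightarrow>\<^sub>E carrier D" by (auto simp: matrix_ring_def)
      fix ij assume ij: "ij \<in> {..<n} \<times> {..<n}"
      have "\<phi> (res 0) ij = \<phi> (res 0) ij \<oplus>\<^bsub>D\<^esub> \<phi> (res 0) ij"
        using fun_cong[OF a, of ij] ij by (simp add: matrix_ring_def)
      then show "\<phi> (res 0) ij = \<zero>\<^bsub>matrix_ring n D\<^esub> ij"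
        using PiE_mem[OF m ij] ij D.add.l_cancel_one' by (simp add: matrix_ring_def)
    qed
  qed
  have d_cor: "d \<in> corner d" by (rule corner_closed(5)[OF dd])
  have \<phi>1: "\<phi> (res d) = \<one>\<^bsub>matrix_ring n D\<^esub>" using ring_iso_memE(4)[OF \<phi>] by (simp add: corner_ring_simps)
  have \<phi>inj: "x = y" if "x \<in> corner d" "y \<in> corner d" "\<phi> (res x) = \<phi> (res y)" for x y
    using ring_iso_memE(5)[OF \<phi>] that res_inj corner_galg
    by (auto simp: bij_betw_def corner_ring_simps inj_on_def)
  have "d \<noteq> 0"
  proof
    assume "d = 0"
    then have "\<one>\<^bsub>matrix_ring n D\<^esub> (0, 0) = \<zero>\<^bsub>matrix_ring n D\<^esub> (0, 0)" using \<phi>0 \<phi>1 by simp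
    then show False using n D1 by (simp add: matrix_ring_def)
  qed
  moreover have "f = 0 \<or> f = d" if f: "f \<in> zalg" "f \<star> f = f" "f \<star> d = f" for f
  proof -
    have fc: "f \<in> corner d" using f dz by (simp add: corner_central zalg_galg)
    have "\<phi> (res f) = \<zero>\<^bsub>matrix_ring n D\<^esub> \<or> \<phi> (res f) = \<one>\<^bsub>matrix_ring n D\<^esub>"
    proof (rule matrix_central_idempotent[OF D])
      show "\<phi> (res f) \<in> carrier (matrix_ring n D)" using ring_iso_memE(1)[OF \<phi>] fc by (simp add: corner_ring_simps)
      show "\<phi> (res f) \<otimes>\<^bsub>matrix_ring n D\<^esub> \<phi> (res f) = \<phi> (res f)"
        using ring_iso_memE(2)[OF \<phi>, of "res f" "res f"] fc f(2) by (simp add: corner_ring_simps)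
      fix N assume "N \<in> carrier (matrix_ring n D)"
      then obtain x where x: "x \<in> corner d" "N = \<phi> (res x)"
        using ring_iso_memE(5)[OF \<phi>] by (force simp: bij_betw_def corner_ring_simps)
      show "\<phi> (res f) \<otimes>\<^bsub>matrix_ring n D\<^esub> N = N \<otimes>\<^bsub>matrix_ring n D\<^esub> \<phi> (res f)"
        unfolding x(2)
        using ring_iso_memE(2)[OF \<phi>, of "res f" "res x"] ring_iso_memE(2)[OF \<phi>, of "res x" "res f"] fc x(1)
          zalg_commute[OF f(1), of x]
        by (simp add: corner_ring_simps)
    qed
    then show ?thesis
      using \<phi>inj[OF fc corner_closed(4)] \<phi>inj[OF fc d_cor] unfolding \<phi>0 \<phi>1 by blast
  qed
  ultimately have "d \<in> PCI" using dz dd by (auto simp: PCI_def)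
  then show ?thesis using Bd by blast
qed

lemma simple_components_QG: "simple_components QG = component ` PCI"
  using wedderburn_QG wedderburn_component by (auto simp: simple_components_def)

section \<open>The centres of the simple components\<close>

definition zcorner :: "('a \<Rightarrow> rat) \<Rightarrow> ('a \<Rightarrow> rat) set" where
  "zcorner e = {x \<in> zalg. x \<star> e = x}"

abbreviation ctr :: "('a \<Rightarrow> rat) \<Rightarrow> ('a \<Rightarrow> rat) ring" where
  "ctr e \<equiv> centre (component_ring QG (component e))"

lemma zcorner_zalg: "x \<in> zcorner e \<Longrightarrow> x \<in> zalg" and zcorner_galg: "x \<in> zcorner e \<Longrightarrow> x \<in> galg"
  and zcorner_id: "x \<in> zcorner e \<Longrightarrow> x \<star> e = x"
  by (auto simp: zcorner_def zalg_galg)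

lemma zcorner_closed:
  assumes "e \<in> PCI"
  shows "x \<in> zcorner e \<Longrightarrow> y \<in> zcorner e \<Longrightarrow> x + y \<in> zcorner e" "x \<in> zcorner e \<Longrightarrow> y \<in> zcorner e \<Longrightarrow> x - y \<in> zcorner e"
    "x \<in> zcorner e \<Longrightarrow> - x \<in> zcorner e" "x \<in> zcorner e \<Longrightarrow> fscale q x \<in> zcorner e"
    "x \<in> zcorner e \<Longrightarrow> y \<in> zcorner e \<Longrightarrow> x \<star> y \<in> zcorner e" "0 \<in> zcorner e" "e \<in> zcorner e"
    "x \<in> zalg \<Longrightarrow> x \<star> e \<in> zcorner e"
  using PCI_D[OF assms] by (auto simp: zcorner_def conv_distribs conv_scale_left conv_assoc)

text \<open>The centre of the component lies in the centre of the whole algebra: a \<open>z\<close>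
  fixed by \<open>e\<close> sees only the part \<open>h \<star> e\<close> of any \<open>h\<close>,
  and this part lies in the component.\<close>

lemma ctr_simps:
  assumes "e \<in> PCI"
  shows "carrier (ctr e) = res ` zcorner e" "\<one>\<^bsub>ctr e\<^esub> = res e" "\<zero>\<^bsub>ctr e\<^esub> = res 0"
    "res x \<otimes>\<^bsub>ctr e\<^esub> res y = res (x \<star> y)" "res x \<oplus>\<^bsub>ctr e\<^esub> res y = res (x + y)"
proof -
  have ee: "e \<star> e = e" "e \<in> zalg" using PCI_D[OF assms] by auto
  show "carrier (ctr e) = res ` zcorner e"
  proof (intro equalityI subsetI)
    fix r assume "r \<in> carrier (ctr e)"
    then obtain z where z: "z \<in> corner e" "r = res z"
      and c: "\<And>x. x \<in> corner e \<Longrightarrow> res z \<otimes>\<^bsub>corner_ring e\<^esub> res x = res x \<otimes>\<^bsub>corner_ring e\<^esub> res z"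
      by (auto simp: centre_def component_ring_corner[OF ee(1)] corner_ring_simps)
    have ze: "z \<star> e = z" "e \<star> z = z" using z(1) by (auto simp: corner_def)
    have "z \<in> zalg"
    proof (rule zalgI[OF corner_galg[OF z(1)]])
      fix h :: "'a \<Rightarrow> rat" assume h: "h \<in> galg"
      have hc: "h \<star> e \<in> corner e" using ee by (simp add: corner_central conv_assoc)
      have "z \<star> h = z \<star> (e \<star> h)" using ze(1) conv_assoc[of z e h] by simp
      also have "\<dots> = z \<star> (h \<star> e)" using zalg_commute[OF ee(2), of h] by simp
      also have "\<dots> = (h \<star> e) \<star> z" using c[OF hc] res_injD[of "z \<star> (h \<star> e)" "(h \<star> e) \<star> z"] by (simp add: corner_ring_simps)
      also have "\<dots> = h \<star> z" using ze(2) by (simp add: conv_assoc)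
      finally show "z \<star> h = h \<star> z" .
    qed
    then show "r \<in> res ` zcorner e" using z(2) ze by (auto simp: zcorner_def)
  next
    fix r assume "r \<in> res ` zcorner e"
    then obtain z where z: "z \<in> zcorner e" "r = res z" by blast
    then have "z \<in> corner e" by (auto simp: corner_central[OF ee(2)] zcorner_def zalg_galg)
    moreover have "res z \<otimes>\<^bsub>corner_ring e\<^esub> res x = res x \<otimes>\<^bsub>corner_ring e\<^esub> res z" for x
      using zalg_commute[OF zcorner_zalg[OF z(1)], of x] by (simp add: corner_ring_simps)
    ultimately show "r \<in> carrier (ctr e)"
      using z(2) by (auto simp: centre_def component_ring_corner[OF ee(1)] corner_ring_simps)
  qed
qed (simp_all add: centre_def component_ring_corner[OF PCI_D(2)[OF assms]] corner_ring_simps)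

lemma field_ctr:
  assumes e: "e \<in> PCI"
  shows "field (ctr e)"
proof -
  note [simp] = ctr_simps[OF e] and cl = zcorner_closed[OF e]
  have ez: "e \<star> x = x" if "x \<in> zcorner e" for x using zcorner_id[OF that] zalg_commute[OF PCI_D(1)[OF e], of x] by simp
  interpret cring "ctr e"
  proof (rule cringI)
    show "abelian_group (ctr e)"
    proof (rule abelian_groupI)
      fix x assume "x \<in> carrier (ctr e)"
      then obtain z where "z \<in> zcorner e" "x = res z" by auto
      then show "\<exists>y\<in>carrier (ctr e). y \<oplus>\<^bsub>ctr e\<^esub> x = \<zero>\<^bsub>ctr e\<^esub>" using cl(3) by (intro bexI[of _ "res (- z)"]) auto
    qed (auto simp: cl add_ac)
    show "comm_monoid (ctr e)"
    proof (rule comm_monoidI)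
      fix x y assume "x \<in> carrier (ctr e)" "y \<in> carrier (ctr e)"
      then obtain z w where "z \<in> zcorner e" "x = res z" "w \<in> zcorner e" "y = res w" by auto
      then show "x \<otimes>\<^bsub>ctr e\<^esub> y = y \<otimes>\<^bsub>ctr e\<^esub> x" using zalg_commute[OF zcorner_zalg, of z e w] by simp
    qed (auto simp: cl conv_assoc ez)
  qed (auto simp: conv_distribs)
  show ?thesis
  proof (rule cring_fieldI2)
    show "\<zero>\<^bsub>ctr e\<^esub> \<noteq> \<one>\<^bsub>ctr e\<^esub>" using PCI_D[OF e] res_injD[of 0 e] by auto
    fix a assume "a \<in> carrier (ctr e)" "a \<noteq> \<zero>\<^bsub>ctr e\<^esub>"
    then obtain y where y: "y \<in> zcorner e" "a = res y" "y \<noteq> 0" by auto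
    obtain b where b: "b \<in> zalg" "b \<star> e = b" "b \<star> y = e"
      using Q.PCI_inverse[OF e zcorner_zalg[OF y(1)] zcorner_id[OF y(1)] y(3)] .
    have "y \<star> b = e" using b(3) zalg_commute[OF zcorner_zalg[OF y(1)]] by simp
    then show "\<exists>b\<in>carrier (ctr e). a \<otimes>\<^bsub>ctr e\<^esub> b = \<one>\<^bsub>ctr e\<^esub>"
      using b y by (intro bexI[of _ "res b"]) (auto simp: zcorner_def)
  qed
qed

section \<open>Embeddings, prime field and degree of the centres\<close>

lemma zcorner_K: "e \<in> PCI \<Longrightarrow> x \<in> zcorner e \<Longrightarrow> rc x \<in> K (rc e)"
  using zcorner_zalg[of x e] zcorner_id[of x e] rc_conv[of x e] by (auto simp: K_def rz_iff)

lemma K_zcorner: "x \<in> K (rc e) \<Longrightarrow> \<exists>y\<in>zcorner e. x = rc y"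
proof -
  assume x: "x \<in> K (rc e)"
  then obtain y where y: "y \<in> zalg" "x = rc y" by (auto simp: K_def rz_iff)
  then have "rc (y \<star> e) = rc y" using x by (simp add: K_def rc_conv)
  then show ?thesis using y by (auto simp: zcorner_def)
qed

lemma rc_EQ: "e \<in> PCI \<Longrightarrow> rc e \<in> EQ"
  by (simp add: EQ_def)

lemma J_ext:
  assumes "e \<in> PCI" "v \<in> J (rc e)" "w \<in> J (rc e)" "\<And>x. x \<in> zcorner e \<Longrightarrow> lam v (rc x) = lam w (rc x)"
  shows "v = w"
  by (rule J_separates[OF rc_EQ[OF assms(1)] assms(2,3)]) (use K_zcorner assms(4) in blast)

text \<open>Additivity alone forces linearity over the rationals when the target has characteristic
  0.\<close>

lemma hom_scale:
  fixes \<phi> :: "('a \<Rightarrow> rat) \<Rightarrow> 'k::field_char_0"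
  assumes e: "e \<in> PCI" and \<phi>: "\<phi> \<in> Ring.ring_hom (ctr e) ring_of_type_algebra" and x: "x \<in> zcorner e"
  shows "\<phi> (res (fscale q x)) = of_rat q * \<phi> (res x)"
proof -
  have cl: "fscale q x \<in> zcorner e" for q using zcorner_closed(4)[OF e x] .
  define g where "g q = \<phi> (res (fscale q x))" for q
  have add: "g (p + q) = g p + g q" for p q
    using ring_hom_memE(3)[OF \<phi>, of "res (fscale p x)" "res (fscale q x)"] cl
    by (simp add: ctr_simps[OF e] g_def fvs.scale_left_distrib)
  have g0: "g 0 = 0" using add[of 0 0] by simp
  have n: "g (of_nat n * q) = of_nat n * g q" for n q
    by (induction n) (auto simp: g0 add algebra_simps)
  have i: "g (of_int i * q) = of_int i * g q" for i q
  proof (cases i rule: int_cases2)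
    case (nonpos k)
    have "g (- (of_nat k * q)) = - (of_nat k * g q)"
      using n[of k q] add[of "of_nat k * q" "- (of_nat k * q)"] g0 by (simp add: eq_neg_iff_add_eq_0 add.commute)
    then show ?thesis using nonpos by simp
  qed (use n in simp)
  obtain a b where ab: "quotient_of q = (a, b)" by (cases "quotient_of q")
  have b: "b > 0" using quotient_of_denom_pos[OF ab] .
  have q: "q = of_int a / of_int b" using quotient_of_div[OF ab] .
  have bq: "of_int b * q = of_int a * 1" using b by (simp add: q)
  have "of_int b * g q = of_int a * g 1" using i[of b q] i[of a 1] unfolding bq by simp
  then have "g q = of_rat q * g 1" using b by (simp add: q of_rat_divide field_simps)
  then show ?thesis by (simp add: g_def fvs.scale_one)
qed

lemma emb_hom:
  assumes e: "e \<in> PCI" and v: "v \<in> J (rc e)"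
  shows "(\<lambda>r. lam v (rc (unr r))) \<in> Ring.ring_hom (ctr e) complex_ring"
proof (rule ring_hom_memI)
  note vP = J_PCI[OF v]
  fix r s assume "r \<in> carrier (ctr e)" "s \<in> carrier (ctr e)"
  then obtain x y where xy: "x \<in> zcorner e" "r = res x" "y \<in> zcorner e" "s = res y" by (auto simp: ctr_simps[OF e])
  have g: "x \<in> zalg" "y \<in> zalg" "x \<in> galg" "y \<in> galg" using xy zcorner_zalg zcorner_galg by auto
  show "lam v (rc (unr (r \<otimes>\<^bsub>ctr e\<^esub> s))) = lam v (rc (unr r)) \<otimes>\<^bsub>complex_ring\<^esub> lam v (rc (unr s))"
    using g vP by (simp add: xy ctr_simps[OF e] rc_conv lam_mult)
  show "lam v (rc (unr (r \<oplus>\<^bsub>ctr e\<^esub> s))) = lam v (rc (unr r)) \<oplus>\<^bsub>complex_ring\<^esub> lam v (rc (unr s))"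
    using g vP by (simp add: xy ctr_simps[OF e] rc_add lam_add)
next
  show "lam v (rc (unr \<one>\<^bsub>ctr e\<^esub>)) = \<one>\<^bsub>complex_ring\<^esub>"
    using PCI_D[OF e] lam_J[OF rc_EQ[OF e] v] by (simp add: ctr_simps[OF e])
qed simp

text \<open>A homomorphism from the centre of a component to \<open>\<complex>\<close> extends \<open>\<complex>\<close>-linearly to a character of
  \<open>Z(\<complex>G)\<close>.\<close>

lemma hom_is_emb:
  assumes e: "e \<in> PCI" and \<phi>: "\<phi> \<in> Ring.ring_hom (ctr e) complex_ring"
  obtains v where "v \<in> J (rc e)" "\<And>x. x \<in> zcorner e \<Longrightarrow> \<phi> (res x) = lam v (rc x)"
proof -
  note cl = zcorner_closed[OF e]
  define h where "h x = \<phi> (res (x \<star> e))" for x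
  have hadd: "h (x + y) = h x + h y" if "x \<in> zalg" "y \<in> zalg" for x y
    using ring_hom_memE(3)[OF \<phi>, of "res (x \<star> e)" "res (y \<star> e)"] cl(8) that
    by (simp add: h_def ctr_simps[OF e] conv_add_left)
  have hscale: "h (fscale q x) = of_rat q * h x" if "x \<in> zalg" for q x
    using hom_scale[OF e \<phi> cl(8)[OF that]] by (simp add: h_def conv_scale_left)
  have h0: "h 0 = 0" using hscale[of 0 0] by simp
  have hsum: "h (\<Sum>i\<in>I. f i) = (\<Sum>i\<in>I. h (f i))" if "\<And>i. i \<in> I \<Longrightarrow> f i \<in> zalg" for f and I :: "'a set set"
    using that by (induction I rule: infinite_finite_induct) (auto simp: h0 hadd zalg_sum)
  have hmult: "h (x \<star> y) = h x * h y" if "x \<in> zalg" "y \<in> zalg" for x y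
  proof -
    have "(x \<star> e) \<star> (y \<star> e) = x \<star> y \<star> e"
      using zalg_commute[OF PCI_D(1)[OF e], of "y \<star> e"] PCI_D(2)[OF e] by (simp add: conv_assoc)
    then show ?thesis
      using ring_hom_memE(2)[OF \<phi>, of "res (x \<star> e)" "res (y \<star> e)"] cl(8) that
      by (simp add: h_def ctr_simps[OF e])
  qed
  \<comment> \<open>The complex-linear extension of \<open>h\<close>, defined through the
    coordinates \<open>z (crep C)\<close> in the basis of class sums.\<close>
  define \<psi> where "\<psi> z = (\<Sum>C\<in>CC. z (crep C) * h (ind C))" for z
  have \<psi>add: "\<psi> (\<Sum>i\<in>I. f i) = (\<Sum>i\<in>I. \<psi> (f i))" for f and I :: "'i set"
    unfolding \<psi>_def sum_fun_apply sum_distrib_right by (rule sum.swap)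
  have \<psi>scale: "\<psi> (fscale c z) = c * \<psi> z" for c z
    by (simp add: \<psi>_def fscale_apply sum_distrib_left mult.assoc)
  have \<psi>rc: "\<psi> (rc x) = h x" if "x \<in> zalg" for x
  proof -
    have "h x = h (\<Sum>C\<in>CC. fscale (x (crep C)) (ind C))" using zalg_ind_expand[OF that] by simp
    also have "\<dots> = (\<Sum>C\<in>CC. of_rat (x (crep C)) * h (ind C))" by (subst hsum) (auto simp: hscale)
    finally show ?thesis by (simp add: \<psi>_def rc_def)
  qed
  have \<psi>mult: "\<psi> (z \<star> w) = \<psi> z * \<psi> w" if z: "z \<in> zalg" and w: "w \<in> zalg" for z w
  proof -
    have "z \<star> w = (\<Sum>C\<in>CC. fscale (z (crep C)) (ind C)) \<star> (\<Sum>D\<in>CC. fscale (w (crep D)) (ind D))"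
      using zalg_ind_expand[OF z] zalg_ind_expand[OF w] by simp
    also have "\<dots> = (\<Sum>C\<in>CC. \<Sum>D\<in>CC. fscale (z (crep C)) (fscale (w (crep D)) (rc (ind C \<star> ind D))))"
      by (simp only: conv_sum_left conv_scale_left conv_sum_right conv_scale_right rc_conv rc_ind fvs.scale_sum_right)
        (subst sum.swap, intro sum.cong refl, rule fvs.scale_left_commute)
    finally have "\<psi> (z \<star> w) = (\<Sum>C\<in>CC. \<Sum>D\<in>CC. z (crep C) * (w (crep D) * h (ind C \<star> ind D)))"
      by (simp only: \<psi>add \<psi>scale) (auto intro!: sum.cong simp: \<psi>rc)
    also have "\<dots> = (\<Sum>C\<in>CC. \<Sum>D\<in>CC. (z (crep C) * h (ind C)) * (w (crep D) * h (ind D)))"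
      by (intro sum.cong refl) (simp add: hmult)
    also have "\<dots> = \<psi> z * \<psi> w" by (simp add: \<psi>_def sum_product)
    finally show ?thesis .
  qed
  have he: "h e = 1" "h e1 = 1"
    using ring_hom_memE(4)[OF \<phi>] PCI_D[OF e] by (simp_all add: h_def ctr_simps[OF e])
  \<comment> \<open>As \<psi> sends 1 to 1, it is nonzero at some primitive idempotent
    \<open>v\<close>, where its value is idempotent, hence 1. Then
    \<open>\<psi> z = \<psi> (z \<star> v) = lam v z\<close>.\<close>
  have "(\<Sum>v\<in>PCI. \<psi> v) = \<psi> (rc e1)" by (simp add: \<psi>add[symmetric] PCI_sum)
  also have "\<dots> = 1" by (subst \<psi>rc) (simp_all add: he)
  finally obtain v where v: "v \<in> PCI" "\<psi> v \<noteq> 0" by (metis sum.neutral zero_neq_one)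
  have "\<psi> v * \<psi> v = \<psi> v" using \<psi>mult[of v v] PCI_D[OF v(1)] by simp
  then have v1: "\<psi> v = 1" using v(2) by simp
  have \<psi>lam: "\<psi> z = lam v z" if "z \<in> zalg" for z
    using \<psi>mult[OF that PCI_D(1)[OF v(1)]] lam[OF v(1) that] v1 by (simp add: \<psi>scale)
  have "lam v (rc e) = 1" using \<psi>lam[of "rc e"] \<psi>rc[of e] PCI_D(1)[OF e] he by simp
  then have "v \<in> J (rc e)" using lam_EQ[OF rc_EQ[OF e] v(1)] by (simp split: if_splits)
  moreover have "\<phi> (res x) = lam v (rc x)" if "x \<in> zcorner e" for x
    using \<psi>lam[of "rc x"] \<psi>rc[of x] zcorner_zalg[OF that] zcorner_id[OF that] by (simp add: h_def)
  ultimately show ?thesis by (rule that)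
qed

text \<open>A real embedding, viewed as a complex one, is some \<open>lam v\<close> by
  \<open>hom_is_emb\<close>. Its values are fixed by conjugation, so \<open>v\<close> and
  \<open>bar v\<close> agree on the field and coincide.\<close>

lemma real_embedding_iff:
  assumes e: "e \<in> PCI"
  shows "has_real_embedding (ctr e) \<longleftrightarrow> (\<exists>v\<in>J (rc e). bar v = v)"
proof
  assume "has_real_embedding (ctr e)"
  then obtain \<phi> where \<phi>: "\<phi> \<in> Ring.ring_hom (ctr e) real_ring" by (auto simp: has_real_embedding_def)
  have "(\<lambda>r. of_real (\<phi> r)) \<in> Ring.ring_hom (ctr e) complex_ring"
    by (rule ring_hom_memI)
      (simp_all add: ring_hom_memE(2)[OF \<phi>] ring_hom_memE(3)[OF \<phi>] ring_hom_memE(4)[OF \<phi>])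
  then obtain v where v: "v \<in> J (rc e)" "\<And>x. x \<in> zcorner e \<Longrightarrow> complex_of_real (\<phi> (res x)) = lam v (rc x)"
    using hom_is_emb[OF e] by blast
  have "bar v = v"
  proof (rule J_ext[OF e bar_J[OF rc_EQ[OF e] v(1)] v(1)])
    fix x assume x: "x \<in> zcorner e"
    have "lam (bar v) (rc x) = cnj (lam v (rc x))"
      using lam_bar_rz[OF J_PCI[OF v(1)] K_rz[OF zcorner_K[OF e x]]] .
    then show "lam (bar v) (rc x) = lam v (rc x)" using v(2)[OF x] by (metis complex_cnj_complex_of_real)
  qed
  then show "\<exists>v\<in>J (rc e). bar v = v" using v(1) by blast
next
  assume "\<exists>v\<in>J (rc e). bar v = v"
  then obtain v where v: "v \<in> J (rc e)" "bar v = v" by blast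
  define \<phi> where "\<phi> r = lam v (rc (unr r))" for r
  have \<phi>: "\<phi> \<in> Ring.ring_hom (ctr e) complex_ring" using emb_hom[OF e v(1)] by (simp add: \<phi>_def[abs_def])
  have Im: "Im (\<phi> r) = 0" if r: "r \<in> carrier (ctr e)" for r
  proof -
    obtain x where x: "x \<in> zcorner e" "r = res x" using r by (auto simp: ctr_simps[OF e])
    have "\<phi> r = cnj (\<phi> r)"
      using lam_bar_rz[OF J_PCI[OF v(1)] K_rz[OF zcorner_K[OF e x(1)]]] v(2) zcorner_galg[OF x(1)] by (simp add: \<phi>_def x(2))
    then show ?thesis by (metis Reals_cnj_iff complex_is_Real_iff)
  qed
  have "(\<lambda>r. Re (\<phi> r)) \<in> Ring.ring_hom (ctr e) real_ring"
    by (rule ring_hom_memI)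
      (simp_all add: ring_hom_memE(2)[OF \<phi>] ring_hom_memE(3)[OF \<phi>] ring_hom_memE(4)[OF \<phi>] Im)
  then show "has_real_embedding (ctr e)" by (auto simp: has_real_embedding_def)
qed

lemma prime_field_ctr:
  assumes e: "e \<in> PCI"
  shows "generate_field (ctr e) {} = res ` range (\<lambda>q. fscale q e)"
proof -
  interpret R: field "ctr e" by (rule field_ctr[OF e])
  note [simp] = ctr_simps[OF e]
  have ez: "fscale q e \<in> zcorner e" for q using zcorner_closed(4,7)[OF e] by blast
  have ee: "fscale p e \<star> fscale q e = fscale (p * q) e" for p q
    by (simp add: conv_scale_left conv_scale_right PCI_D(2)[OF e])
  have neg: "\<ominus>\<^bsub>ctr e\<^esub> res (fscale q e) = res (fscale (- q) e)" for q
    by (rule R.minus_equality)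
      (use ez in \<open>auto simp: fvs.scale_left_distrib[symmetric] fvs.scale_zero_left simp del: fvs.scale_minus_left\<close>)
  have inv: "inv\<^bsub>ctr e\<^esub> res (fscale q e) = res (fscale (1 / q) e)" if "q \<noteq> 0" for q
    using ez that by (intro R.comm_inv_char) (auto simp: ee fvs.scale_one)
  have nz: "res (fscale q e) \<noteq> \<zero>\<^bsub>ctr e\<^esub>" if "q \<noteq> 0" for q
    using res_injD[of "fscale q e" 0] that PCI_D[OF e] by (auto simp: fvs.scale_eq_0_iff)
  show ?thesis
  proof (intro equalityI subsetI)
    fix r assume "r \<in> generate_field (ctr e) {}"
    then show "r \<in> res ` range (\<lambda>q. fscale q e)"
    proof induction
      case one
      show ?case by (auto intro!: image_eqI[where x = 1] simp: fvs.scale_one image_image)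
    next
      case (a_inv h)
      then obtain q where "h = res (fscale q e)" by auto
      then have h: "\<ominus>\<^bsub>ctr e\<^esub> h = res (fscale (- q) e)" using neg by (simp only:)
      show ?case unfolding h by (rule imageI) (rule rangeI)
    next
      case (m_inv h)
      then obtain q where q: "h = res (fscale q e)" by auto
      then have "q \<noteq> 0" using m_inv(2) by (auto simp: fvs.scale_zero_left)
      then show ?case using inv q by auto
    next
      case (eng_add h1 h2)
      then obtain p q where "h1 = res (fscale p e)" "h2 = res (fscale q e)" by auto
      then show ?case by (auto simp: fvs.scale_left_distrib[symmetric])
    next
      case (eng_mult h1 h2)
      then obtain p q where "h1 = res (fscale p e)" "h2 = res (fscale q e)" by auto
      then show ?case by (auto simp: ee)
    qed auto
  next
    fix r assume "r \<in> res ` range (\<lambda>q. fscale q e)"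
    then obtain q where r: "r = res (fscale q e)" by auto
    have one: "res (fscale 1 e) \<in> generate_field (ctr e) {}"
      using generate_field.one[of "ctr e" "{}"] by (simp add: fvs.scale_one)
    have zero: "res (fscale 0 e) \<in> generate_field (ctr e) {}"
      using R.zero_in_generate[of "{}"] by (simp add: fvs.scale_zero_left)
    have add: "res (fscale (p + q) e) \<in> generate_field (ctr e) {}"
      if "res (fscale p e) \<in> generate_field (ctr e) {}" "res (fscale q e) \<in> generate_field (ctr e) {}" for p q
      using generate_field.eng_add[OF that] by (simp add: fvs.scale_left_distrib)
    have nat: "res (fscale (of_nat n) e) \<in> generate_field (ctr e) {}" for n
    proof (induction n)
      case (Suc n)
      then show ?case using add[OF one, of "of_nat n"] by simp
    qed (simp only: of_nat_0 zero)
    have int: "res (fscale (of_int i) e) \<in> generate_field (ctr e) {}" for i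
      by (cases i rule: int_cases2) (use nat generate_field.a_inv[OF nat] in \<open>auto simp: neg\<close>)
    obtain a b where ab: "quotient_of q = (a, b)" by (cases "quotient_of q")
    have b: "b > 0" using quotient_of_denom_pos[OF ab] .
    have "res (fscale (1 / of_int b) e) \<in> generate_field (ctr e) {}"
      using generate_field.m_inv[OF int[of b]] nz[of "of_int b"] inv[of "of_int b"] b by simp
    from generate_field.eng_mult[OF int[of a] this] show "r \<in> generate_field (ctr e) {}"
      by (simp add: ee r quotient_of_div[OF ab])
  qed
qed

text \<open>The prime field consists of the rational multiples of \<open>e\<close>, so its scalars
  act like \<open>fscale\<close>. The dimension is built up by adjoining the vectors of
  \<open>rational_basis\<close> one at a time.\<close>

lemma degree_iff:
  assumes e: "e \<in> PCI"
  shows "degree_over_Q (ctr e) n \<longleftrightarrow> n = card (J (rc e))"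
proof -
  interpret R: field "ctr e" by (rule field_ctr[OF e])
  note [simp] = ctr_simps[OF e]
  define F where "F = generate_field (ctr e) {}"
  have F: "F = res ` range (\<lambda>q. fscale q e)" unfolding F_def by (rule prime_field_ctr[OF e])
  have sF: "subfield F (ctr e)" unfolding F_def by (rule R.generate_field_is_subfield) simp
  obtain B where B: "Q.orth_set B" "B \<subseteq> {x \<in> zalg. x \<star> e = x}"
    "\<And>v. v \<in> zalg \<Longrightarrow> v \<star> e = v \<Longrightarrow> v = Q.proj B v" "card B = card (J (rc e))"
    by (rule rational_basis[OF e]) blast
  have ind: "fvs.independent B" by (rule Q.orth_set_independent[OF B(1)])
  have fB: "finite B" using B(1) by (simp add: Q.orth_set_def)
  have sub: "fvs.span B' \<subseteq> zcorner e" if "B' \<subseteq> B" for B'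
    by (rule fvs.span_minimal)
      (use that B(2) zcorner_closed[OF e] in \<open>auto simp: zcorner_def intro!: fvs.subspaceI\<close>)
  have dim: "R.dimension (card B') F (res ` fvs.span B')" if "B' \<subseteq> B" for B'
    using finite_subset[OF that fB] that
  proof (induction B' rule: finite_induct)
    case empty
    show ?case
      using R.zero_dim[of F] by (simp only: ctr_simps[OF e] card.empty fvs.span_empty image_insert image_empty)
  next
    case (insert b B')
    have b: "b \<in> zcorner e" "b \<star> e = b" "e \<star> b = b"
      using insert(4) B(2) zalg_commute[OF PCI_D(1)[OF e], of b] by (auto simp: zcorner_def)
    have "b \<notin> fvs.span B'"
    proof
      assume "b \<in> fvs.span B'"
      then have "b \<in> fvs.span (B - {b})" using fvs.span_mono[of B' "B - {b}"] insert(2,4) by blast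
      then show False using ind insert(4) unfolding fvs.dependent_def by blast
    qed
    have nb: "res b \<notin> res ` fvs.span B'"
    proof
      assume "res b \<in> res ` fvs.span B'"
      then obtain s where s: "s \<in> fvs.span B'" "res b = res s" by blast
      then have "s \<in> zcorner e" using sub[of B'] insert(4) by blast
      then have "b = s" using res_injD[OF zcorner_galg zcorner_galg] b(1) s(2) by blast
      then show False using s(1) \<open>b \<notin> fvs.span B'\<close> by simp
    qed
    have "R.line_extension F (res b) (res ` fvs.span B') = res ` fvs.span (insert b B')"
    proof (intro equalityI subsetI)
      fix r assume "r \<in> R.line_extension F (res b) (res ` fvs.span B')"
      then obtain q s where "s \<in> fvs.span B'" "r = res (fscale q e \<star> b + s)"
        unfolding R.line_extension_def by (auto simp: set_add_def set_mult_def r_coset_def F)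
      then show "r \<in> res ` fvs.span (insert b B')"
        by (intro image_eqI[where x = "fscale q b + s"]) (auto simp: conv_scale_left b fvs.span_breakdown_eq intro!: exI[of _ q])
    next
      fix r assume "r \<in> res ` fvs.span (insert b B')"
      then obtain x q where x: "r = res x" "x - fscale q b \<in> fvs.span B'" by (auto simp: fvs.span_breakdown_eq)
      have "r = res (fscale q e) \<otimes>\<^bsub>ctr e\<^esub> res b \<oplus>\<^bsub>ctr e\<^esub> res (x - fscale q b)"
        by (simp add: conv_scale_left b x(1))
      then show "r \<in> R.line_extension F (res b) (res ` fvs.span B')"
        unfolding R.line_extension_def set_add_def set_mult_def r_coset_def F using x(2) by fastforce
    qed
    moreover have "R.dimension (Suc (card B')) F (R.line_extension F (res b) (res ` fvs.span B'))"
      using insert nb b(1) by (intro R.Suc_dim) auto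
    ultimately show ?case using insert(1,2) by simp
  qed
  have "zcorner e \<subseteq> fvs.span B"
  proof
    fix x assume "x \<in> zcorner e"
    then have "x = Q.proj B x" using B(3) by (simp add: zcorner_def)
    also have "\<dots> \<in> fvs.span B" unfolding Q.proj_def by (intro fvs.span_sum fvs.span_scale fvs.span_base)
    finally show "x \<in> fvs.span B" .
  qed
  then have "res ` fvs.span B = carrier (ctr e)" using sub[of B] by auto
  then have "R.dimension (card (J (rc e))) F (carrier (ctr e))" using dim[of B] B(4) by simp
  then show ?thesis unfolding degree_over_Q_def F_def[symmetric] using R.dimension_is_inj[OF sF] by blast
qed

text \<open>A common value \<open>c\<close> of all embeddings means \<open>rc z = c\<close> times
  \<open>rc e\<close>. Comparing one nonzero coefficient of \<open>e\<close> shows that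
  \<open>c\<close> is rational.\<close>

lemma rational_if_constant:
  assumes e: "e \<in> PCI" and z: "z \<in> zcorner e"
    and c: "\<And>v w. v \<in> J (rc e) \<Longrightarrow> w \<in> J (rc e) \<Longrightarrow> lam v (rc z) = lam w (rc z)"
  obtains q where "z = fscale q e"
proof -
  obtain v where v: "v \<in> J (rc e)" using J_nonempty[OF rc_EQ[OF e]] by blast
  define c where "c = lam v (rc z)"
  have zK: "rc z \<in> K (rc e)" by (rule zcorner_K[OF e z])
  have eq: "rc z = fscale c (rc e)"
  proof (rule lam_ext)
    fix w :: "'a \<Rightarrow> complex" assume w: "w \<in> PCI"
    show "lam w (rc z) = lam w (fscale c (rc e))"
      using assms(3)[OF _ v, of w] lam_K_outside[OF rc_EQ[OF e] zK w] lam_EQ[OF rc_EQ[OF e] w] w PCI_D(1)[OF e]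
      by (auto simp: lam_scale c_def)
  qed (use z zcorner_zalg PCI_D(1)[OF e] in auto)
  obtain g where g: "e g \<noteq> 0" using PCI_D(3)[OF e] by (auto simp: fun_eq_iff)
  have "of_rat (z g) = c * of_rat (e g)" using fun_cong[OF eq, of g] by (simp add: rc_def fscale_apply)
  then have "c = of_rat (z g / e g)" using g by (simp add: of_rat_divide field_simps)
  then have "rc z = rc (fscale (z g / e g) e)" using eq by (simp add: rc_scale)
  then show ?thesis using that by simp
qed

section \<open>Rational and imaginary quadratic centres\<close>

lemma imaginary_quadratic_carrier:
  assumes "d > 0"
  shows "generate_field complex_ring (insert (csqrt (- of_nat d)) \<rat>)
    = {of_rat a + of_rat b * csqrt (- of_nat d) | a b. True}" (is "?L = ?R")
proof -
  interpret CR: field complex_ring by (rule field_from_type_algebra)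
  define s where "s = csqrt (- of_nat d)"
  have ss: "s * s = - of_nat d" unfolding s_def power2_eq_square[symmetric] by (rule power2_csqrt)
  have neg: "\<ominus>\<^bsub>complex_ring\<^esub> z = - z" for z by (rule CR.minus_equality) auto
  have inv: "inv\<^bsub>complex_ring\<^esub> z = inverse z" if "z \<noteq> 0" for z using that by (intro CR.comm_inv_char) auto
  show ?thesis
  proof (intro equalityI subsetI)
    fix z assume "z \<in> ?L"
    then show "z \<in> ?R" unfolding s_def[symmetric]
    proof induction
      case one
      have "\<one>\<^bsub>complex_ring\<^esub> = of_rat 1 + of_rat 0 * s" by simp
      then show ?case by blast
    next
      case (incl h)
      show ?case
      proof (cases "h = s")
        case True
        then have "h = of_rat 0 + of_rat 1 * s" by simp
        then show ?thesis by blast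
      next
        case False
        then obtain q where "h = of_rat q" using incl by (auto simp: Rats_def)
        then have "h = of_rat q + of_rat 0 * s" by simp
        then show ?thesis by blast
      qed
    next
      case (a_inv h)
      then obtain a b where "h = of_rat a + of_rat b * s" by auto
      then have "- h = of_rat (- a) + of_rat (- b) * s" by (simp add: of_rat_minus)
      then show ?case unfolding neg by blast
    next
      case (m_inv h)
      then obtain a b where h: "h = of_rat a + of_rat b * s" by auto
      \<comment> \<open>The norm of \<open>h\<close>; it vanishes only for \<open>h = 0\<close>
        because \<open>d > 0\<close>.\<close>
      define N where "N = a * a + of_nat d * (b * b)"
      have "N \<noteq> 0"
      proof
        assume "N = 0"
        then have "a = 0" "b = 0" using assms by (auto simp: N_def add_nonneg_eq_0_iff)
        then show False using m_inv(2) h by simp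
      qed
      have "h * (of_rat a - of_rat b * s) = of_rat a * of_rat a - of_rat b * of_rat b * (s * s)"
        by (simp add: h algebra_simps)
      also have "\<dots> = of_rat N" by (simp add: ss N_def of_rat_add of_rat_mult)
      finally have "h * (of_rat (a / N) + of_rat (- b / N) * s) = 1"
        using \<open>N \<noteq> 0\<close> by (simp add: of_rat_divide of_rat_minus field_simps)
      moreover have "h \<noteq> 0" using m_inv(2) by simp
      ultimately have "inverse h = of_rat (a / N) + of_rat (- b / N) * s" by (metis inverse_unique)
      then show ?case using inv[OF \<open>h \<noteq> 0\<close>] by auto
    next
      case (eng_add h1 h2)
      then obtain a b a' b' where "h1 = of_rat a + of_rat b * s" "h2 = of_rat a' + of_rat b' * s" by auto
      then have "h1 + h2 = of_rat (a + a') + of_rat (b + b') * s" by (simp add: of_rat_add algebra_simps)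
      then show ?case by auto
    next
      case (eng_mult h1 h2)
      then obtain a b a' b' where "h1 = of_rat a + of_rat b * s" "h2 = of_rat a' + of_rat b' * s" by auto
      then have "h1 * h2 = of_rat a * of_rat a' + of_rat b * of_rat b' * (s * s) + (of_rat a * of_rat b' + of_rat b * of_rat a') * s"
        by (simp add: algebra_simps)
      then have "h1 * h2 = of_rat (a * a' - of_nat d * (b * b')) + of_rat (a * b' + b * a') * s"
        by (simp add: ss of_rat_add of_rat_diff of_rat_mult)
      then show ?case by auto
    qed
  next
    fix z assume "z \<in> ?R"
    then obtain a b where z: "z = of_rat a + of_rat b * s" by (auto simp: s_def)
    have "of_rat a \<in> ?L" "of_rat b \<in> ?L" "s \<in> ?L" by (auto simp: s_def intro!: generate_field.incl)
    then show "z \<in> ?L"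
      using generate_field.eng_add[OF _ generate_field.eng_mult] z by fastforce
  qed
qed

lemma imaginary_carrier:
  "d > 0 \<Longrightarrow> carrier (imaginary_quadratic_field d) = {of_rat a + of_rat b * csqrt (- of_nat d) | a b. True}"
proof -
  assume d: "d > 0"
  have upd: "carrier (R\<lparr>carrier := S\<rparr>) = S" for R :: "complex ring" and S by simp
  show ?thesis unfolding imaginary_quadratic_field_def imaginary_quadratic_carrier[OF d] by (rule upd)
qed

text \<open>The field is spanned over the rationals by \<open>e\<close> and an element
  \<open>y\<close> whose values under all embeddings are purely imaginary with a common square. An
  embedding is determined by its value at \<open>y\<close>, which is unique up to sign, and
  \<open>bar\<close> changes the sign.\<close>

lemma one_place_if_imaginary:
  assumes e: "e \<in> PCI" and q: "rational_or_imaginary_quadratic (ctr e)"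
  shows "one_place (rc e)"
proof -
  note cl = zcorner_closed[OF e]
  \<comment> \<open>Covers both cases: for the rational field \<open>y = 0\<close> and
    \<open>c = 0\<close>, for an imaginary quadratic one \<open>y\<close> corresponds to the square
    root of \<open>-d\<close> and \<open>c = -d\<close>.\<close>
  have ex: "\<exists>y\<in>zcorner e. \<exists>c. (\<forall>v\<in>J (rc e). lam v (rc y) * lam v (rc y) = c \<and> cnj (lam v (rc y)) = - lam v (rc y)) \<and>
      (\<forall>z\<in>zcorner e. \<exists>a b. z = fscale a e + fscale b y)"
    using q unfolding rational_or_imaginary_quadratic_def
  proof
    assume "ctr e \<simeq> rat_ring"
    then obtain \<phi> where \<phi>: "\<phi> \<in> ring_iso (ctr e) rat_ring" by (auto simp: is_ring_iso_def)
    then have h: "\<phi> \<in> Ring.ring_hom (ctr e) ring_of_type_algebra" and inj: "inj_on \<phi> (res ` zcorner e)"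
      by (auto simp: ring_iso_def bij_betw_def ctr_simps[OF e])
    have "z = fscale (\<phi> (res z)) e + fscale 0 0" if z: "z \<in> zcorner e" for z
    proof -
      have "\<phi> (res (fscale (\<phi> (res z)) e)) = \<phi> (res z)"
        using hom_scale[OF e h cl(7), of "\<phi> (res z)"] ring_hom_memE(4)[OF h] by (simp add: ctr_simps[OF e])
      then have "res (fscale (\<phi> (res z)) e) = res z" using z by (intro inj_onD[OF inj] imageI cl(4)[OF cl(7)])
      then have "fscale (\<phi> (res z)) e = z" by (rule res_injD[OF zcorner_galg[OF cl(4)[OF cl(7)]] zcorner_galg[OF z]])
      then show ?thesis by simp
    qed
    then show ?thesis using cl(6) J_PCI by (intro bexI[of _ 0] exI[of _ 0]) auto
  next
    assume "\<exists>d>0. ctr e \<simeq> imaginary_quadratic_field d"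
    then obtain d \<phi> where d: "d > 0" and \<phi>: "\<phi> \<in> ring_iso (ctr e) (imaginary_quadratic_field d)"
      by (auto simp: is_ring_iso_def)
    define s where "s = csqrt (- of_nat d)"
    have cq: "carrier (imaginary_quadratic_field d) = {of_rat a + of_rat b * s | a b. True}"
      unfolding s_def by (rule imaginary_carrier[OF d])
    have ss: "s * s = - of_nat d" unfolding s_def power2_eq_square[symmetric] by (rule power2_csqrt)
    have h: "\<phi> \<in> Ring.ring_hom (ctr e) complex_ring"
    proof (rule ring_hom_memI)
      fix x y assume xy: "x \<in> carrier (ctr e)" "y \<in> carrier (ctr e)"
      show "\<phi> (x \<otimes>\<^bsub>ctr e\<^esub> y) = \<phi> x \<otimes>\<^bsub>complex_ring\<^esub> \<phi> y" "\<phi> (x \<oplus>\<^bsub>ctr e\<^esub> y) = \<phi> x \<oplus>\<^bsub>complex_ring\<^esub> \<phi> y"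
        using ring_iso_memE(2,3)[OF \<phi> xy] by (simp_all add: imaginary_quadratic_field_def)
    qed (use ring_iso_memE(4)[OF \<phi>] in \<open>simp_all add: imaginary_quadratic_field_def\<close>)
    have bij: "bij_betw \<phi> (res ` zcorner e) {of_rat a + of_rat b * s | a b. True}"
      using ring_iso_memE(5)[OF \<phi>] by (simp add: cq ctr_simps[OF e])
    have "s = of_rat 0 + of_rat 1 * s" by simp
    then have "s \<in> \<phi> ` res ` zcorner e" using bij unfolding bij_betw_def by blast
    then obtain y where y: "y \<in> zcorner e" "\<phi> (res y) = s" by blast
    have lin: "\<phi> (res (fscale a e + fscale b y)) = of_rat a + of_rat b * s" for a b
    proof -
      have "\<phi> (res (fscale a e + fscale b y)) = \<phi> (res (fscale a e)) + \<phi> (res (fscale b y))"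
        using ring_hom_memE(3)[OF h, of "res (fscale a e)" "res (fscale b y)"] cl(4,7) y(1) by (simp add: ctr_simps[OF e])
      then show ?thesis
        using hom_scale[OF e h cl(7)] hom_scale[OF e h y(1)] y(2) ring_hom_memE(4)[OF h] by (simp add: ctr_simps[OF e])
    qed
    have inj: "z = fscale a e + fscale b y" if "z \<in> zcorner e" "\<phi> (res z) = of_rat a + of_rat b * s" for z a b
    proof -
      have c: "fscale a e + fscale b y \<in> zcorner e" using cl(1,4,7) y(1) by blast
      have "\<phi> (res z) = \<phi> (res (fscale a e + fscale b y))" using that(2) lin by simp
      then have "res z = res (fscale a e + fscale b y)"
        by (rule inj_onD[OF bij_betw_imp_inj_on[OF bij] _ imageI[OF that(1)] imageI[OF c]])
      then show ?thesis by (rule res_injD[OF zcorner_galg[OF that(1)] zcorner_galg[OF c]])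
    qed
    have span: "\<exists>a b. z = fscale a e + fscale b y" if z: "z \<in> zcorner e" for z
    proof -
      have "\<phi> (res z) \<in> {of_rat a + of_rat b * s | a b. True}" using bij z by (auto simp: bij_betw_def)
      then show ?thesis using inj[OF z] by blast
    qed
    have "\<phi> (res (y \<star> y)) = of_rat (- of_nat d) + of_rat 0 * s"
      using ring_hom_memE(2)[OF h, of "res y" "res y"] y ss by (simp add: ctr_simps[OF e] of_rat_minus)
    then have yy: "y \<star> y = fscale (- of_nat d) e" using inj[OF cl(5)[OF y(1) y(1)]] by fastforce
    have "lam v (rc y) * lam v (rc y) = - of_nat d \<and> cnj (lam v (rc y)) = - lam v (rc y)" if v: "v \<in> J (rc e)" for v
    proof
      have "lam v (rc y) * lam v (rc y) = lam v (rc (y \<star> y))"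
        using zcorner_zalg[OF y(1)] J_PCI[OF v] by (simp add: rc_conv lam_mult)
      also have "\<dots> = - of_nat d"
        using J_PCI[OF v] lam_J[OF rc_EQ[OF e] v] PCI_D(1)[OF e] by (simp add: yy rc_scale lam_scale of_rat_minus del: fvs.scale_minus_left)
      finally show sq: "lam v (rc y) * lam v (rc y) = - of_nat d" .
      define t where "t = lam v (rc y)"
      have "Re t * Re t - Im t * Im t = - real d" "Re t * Im t = 0"
        using arg_cong[OF sq, of Re] arg_cong[OF sq, of Im] by (simp_all add: t_def mult.commute)
      then have "Re t = 0" using d zero_le_square[of "Re t"] by (cases "Im t = 0") auto
      then show "cnj (lam v (rc y)) = - lam v (rc y)" by (simp add: t_def complex_eq_iff)
    qed
    then show ?thesis using y(1) span by blast
  qed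
  then obtain y c where y: "y \<in> zcorner e"
    "\<And>v. v \<in> J (rc e) \<Longrightarrow> lam v (rc y) * lam v (rc y) = c \<and> cnj (lam v (rc y)) = - lam v (rc y)"
    "\<And>z. z \<in> zcorner e \<Longrightarrow> \<exists>a b. z = fscale a e + fscale b y" by blast
  have eqI: "v = w" if v: "v \<in> J (rc e)" and w: "w \<in> J (rc e)" and eq: "lam v (rc y) = lam w (rc y)" for v w
  proof (rule J_ext[OF e v w])
    fix z assume "z \<in> zcorner e"
    then obtain a b where z: "z = fscale a e + fscale b y" using y(3) by blast
    show "lam v (rc z) = lam w (rc z)"
      using v w eq J_PCI zcorner_zalg[OF y(1)] PCI_D(1)[OF e] lam_J[OF rc_EQ[OF e]]
      by (simp add: z rc_add rc_scale lam_add lam_scale)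
  qed
  show ?thesis unfolding one_place_def
  proof (intro ballI subsetI)
    fix v w assume v: "v \<in> J (rc e)" and w: "w \<in> J (rc e)"
    have "lam w (rc y) * lam w (rc y) = lam v (rc y) * lam v (rc y)" using y(2) v w by metis
    then have "lam w (rc y) = lam v (rc y) \<or> lam w (rc y) = - lam v (rc y)"
      by (metis power2_eq_iff power2_eq_square)
    moreover have "lam (bar v) (rc y) = - lam v (rc y)"
      using lam_bar_rz[OF J_PCI[OF v] K_rz[OF zcorner_K[OF e y(1)]]] y(2)[OF v] by simp
    ultimately show "w \<in> {v, bar v}" using eqI[OF w v] eqI[OF w bar_J[OF rc_EQ[OF e] v]] by auto
  qed
qed

text \<open>An element with a real value at \<open>v\<close> has the same value at
  \<open>bar v\<close>, hence is rational by \<open>rational_if_constant\<close>. If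
  \<open>v\<close> is real, this applies to the whole field. Otherwise it applies to the square of a
  purely imaginary element, whose multiple \<open>Y\<close> becomes the square root of
  \<open>-d\<close>.\<close>

lemma imaginary_if_one_place:
  assumes e: "e \<in> PCI" and one: "one_place (rc e)"
  shows "rational_or_imaginary_quadratic (ctr e)"
proof -
  note cl = zcorner_closed[OF e] and \<epsilon> = rc_EQ[OF e]
  obtain v where v: "v \<in> J (rc e)" using J_nonempty[OF \<epsilon>] by blast
  have J: "J (rc e) = {v, bar v}" using one v bar_J[OF \<epsilon> v] by (auto simp: one_place_def)
  define \<phi> where "\<phi> r = lam v (rc (unr r))" for r
  have \<phi>: "\<phi> \<in> Ring.ring_hom (ctr e) complex_ring" using emb_hom[OF e v] by (simp add: \<phi>_def[abs_def])
  have \<phi>res: "\<phi> (res x) = lam v (rc x)" if "x \<in> zcorner e" for x using zcorner_galg[OF that] by (simp add: \<phi>_def)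
  have inj: "inj_on \<phi> (carrier (ctr e))"
  proof (rule inj_onI)
    fix r s assume "r \<in> carrier (ctr e)" "s \<in> carrier (ctr e)" "\<phi> r = \<phi> s"
    then obtain x y where "x \<in> zcorner e" "r = res x" "y \<in> zcorner e" "s = res y" "lam v (rc x) = lam v (rc y)"
      using \<phi>res by (auto simp: ctr_simps[OF e])
    then show "r = s" using K_ext[OF \<epsilon> zcorner_K[OF e] zcorner_K[OF e] v] by auto
  qed
  have bl: "lam (bar v) (rc x) = cnj (lam v (rc x))" if "x \<in> zcorner e" for x
    using lam_bar_rz[OF J_PCI[OF v] K_rz[OF zcorner_K[OF e that]]] .
  have rat: "\<exists>q. z = fscale q e" if z: "z \<in> zcorner e" "cnj (lam v (rc z)) = lam v (rc z)" for z
  proof -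
    have "lam w (rc z) = lam v (rc z)" if "w \<in> J (rc e)" for w using that bl[OF z(1)] z(2) by (auto simp: J)
    then show ?thesis using rational_if_constant[OF e z(1)] by metis
  qed
  have \<phi>e: "\<phi> (res (fscale q e)) = of_rat q" for q
    using \<phi>res[OF cl(4)[OF cl(7)]] lam_J[OF \<epsilon> v] J_PCI[OF v] PCI_D(1)[OF e] by (simp add: rc_scale lam_scale)
  show ?thesis
  proof (cases "bar v = v")
    case True
    have all: "\<exists>q. z = fscale q e" if "z \<in> zcorner e" for z using rat[OF that] bl[OF that] True by simp
    define f where "f r = (THE q. \<phi> r = of_rat q)" for r
    have f: "f (res (fscale q e)) = q" for q unfolding f_def \<phi>e by (rule the_equality) auto
    have ee: "fscale p e \<star> fscale q e = fscale (p * q) e" for p q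
      by (simp add: conv_scale_left conv_scale_right PCI_D(2)[OF e])
    have car: "\<exists>q. r = res (fscale q e)" if "r \<in> carrier (ctr e)" for r
      using that all by (auto simp: ctr_simps[OF e])
    have "f \<in> ring_iso (ctr e) rat_ring"
    proof (rule ring_iso_memI)
      fix r s assume "r \<in> carrier (ctr e)" "s \<in> carrier (ctr e)"
      then obtain p q where pq: "r = res (fscale p e)" "s = res (fscale q e)" using car by metis
      show "f (r \<otimes>\<^bsub>ctr e\<^esub> s) = f r \<otimes>\<^bsub>rat_ring\<^esub> f s" "f (r \<oplus>\<^bsub>ctr e\<^esub> s) = f r \<oplus>\<^bsub>rat_ring\<^esub> f s"
        by (simp_all add: pq ctr_simps[OF e] ee f fvs.scale_left_distrib[symmetric])
    next
      show "f \<one>\<^bsub>ctr e\<^esub> = \<one>\<^bsub>rat_ring\<^esub>" using f[of 1] by (simp add: ctr_simps[OF e] fvs.scale_one)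
      show "bij_betw f (carrier (ctr e)) (carrier rat_ring)"
      proof (rule bij_betw_imageI)
        show "inj_on f (carrier (ctr e))"
        proof (rule inj_onI)
          fix r s assume rs: "r \<in> carrier (ctr e)" "s \<in> carrier (ctr e)" "f r = f s"
          then obtain p q where "r = res (fscale p e)" "s = res (fscale q e)" using car by metis
          then show "r = s" using rs(3) f by metis
        qed
        have "q \<in> f ` carrier (ctr e)" for q
          using f[of q] cl(4)[OF cl(7), of q] by (auto simp: ctr_simps[OF e] intro!: image_eqI[of _ f "res (fscale q e)"])
        then show "f ` carrier (ctr e) = carrier rat_ring" by auto
      qed
    qed simp
    then show ?thesis by (auto simp: rational_or_imaginary_quadratic_def is_ring_iso_def)
  next
    case False
    then obtain y0 where y0: "y0 \<in> zcorner e" "lam v (rc y0) \<noteq> cnj (lam v (rc y0))"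
      using J_ext[OF e v bar_J[OF \<epsilon> v]] bl by metis
    have star: "\<exists>x'\<in>zcorner e. lam v (rc x') = cnj (lam v (rc x))" if x: "x \<in> zcorner e" for x
    proof -
      obtain x' where "x' \<in> zcorner e" "C.star (rc x) = rc x'" using K_zcorner[OF K_star[OF \<epsilon> zcorner_K[OF e x]]] by blast
      then show ?thesis using lam_star[OF J_PCI[OF v], of "rc x"] zcorner_zalg[OF x] by (intro bexI[of _ x']) auto
    qed
    obtain y0' where y0': "y0' \<in> zcorner e" "lam v (rc y0') = cnj (lam v (rc y0))" using star[OF y0(1)] by blast
    note lsimps = lam_diff lam_add lam_scale lam_mult rc_diff rc_add rc_scale rc_conv zcorner_zalg J_PCI[OF v]
    \<comment> \<open>Subtracting the image under the involution leaves twice the imaginary part, so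
      that the square of \<open>y\<close> has a negative real value.\<close>
    define y where "y = y0 - y0'"
    have y: "y \<in> zcorner e" using cl(2) y0(1) y0'(1) by (simp add: y_def)
    have ly: "lam v (rc y) = lam v (rc y0) - cnj (lam v (rc y0))"
      using y0(1) y0' by (simp add: y_def lsimps)
    have ly_im: "lam v (rc y) = \<i> * of_real (2 * Im (lam v (rc y0)))" unfolding ly by (simp add: complex_eq_iff)
    define s where "s = 2 * Im (lam v (rc y0))"
    have s0: "s \<noteq> 0" using y0(2) by (auto simp: s_def complex_eq_iff)
    have lyy: "lam v (rc (y \<star> y)) = - of_real (s * s)" using y by (simp add: lsimps ly_im s_def)
    then obtain q where q: "y \<star> y = fscale q e" using rat[OF cl(5)[OF y y]] by auto
    have qs: "of_rat q = - complex_of_real (s * s)"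
      using lyy lam_J[OF \<epsilon> v] PCI_D(1)[OF e] by (simp add: q lsimps)
    have "complex_of_real (of_rat q) = of_rat q"
      by (cases q) (simp add: of_rat_rat)
    then have "of_rat q = - (s * s)" using qs by (metis of_real_eq_iff of_real_minus)
    moreover have "s * s > 0" using s0 by (metis not_real_square_gt_zero)
    ultimately have "q < 0" by (metis neg_less_0_iff_less of_rat_less_0_iff)
    obtain a b where ab: "quotient_of (- q) = (a, b)" by (cases "quotient_of (- q)")
    have b: "b > 0" using quotient_of_denom_pos[OF ab] .
    have qa: "- q = of_int a / of_int b" using quotient_of_div[OF ab] .
    have a: "a > 0" using \<open>q < 0\<close> qa b by (metis neg_0_less_iff_less of_int_0_less_iff zero_less_divide_iff order.asym)
    \<comment> \<open>With the square of \<open>y\<close> equal to \<open>- a / b\<close>, the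
      element \<open>b y\<close> has square \<open>- a b\<close>, an integer.\<close>
    define d where "d = nat (a * b)"
    have d: "d > 0" "of_nat d = (of_int a * of_int b :: rat)" using a b by (auto simp: d_def)
    \<comment> \<open>\<open>csqrt\<close> of a negative number has positive imaginary part; the
      sign makes the value of \<open>Y\<close> match it.\<close>
    define sg where "sg = (if s > 0 then 1 else - 1 :: rat)"
    define Y where "Y = fscale (sg * of_int b) y"
    have Y: "Y \<in> zcorner e" using cl(4)[OF y] by (simp add: Y_def)
    have sg2: "sg * sg = 1" by (simp add: sg_def)
    have "Y \<star> Y = fscale ((sg * sg) * (of_int b * of_int b * q)) e"
      by (simp add: Y_def conv_scale_left conv_scale_right q mult_ac)
    also have "(sg * sg) * (of_int b * of_int b * q) = - of_nat d"
    proof -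
      have "of_int b * q = - of_int a" using qa b by (simp add: field_simps)
      then show ?thesis unfolding sg2 d(2) by (simp add: mult.assoc)
    qed
    finally have YY: "Y \<star> Y = fscale (- of_nat d) e" .
    define t where "t = \<bar>s\<bar> * of_int b"
    have t0: "t > 0" using s0 b by (simp add: t_def)
    have lY: "lam v (rc Y) = \<i> * of_real t"
      using y b s0 by (auto simp: Y_def lsimps ly_im s_def[symmetric] sg_def t_def of_rat_minus)
    have "lam v (rc (Y \<star> Y)) = - of_nat d"
      using lam_J[OF \<epsilon> v] PCI_D(1)[OF e] by (simp add: YY lsimps of_rat_minus del: fvs.scale_minus_left)
    then have "(lam v (rc Y))\<^sup>2 = - of_nat d" using Y by (simp add: lsimps power2_eq_square)
    moreover define rt where "rt = csqrt (- of_nat d)"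
    ultimately have cs: "rt = lam v (rc Y)" unfolding rt_def using t0 by (intro csqrt_unique) (auto simp: lY)
    \<comment> \<open>Let \<open>z'\<close> be the conjugate of \<open>z\<close>. Then
      \<open>z + z'\<close> and \<open>(z - z') \<star> Y\<close> have real values, hence are
      rational, and \<open>Y\<close> is inverted by means of \<open>YY\<close>.\<close>
    have span: "\<exists>a b. z = fscale a e + fscale b Y" if z: "z \<in> zcorner e" for z
    proof -
      obtain z' where z': "z' \<in> zcorner e" "lam v (rc z') = cnj (lam v (rc z))" using star[OF z] by blast
      obtain p where p: "z + z' = fscale p e"
        using rat[OF cl(1)[OF z z'(1)]] z z' by (auto simp: lsimps)
      have "cnj (lam v (rc ((z - z') \<star> Y))) = lam v (rc ((z - z') \<star> Y))"
        using z z' Y by (simp add: lsimps lY cl(2) algebra_simps)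
      then obtain r where r: "(z - z') \<star> Y = fscale r e" using rat[OF cl(5)[OF cl(2)[OF z z'(1)] Y]] by blast
      have "(z - z') \<star> (Y \<star> Y) = fscale r Y"
        using r zcorner_id[OF Y] zalg_commute[OF PCI_D(1)[OF e], of Y]
        by (simp add: conv_assoc[symmetric] conv_scale_left)
      moreover have "(z - z') \<star> (Y \<star> Y) = fscale (- of_nat d) (z - z')"
        unfolding YY conv_scale_right using zcorner_id[OF cl(2)[OF z z'(1)]] by simp
      ultimately have "fscale (- of_nat d) (z - z') = fscale r Y" by simp
      then have "fscale (1 / - of_nat d) (fscale (- of_nat d) (z - z')) = fscale (1 / - of_nat d) (fscale r Y)" by simp
      then have m: "z - z' = fscale (- r / of_nat d) Y" using d(1) by (simp add: fvs.scale_scale fvs.scale_one)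
      have "z = fscale (1/2) ((z + z') + (z - z'))" by (simp add: fun_eq_iff fscale_apply)
      also have "\<dots> = fscale (1/2 * p) e + fscale (1/2 * (- r / of_nat d)) Y"
        unfolding p m by (simp only: fvs.scale_right_distrib fvs.scale_scale)
      finally show ?thesis by blast
    qed
    have lin: "\<phi> (res (fscale a e + fscale b Y)) = of_rat a + of_rat b * rt" for a b
      using cl(1)[OF cl(4)[OF cl(7)] cl(4)[OF Y]] \<phi>res Y lam_J[OF \<epsilon> v] PCI_D(1)[OF e] by (simp add: lsimps cs)
    have cq: "carrier (imaginary_quadratic_field d) = {of_rat a + of_rat b * rt | a b. True}"
      unfolding rt_def by (rule imaginary_carrier[OF d(1)])
    have img: "\<phi> ` carrier (ctr e) = carrier (imaginary_quadratic_field d)"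
    proof (intro equalityI subsetI)
      fix c assume "c \<in> \<phi> ` carrier (ctr e)"
      then obtain z where "z \<in> zcorner e" "c = \<phi> (res z)" by (auto simp: ctr_simps[OF e])
      then show "c \<in> carrier (imaginary_quadratic_field d)" using span lin unfolding cq by blast
    next
      fix c assume "c \<in> carrier (imaginary_quadratic_field d)"
      then obtain a b where "c = \<phi> (res (fscale a e + fscale b Y))" unfolding cq lin by blast
      then show "c \<in> \<phi> ` carrier (ctr e)"
        using cl(1)[OF cl(4)[OF cl(7)] cl(4)[OF Y]] by (auto simp: ctr_simps[OF e])
    qed
    have "\<phi> \<in> ring_iso (ctr e) (imaginary_quadratic_field d)"
    proof (rule ring_iso_memI)
      fix r s assume rs: "r \<in> carrier (ctr e)" "s \<in> carrier (ctr e)"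
      show "\<phi> r \<in> carrier (imaginary_quadratic_field d)" using img rs(1) by blast
      show "\<phi> (r \<otimes>\<^bsub>ctr e\<^esub> s) = \<phi> r \<otimes>\<^bsub>imaginary_quadratic_field d\<^esub> \<phi> s"
        "\<phi> (r \<oplus>\<^bsub>ctr e\<^esub> s) = \<phi> r \<oplus>\<^bsub>imaginary_quadratic_field d\<^esub> \<phi> s"
        using ring_hom_memE(2,3)[OF \<phi> rs] by (simp_all add: imaginary_quadratic_field_def)
    next
      show "\<phi> \<one>\<^bsub>ctr e\<^esub> = \<one>\<^bsub>imaginary_quadratic_field d\<^esub>"
        using ring_hom_memE(4)[OF \<phi>] by (simp add: imaginary_quadratic_field_def)
      show "bij_betw \<phi> (carrier (ctr e)) (carrier (imaginary_quadratic_field d))"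
        using inj img by (rule bij_betw_imageI)
    qed
    then show ?thesis using d(1) by (auto simp: rational_or_imaginary_quadratic_def is_ring_iso_def)
  qed
qed

text \<open>By \<open>J_real_dichotomy\<close> the places are all real, with one embedding each, or
  all complex, with two each. So two places amount to two embeddings in the real case and four in
  the complex one.\<close>

lemma two_places_iff:
  assumes e: "e \<in> PCI"
  shows "real_quadratic (ctr e) \<or> totally_complex_quartic (ctr e) \<longleftrightarrow> two_places (rc e)"
proof -
  note \<epsilon> = rc_EQ[OF e]
  have rq: "real_quadratic (ctr e) \<longleftrightarrow> card (J (rc e)) = 2 \<and> (\<exists>v\<in>J (rc e). bar v = v)"
    unfolding real_quadratic_def using degree_iff[OF e] real_embedding_iff[OF e] field_ctr[OF e] by auto
  have tq: "totally_complex_quartic (ctr e) \<longleftrightarrow> card (J (rc e)) = 4 \<and> \<not> (\<exists>v\<in>J (rc e). bar v = v)"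
    unfolding totally_complex_quartic_def using degree_iff[OF e] real_embedding_iff[OF e] field_ctr[OF e] by auto
  show ?thesis
  proof
    assume "two_places (rc e)"
    then obtain v w where vw: "v \<in> J (rc e)" "w \<in> J (rc e)" "w \<notin> {v, bar v}" "J (rc e) = {v, bar v, w, bar w}"
      by (auto simp: two_places_def)
    show "real_quadratic (ctr e) \<or> totally_complex_quartic (ctr e)"
    proof (cases "\<exists>v\<in>J (rc e). bar v = v")
      case True
      then have "bar v = v" "bar w = w" using J_real_dichotomy[OF \<epsilon>] vw by blast+
      then have "card (J (rc e)) = 2" using vw by auto
      then show ?thesis using True rq by blast
    next
      case False
      then have "bar v \<noteq> v" "bar w \<noteq> w" using vw by blast+
      moreover have "bar w \<noteq> v" "bar w \<noteq> bar v" using vw(3) by auto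
      ultimately have "card {v, bar v, w, bar w} = 4" using vw(3) by (auto simp: card_insert_if)
      then show ?thesis using False tq vw(4) by simp
    qed
  next
    assume "real_quadratic (ctr e) \<or> totally_complex_quartic (ctr e)"
    then show "two_places (rc e)"
    proof
      assume "real_quadratic (ctr e)"
      then obtain v where v: "card (J (rc e)) = 2" "v \<in> J (rc e)" "bar v = v" using rq by blast
      then obtain w where w: "J (rc e) = {v, w}" "w \<noteq> v" by (auto simp: card_2_iff doubleton_eq_iff)
      have "bar w = w" using J_real_dichotomy[OF \<epsilon> v(2,3)] w by blast
      then show ?thesis unfolding two_places_def using v w by auto
    next
      assume "totally_complex_quartic (ctr e)"
      then have c: "card (J (rc e)) = 4" and nr: "\<And>v. v \<in> J (rc e) \<Longrightarrow> bar v \<noteq> v" using tq by auto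
      obtain v where v: "v \<in> J (rc e)" using J_nonempty[OF \<epsilon>] by blast
      have "\<not> J (rc e) \<subseteq> {v, bar v}"
      proof
        assume "J (rc e) \<subseteq> {v, bar v}"
        then have "card (J (rc e)) \<le> card {v, bar v}" by (intro card_mono) auto
        also have "\<dots> \<le> 2" by (auto simp: card_insert_if)
        finally show False using c by simp
      qed
      then obtain w where w: "w \<in> J (rc e)" "w \<notin> {v, bar v}" by blast
      have ne: "bar w \<noteq> v" "bar w \<noteq> bar v" using w(2) by auto
      have "{v, bar v, w, bar w} \<subseteq> J (rc e)" using v w bar_J[OF \<epsilon>] by auto
      moreover have "card {v, bar v, w, bar w} = 4" using nr[OF v] nr[OF w(1)] w(2) ne by (auto simp: card_insert_if)
      ultimately have "{v, bar v, w, bar w} = J (rc e)" using c by (intro card_subset_eq) auto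
      then show ?thesis unfolding two_places_def using v w by auto
    qed
  qed
qed

lemma ecut_components:
  "ecut G \<longleftrightarrow> (\<forall>B \<in> simple_components QG. rational_or_imaginary_quadratic (centre (component_ring QG B))) \<or>
    (\<exists>B0 \<in> simple_components QG.
      (real_quadratic (centre (component_ring QG B0)) \<or> totally_complex_quartic (centre (component_ring QG B0))) \<and>
      (\<forall>B \<in> simple_components QG - {B0}. rational_or_imaginary_quadratic (centre (component_ring QG B))))"
proof -
  have one: "rational_or_imaginary_quadratic (ctr e) \<longleftrightarrow> one_place (rc e)" if "e \<in> PCI" for e
    using one_place_if_imaginary imaginary_if_one_place that by blast
  \<comment> \<open>Distinct idempotents give distinct ideals, so omitting one component is the same
    as omitting one idempotent.\<close>
  have diff: "simple_components QG - {component e} = component ` (PCI - {e})" "EQ - {rc e} = rc ` (PCI - {e})"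
    if "e \<in> PCI" for e
    using that component_inj by (auto simp: simple_components_QG EQ_def)
  have "ecut G \<longleftrightarrow> (\<forall>\<epsilon>\<in>EQ. one_place \<epsilon>) \<or> (\<exists>\<epsilon>\<in>EQ. two_places \<epsilon> \<and> (\<forall>\<delta>\<in>EQ - {\<epsilon>}. one_place \<delta>))"
    using ecut_imp_places places_imp_ecut by blast
  also have "\<dots> \<longleftrightarrow> (\<forall>e\<in>PCI. one_place (rc e)) \<or>
      (\<exists>e\<in>PCI. two_places (rc e) \<and> (\<forall>\<delta>\<in>EQ - {rc e}. one_place \<delta>))"
    by (simp add: EQ_def)
  also have "\<dots> \<longleftrightarrow> (\<forall>e\<in>PCI. one_place (rc e)) \<or>
      (\<exists>e\<in>PCI. two_places (rc e) \<and> (\<forall>f\<in>PCI - {e}. one_place (rc f)))"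
    by (intro disj_cong bex_cong conj_cong refl) (simp only: diff ball_simps)
  also have "\<dots> \<longleftrightarrow> (\<forall>e\<in>PCI. rational_or_imaginary_quadratic (ctr e)) \<or>
      (\<exists>e\<in>PCI. (real_quadratic (ctr e) \<or> totally_complex_quartic (ctr e)) \<and>
        (\<forall>f\<in>PCI - {e}. rational_or_imaginary_quadratic (ctr f)))"
    by (intro disj_cong bex_cong ball_cong conj_cong refl) (auto simp: one two_places_iff)
  also have "\<dots> \<longleftrightarrow> (\<forall>e\<in>PCI. rational_or_imaginary_quadratic (ctr e)) \<or>
      (\<exists>e\<in>PCI. (real_quadratic (ctr e) \<or> totally_complex_quartic (ctr e)) \<and>
        (\<forall>B\<in>simple_components QG - {component e}. rational_or_imaginary_quadratic (centre (component_ring QG B))))"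
    by (intro disj_cong bex_cong conj_cong refl) (simp only: diff ball_simps)
  finally show ?thesis by (simp add: simple_components_QG)
qed

end

theorem theorem3p5:
  fixes G :: "('a, 'b) monoid_scheme"
  assumes "group G" and "finite (carrier G)"
  shows "ecut G \<longleftrightarrow>
    (let QG = rational_group_ring G; Z = (\<lambda>B. centre (component_ring QG B)) in
      (\<forall>B \<in> simple_components QG. rational_or_imaginary_quadratic (Z B)) \<or>
      (\<exists>B0 \<in> simple_components QG.
         (real_quadratic (Z B0) \<or> totally_complex_quartic (Z B0)) \<and>
         (\<forall>B \<in> simple_components QG - {B0}. rational_or_imaginary_quadratic (Z B))))"
proof -
  interpret G: group G by (rule assms(1))
  interpret fin_group G by unfold_locales (rule assms(2))
  show ?thesis unfolding Let_def by (rule ecut_components)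
qed

end
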